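(* Let $p\in(1,\infty)$ and let $(K,d,m)$ be the Sierpiński carpet. Let $(\mathcal E_p,\mathcal F_p)$ be the self-similar $p$-energy and Sobolev space, $d_{\mathrm w}(p)=\frac{\log(8\rho(p))}{\log3}$, and $\Gamma_p\langle\cdot\rangle$ the associated $p$-energy measures (see context). Then there exist $C,A\ge1$ such that for all $x\in K$, $r>0$ and $f\in\mathcal F_p$, $$\int_{B_d(x,r)}|f-f_{B_d(x,r)}|^p\,dm\le C\,r^{d_{\mathrm w}(p)}\int_{B_d(x,Ar)}d\Gamma_p\langle f\rangle,$$ and $$\inf\{\mathcal E_p(g): g\in\mathcal F_p\cap C(K),\ g|_{B_d(x,r)}\equiv1,\ \operatorname{supp}[g]\subseteq B_d(x,2r)\}\le C\,\frac{m(B_d(x,r))}{r^{d_{\mathrm w}(p)}},$$ where $f_{B_d(x,r)}:=\frac1{m(B_d(x,r))}\int_{B_d(x,r)}f\,dm$.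
   Context: Sierpiński carpet: let $q_1=(-1,-1)$, $q_2=(0,-1)$, $q_3=(1,-1)$, $q_4=(1,0)$, $q_5=(1,1)$, $q_6=(0,1)$, $q_7=(-1,1)$, $q_8=(-1,0)$ in $\mathbb R^2$, $S=\{1,\dots,8\}$, $f_i(x)=\frac13(x-q_i)+q_i$. $K$ is the unique non-empty compact subset of $\mathbb R^2$ with $K=\bigcup_{i\in S}f_i(K)$; $F_i:=f_i|_K$; $F_w:=F_{w_1}\circ\cdots\circ F_{w_n}$ for $w\in S^n$. $d$ is the Euclidean metric on $K$, $B_d(x,r)=\{y\in K:d(x,y)<r\}$, and $m$ is the self-similar Borel probability measure with $m(F_w(K))=8^{-n}$ for $w\in S^n$. $\mathbb N$ = positive integers. $\mathbb G_n=(V_n,E_n)$: $V_n=S^n$, $E_n=\{\{u,v\}:u\ne v\in V_n,\ F_u(K)\cap F_v(K)\ne\emptyset\}$, with graph distance $d_n$; $\mathcal E_p^{\mathbb G_n}(g)=\sum_{\{u,v\}\in E_n}|g(u)-g(v)|^p$; $(M_nf)(u)=\frac1{m(F_u(K))}\int_{F_u(K)}f\,dm$. $D_4$ is the order-$8$ dihedral group of linear symmetries of $[-1,1]^2$. Scaling constant: for $m,n\in\mathbb N$ and $w\in V_m$ let $S^n(w)\subset V_{n+m}$ be the words whose first $m$ letters form $w$. Let $c_n(w)=\inf\{\mathcal E_p^{\mathbb G_{n+m}}(g): g=0\text{ on }S^n(w),\ g=1\text{ on }V_{n+m}\setminus\bigcup_{v\in V_m,\,d_m(v,w)\le1}S^n(v)\}$,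 $\mathcal C_p^{(n)}=\sup_{m\in\mathbb N,w\in V_m}c_n(w)$, and $\rho(p):=\lim_{n\to\infty}(\mathcal C_p^{(n)})^{-1/n}\in(0,\infty)$ (the limit exists). Sobolev space: $|f|_{\mathcal F_p}=(\sup_{n\in\mathbb N}\rho(p)^n\mathcal E_p^{\mathbb G_n}(M_nf))^{1/p}$, $\mathcal F_p=\{f\in L^p(K,m):|f|_{\mathcal F_p}<\infty\}$, $\|f\|_{\mathcal F_p}=\|f\|_{L^p}+|f|_{\mathcal F_p}$; this is a reflexive separable Banach space in which $\mathcal F_p\cap C(K)$ is dense, and $\mathcal F_p\cap C(K)$ is dense in $C(K)$. Self-similar $p$-energy: $\mathcal E_p:\mathcal F_p\to[0,\infty)$ is a fixed functional with the following properties, for some constant $C_0\ge1$ (such a functional exists): $\mathcal E_p^{1/p}$ is a uniformly convex semi-norm with $C_0^{-1}|f|_{\mathcal F_p}\le\mathcal E_p(f)^{1/p}\le C_0|f|_{\mathcal F_p}$; for $1$-Lipschitz $\varphi:\mathbb R\to\mathbb R$, $\varphi\circ f\in\mathcal F_p$ and $\mathcal E_p(\varphi\circ f)\le\mathcal E_p(f)$; $\|f-\int_Kf\,dm\|_{L^p}^p\le C_0\mathcal E_p(f)$, and $\mathcal E_p(f)=0$ iff $f$ is constant $m$-a.e.; $\mathcal E_p(f+g+h)+\mathcal E_p(h)=\mathcal E_p(f+h)+\mathcal E_p(g+h)$ whenever the supports of $f\,dm$ and $(g-a)\,dm$ are disjoint for some $a\in\mathbb R$; $f\circ F_i\in\mathcal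 F_p$ and $\mathcal E_p(f)=\rho(p)\sum_{i\in S}\mathcal E_p(f\circ F_i)$, and $\mathcal F_p\cap C(K)=\{f\in C(K):f\circ F_i\in\mathcal F_p\ \forall i\in S\}$; $f\circ\Phi\in\mathcal F_p$ and $\mathcal E_p(f\circ\Phi)=\mathcal E_p(f)$ for $\Phi\in D_4$. Energy measures: let $\Sigma=S^{\mathbb N}$ (product topology), $\chi:\Sigma\to K$ with $\{\chi(\omega)\}=\bigcap_nF_{\omega_1\cdots\omega_n}(K)$, and $\Sigma_w$ the set of sequences beginning with $w$. For $f\in\mathcal F_p$ let $\mathfrak m_p\langle f\rangle$ be the finite Borel measure on $\Sigma$ with $\mathfrak m_p\langle f\rangle(\Sigma_w)=\rho(p)^n\mathcal E_p(f\circ F_w)$ for $w\in S^n$ (it exists and is unique by self-similarity and Kolmogorov's extension theorem); $\Gamma_p\langle f\rangle:=\chi_*\mathfrak m_p\langle f\rangle$. *)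

theory Defs
  imports "HOL-Probability.Probability"
begin

section \<open>The Sierpinski carpet\<close>

definition carpet_pt :: "nat \<Rightarrow> real \<times> real" where
  "carpet_pt i = [(-1,-1), (0,-1), (1,-1), (1,0), (1,1), (0,1), (-1,1), (-1,0)] ! (i - 1)"

definition carpet_map :: "nat \<Rightarrow> real \<times> real \<Rightarrow> real \<times> real" where
  "carpet_map i x = (1/3) *\<^sub>R (x - carpet_pt i) + carpet_pt i"

definition carpet :: "(real \<times> real) set" where
  "carpet = (THE K. compact K \<and> K \<noteq> {} \<and> K = (\<Union>i\<in>{1..8}. carpet_map i ` K))"

lemma carpet_map_dist: "dist (carpet_map i x) (carpet_map i y) = dist x y / 3"
proof -
  have "carpet_map i x - carpet_map i y = (1/3) *\<^sub>R (x - y)"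
    by (simp add: carpet_map_def algebra_simps)
  then show ?thesis by (simp add: dist_norm)
qed

lemma carpet_map_continuous: "continuous_on A (carpet_map i)"
  unfolding carpet_map_def by (intro continuous_intros)

lemma carpet_map_inj: "inj (carpet_map i)"
  by (auto simp: inj_on_def carpet_map_def)

lemma carpet_ex1: "\<exists>!K. compact K \<and> K \<noteq> {} \<and> K = (\<Union>i\<in>{1..8}. carpet_map i ` K)"
proof (rule ex_ex1I)
  define T where "T X = (\<Union>i\<in>{1..8}. carpet_map i ` X)" for X :: "(real \<times> real) set"
  define Q where "Q n = (T ^^ n) (cbox (-1,-1) (1,1))" for n
  have Q_Suc: "Q (Suc n) = T (Q n)" for n by (simp add: Q_def)
  have T_mono: "T X \<subseteq> T Y" if "X \<subseteq> Y" for X Y using that by (auto simp: T_def)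
  have pt: "carpet_pt i \<in> cbox (-1,-1) (1,1)" if "i \<in> {1..8}" for i
  proof -
    from that have "i \<in> {1,2,3,4,5,6,7,8}" by auto
    then show ?thesis by (auto simp: carpet_pt_def cbox_Pair_iff numeral_eq_Suc)
  qed
  have "carpet_map i x \<in> cbox (-1,-1) (1,1)"
    if "i \<in> {1..8}" "x \<in> cbox (-1,-1) (1,1)" for i x
    using pt[OF that(1)] that(2)
    by (cases x; cases "carpet_pt i") (auto simp: carpet_map_def cbox_Pair_iff field_simps)
  then have "T (cbox (-1,-1) (1,1)) \<subseteq> cbox (-1,-1) (1,1)" unfolding T_def by blast
  then have "Q (Suc 0) \<subseteq> Q 0" by (simp add: Q_def)
  then have Q_dec1: "Q (Suc n) \<subseteq> Q n" for n
    by (induction n) (auto simp: Q_Suc dest: T_mono)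
  have Q_dec: "Q n \<subseteq> Q m" if "m \<le> n" for m n
    using lift_Suc_antimono_le[of Q, OF Q_dec1 that] .
  have Q_comp: "compact (Q n)" for n
  proof (induction n)
    case (Suc n)
    then show ?case unfolding Q_Suc T_def
      by (intro compact_UN finite_atLeastAtMost compact_continuous_image
            carpet_map_continuous)
  qed (simp add: Q_def)
  have fp: "carpet_map 1 (-1,-1) = (-1,-1)" by (simp add: carpet_map_def carpet_pt_def)
  have Q_pt: "(-1,-1) \<in> Q n" for n
  proof (induction n)
    case (Suc n)
    then have "carpet_map 1 (-1,-1) \<in> T (Q n)" unfolding T_def by force
    then show ?case using fp by (simp add: Q_Suc)
  qed (simp add: Q_def cbox_Pair_iff)
  let ?K = "\<Inter>n. Q n"
  have "compact ?K"
    by (rule compact_Inter) (use Q_comp in auto)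
  moreover have "?K \<noteq> {}" using Q_pt by blast
  moreover have "?K = T ?K"
  proof
    show "T ?K \<subseteq> ?K"
    proof
      fix x assume x: "x \<in> T ?K"
      have "x \<in> Q (Suc n)" for n
        using x T_mono[of ?K "Q n"] by (auto simp: Q_Suc)
      then show "x \<in> ?K" using Q_dec1 by blast
    qed
    show "?K \<subseteq> T ?K"
    proof (rule subsetI, rule ccontr)
      fix x assume x: "x \<in> ?K" and "x \<notin> T ?K"
      have "\<exists>n. x \<notin> carpet_map i ` Q n" if i: "i \<in> {1..8}" for i
      proof (rule ccontr)
        assume "\<not> ?thesis"
        then have *: "\<exists>y\<in>Q n. x = carpet_map i y" for n by blast
        then obtain y where y: "x = carpet_map i y" by blast
        have "y \<in> Q n" for n using *[of n] y injD[OF carpet_map_inj] by metis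
        then show False using \<open>x \<notin> T ?K\<close> i y unfolding T_def by blast
      qed
      then obtain N where N: "\<And>i. i \<in> {1..8} \<Longrightarrow> x \<notin> carpet_map i ` Q (N i)" by metis
      define M where "M = Max (N ` {1..8})"
      have "N i \<le> M" if "i \<in> {1..8}" for i
        unfolding M_def using that by (intro Max_ge) auto
      then have "x \<notin> carpet_map i ` Q M" if "i \<in> {1..8}" for i
        using N[OF that] Q_dec[of "N i" M] that by blast
      then have "x \<notin> Q (Suc M)" by (auto simp: Q_Suc T_def)
      then show False using x by blast
    qed
  qed
  ultimately show "\<exists>K. compact K \<and> K \<noteq> {} \<and> K = (\<Union>i\<in>{1..8}. carpet_map i ` K)"
    unfolding T_def by blast
next
  have sub: "K \<subseteq> L"
    if K: "compact K" "K \<noteq> {}" "K = (\<Union>i\<in>{1..8}. carpet_map i ` K)"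
      and L: "compact L" "L \<noteq> {}" "L = (\<Union>i\<in>{1..8}. carpet_map i ` L)" for K L
  proof -
    have "continuous_on K (\<lambda>y. infdist y L)" by (intro continuous_intros)
    then obtain x where x: "x \<in> K" and mx: "\<And>y. y \<in> K \<Longrightarrow> infdist y L \<le> infdist x L"
      using continuous_attains_sup[OF K(1,2), of "\<lambda>y. infdist y L"] by blast
    from x K(3) obtain i y where i: "i \<in> {1..8}" and y: "y \<in> K" "x = carpet_map i y" by blast
    obtain z where z: "z \<in> L" "infdist y L = dist y z"
      using infdist_attains_inf[of L y] L compact_imp_closed by metis
    have "carpet_map i z \<in> L" using z(1) i L(3) by blast
    then have "infdist x L \<le> dist y z / 3"
      using infdist_le[of "carpet_map i z" L x] y carpet_map_dist by simp
    also have "\<dots> \<le> infdist x L / 3" using mx[OF y(1)] z(2) by simp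
    finally have "infdist x L \<le> 0" by simp
    then have "infdist w L = 0" if "w \<in> K" for w
      using mx[OF that] infdist_nonneg[of w L] by linarith
    then show ?thesis
      using in_closed_iff_infdist_zero[of L] L compact_imp_closed by blast
  qed
  show "K = L"
    if "compact K \<and> K \<noteq> {} \<and> K = (\<Union>i\<in>{1..8}. carpet_map i ` K)"
      and "compact L \<and> L \<noteq> {} \<and> L = (\<Union>i\<in>{1..8}. carpet_map i ` L)" for K L
    using sub[of K L] sub[of L K] that by blast
qed

lemma carpet_props:
  "compact carpet" "carpet \<noteq> {}" "carpet = (\<Union>i\<in>{1..8}. carpet_map i ` carpet)"
  using theI'[OF carpet_ex1] unfolding carpet_def by blast+

definition carpet_ball :: "real \<times> real \<Rightarrow> real \<Rightarrow> (real \<times> real) set" where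
  "carpet_ball x r = {y \<in> carpet. dist x y < r}"

definition words :: "nat \<Rightarrow> nat list set" where
  "words n = {w. length w = n \<and> set w \<subseteq> {1..8}}"

fun word_map :: "nat list \<Rightarrow> real \<times> real \<Rightarrow> real \<times> real" where
  "word_map [] = id"
| "word_map (i # w) = carpet_map i \<circ> word_map w"

definition cell :: "nat list \<Rightarrow> (real \<times> real) set" where
  "cell w = word_map w ` carpet"

definition is_carpet_measure :: "(real \<times> real) measure \<Rightarrow> bool" where
  "is_carpet_measure m \<longleftrightarrow>
     prob_space m \<and> sets m = sets (restrict_space borel carpet) \<and>
     (\<forall>A\<in>sets m. measure m A = (\<Sum>i\<in>{1..8}. measure m {x \<in> carpet. carpet_map i x \<in> A}) / 8) \<and>
     (\<forall>n. \<forall>w\<in>words n. measure m (cell w) = 1 / 8 ^ n)"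

definition square_symmetries :: "(real \<times> real \<Rightarrow> real \<times> real) set" where
  "square_symmetries = {\<Phi>. linear \<Phi> \<and> \<Phi> ` cbox (-1,-1) (1,1) = cbox (-1,-1) (1,1)}"

section \<open>Discrete energies and the scaling constant\<close>

text \<open>The edge set is represented by the symmetric relation of ordered pairs of adjacent words;
  hence the factor 1/2 in the discrete energy, which sums over unordered pairs.\<close>

definition edges :: "nat \<Rightarrow> (nat list \<times> nat list) set" where
  "edges n = {(u, v). u \<in> words n \<and> v \<in> words n \<and> u \<noteq> v \<and> cell u \<inter> cell v \<noteq> {}}"

definition graph_dist :: "nat \<Rightarrow> nat list \<Rightarrow> nat list \<Rightarrow> enat" where
  "graph_dist n u v = (INF k\<in>{k. (u, v) \<in> edges n ^^ k}. enat k)"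

definition graph_energy :: "real \<Rightarrow> nat \<Rightarrow> (nat list \<Rightarrow> real) \<Rightarrow> real" where
  "graph_energy p n g = (\<Sum>(u, v)\<in>edges n. \<bar>g u - g v\<bar> powr p) / 2"

definition cell_mean :: "(real \<times> real) measure \<Rightarrow> (real \<times> real \<Rightarrow> real) \<Rightarrow> nat list \<Rightarrow> real" where
  "cell_mean m f u = (LINT x:cell u|m. f x) / measure m (cell u)"

definition extensions :: "nat \<Rightarrow> nat list \<Rightarrow> nat list set" where
  "extensions n w = {v \<in> words (length w + n). take (length w) v = w}"

text \<open>The real infimum and supremum below are genuine ones: the indicator function of the
  complement of \<^term>\<open>extensions n w\<close> is admissible, and its energy is at most
  \<open>8 * 8 ^ n\<close> for every \<^term>\<open>w\<close>, since every vertex has at most 8 neighbours.\<close>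

definition word_conductance :: "real \<Rightarrow> nat \<Rightarrow> nat list \<Rightarrow> real" where
  "word_conductance p n w =
     (INF g\<in>{g. (\<forall>u\<in>extensions n w. g u = 0) \<and>
                (\<forall>u \<in> words (length w + n) -
                   (\<Union>v\<in>{v \<in> words (length w). graph_dist (length w) v w \<le> 1}. extensions n v).
                   g u = 1)}.
        graph_energy p (length w + n) g)"

definition conductance :: "real \<Rightarrow> nat \<Rightarrow> real" where
  "conductance p n = (SUP w\<in>(\<Union>k\<in>{1..}. words k). word_conductance p n w)"

definition is_scaling_constant :: "real \<Rightarrow> real \<Rightarrow> bool" where
  "is_scaling_constant p \<rho> \<longleftrightarrow>
     0 < \<rho> \<and> (\<lambda>n. conductance p n powr (- 1 / real n)) \<longlonglongrightarrow> \<rho>"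

definition walk_dim :: "real \<Rightarrow> real" where
  "walk_dim \<rho> = ln (8 * \<rho>) / ln 3"

section \<open>The Sobolev space\<close>

text \<open>Functions on the carpet are represented by functions on the plane, whose values off the
  carpet play no role; elements of $L^p$ are represented by functions rather than by classes
  modulo null sets.\<close>

definition lp_norm :: "real \<Rightarrow> (real \<times> real) measure \<Rightarrow> (real \<times> real \<Rightarrow> real) \<Rightarrow> real" where
  "lp_norm p m f = (LINT x|m. \<bar>f x\<bar> powr p) powr (1 / p)"

definition sobolev ::
    "real \<Rightarrow> real \<Rightarrow> (real \<times> real) measure \<Rightarrow> (real \<times> real \<Rightarrow> real) set" where
  "sobolev p \<rho> m =
     {f \<in> borel_measurable m. integrable m (\<lambda>x. \<bar>f x\<bar> powr p) \<and>
        bdd_above ((\<lambda>n. \<rho> ^ n * graph_energy p n (cell_mean m f)) ` {1..})}"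

definition sobolev_seminorm ::
    "real \<Rightarrow> real \<Rightarrow> (real \<times> real) measure \<Rightarrow> (real \<times> real \<Rightarrow> real) \<Rightarrow> real" where
  "sobolev_seminorm p \<rho> m f =
     (SUP n\<in>{1..}. \<rho> ^ n * graph_energy p n (cell_mean m f)) powr (1 / p)"

definition sobolev_norm ::
    "real \<Rightarrow> real \<Rightarrow> (real \<times> real) measure \<Rightarrow> (real \<times> real \<Rightarrow> real) \<Rightarrow> real" where
  "sobolev_norm p \<rho> m f = lp_norm p m f + sobolev_seminorm p \<rho> m f"

definition sobolev_cont ::
    "real \<Rightarrow> real \<Rightarrow> (real \<times> real) measure \<Rightarrow> (real \<times> real \<Rightarrow> real) set" where
  "sobolev_cont p \<rho> m = {f \<in> sobolev p \<rho> m. continuous_on carpet f}"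

definition sobolev_regular :: "real \<Rightarrow> real \<Rightarrow> (real \<times> real) measure \<Rightarrow> bool" where
  "sobolev_regular p \<rho> m \<longleftrightarrow>
     (\<forall>f\<in>sobolev p \<rho> m. \<forall>\<epsilon>>0. \<exists>g\<in>sobolev_cont p \<rho> m. sobolev_norm p \<rho> m (\<lambda>x. f x - g x) < \<epsilon>) \<and>
     (\<forall>h. continuous_on carpet h \<longrightarrow>
        (\<forall>\<epsilon>>0. \<exists>g\<in>sobolev_cont p \<rho> m. \<forall>x\<in>carpet. \<bar>h x - g x\<bar> < \<epsilon>))"

section \<open>Self-similar p-energies and their energy measures\<close>

definition uniformly_convex_seminorm_on ::
    "('a \<Rightarrow> real) set \<Rightarrow> (('a \<Rightarrow> real) \<Rightarrow> real) \<Rightarrow> bool" where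
  "uniformly_convex_seminorm_on V N \<longleftrightarrow>
     (\<forall>f\<in>V. 0 \<le> N f) \<and>
     (\<forall>f\<in>V. \<forall>c. N (\<lambda>x. c * f x) = \<bar>c\<bar> * N f) \<and>
     (\<forall>f\<in>V. \<forall>g\<in>V. N (\<lambda>x. f x + g x) \<le> N f + N g) \<and>
     (\<forall>\<epsilon>>0. \<exists>\<delta>>0. \<forall>f\<in>V. \<forall>g\<in>V.
        N f = 1 \<and> N g = 1 \<and> \<epsilon> \<le> N (\<lambda>x. f x - g x) \<longrightarrow> N (\<lambda>x. f x + g x) \<le> 2 * (1 - \<delta>))"

text \<open>The support of the signed measure $f\,dm$, i.e. of its total variation.\<close>

definition ess_support ::
    "(real \<times> real) measure \<Rightarrow> (real \<times> real \<Rightarrow> real) \<Rightarrow> (real \<times> real) set" where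
  "ess_support m f =
     {x \<in> carpet. \<forall>U. open U \<and> x \<in> U \<longrightarrow>
        0 < emeasure (density m (\<lambda>y. ennreal \<bar>f y\<bar>)) (U \<inter> carpet)}"

definition cont_support :: "(real \<times> real \<Rightarrow> real) \<Rightarrow> (real \<times> real) set" where
  "cont_support g = closure {x \<in> carpet. g x \<noteq> 0}"

definition is_self_similar_energy ::
    "real \<Rightarrow> real \<Rightarrow> (real \<times> real) measure \<Rightarrow> ((real \<times> real \<Rightarrow> real) \<Rightarrow> real) \<Rightarrow> bool" where
  "is_self_similar_energy p \<rho> m \<E> \<longleftrightarrow> (let F = sobolev p \<rho> m in
     (\<forall>f\<in>F. 0 \<le> \<E> f) \<and>
     uniformly_convex_seminorm_on F (\<lambda>f. \<E> f powr (1 / p)) \<and>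
     (\<exists>C\<^sub>0\<ge>1. \<forall>f\<in>F.
        sobolev_seminorm p \<rho> m f / C\<^sub>0 \<le> \<E> f powr (1 / p) \<and>
        \<E> f powr (1 / p) \<le> C\<^sub>0 * sobolev_seminorm p \<rho> m f \<and>
        (LINT x|m. \<bar>f x - (LINT y|m. f y)\<bar> powr p) \<le> C\<^sub>0 * \<E> f) \<and>
     (\<forall>\<phi>. 1-lipschitz_on UNIV \<phi> \<longrightarrow> (\<forall>f\<in>F. \<phi> \<circ> f \<in> F \<and> \<E> (\<phi> \<circ> f) \<le> \<E> f)) \<and>
     (\<forall>f\<in>F. \<E> f = 0 \<longleftrightarrow> (\<exists>c. AE x in m. f x = c)) \<and>
     (\<forall>f\<in>F. \<forall>g\<in>F. \<forall>h\<in>F.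
        (\<exists>a. ess_support m f \<inter> ess_support m (\<lambda>x. g x - a) = {}) \<longrightarrow>
        \<E> (\<lambda>x. f x + g x + h x) + \<E> h = \<E> (\<lambda>x. f x + h x) + \<E> (\<lambda>x. g x + h x)) \<and>
     (\<forall>f\<in>F. (\<forall>i\<in>{1..8}. f \<circ> carpet_map i \<in> F) \<and>
        \<E> f = \<rho> * (\<Sum>i\<in>{1..8}. \<E> (f \<circ> carpet_map i))) \<and>
     sobolev_cont p \<rho> m = {f. continuous_on carpet f \<and> (\<forall>i\<in>{1..8}. f \<circ> carpet_map i \<in> F)} \<and>
     (\<forall>f\<in>F. \<forall>\<Phi>\<in>square_symmetries. f \<circ> \<Phi> \<in> F \<and> \<E> (f \<circ> \<Phi>) = \<E> f))"

text \<open>Sequences are indexed from 0, so that $\omega_1,\omega_2,\dots$ are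
  \<open>\<omega> 0, \<omega> 1, \<dots>\<close>. The topology on \<^typ>\<open>nat \<Rightarrow> nat\<close> is the product of discrete
  topologies.\<close>

definition shift_space :: "(nat \<Rightarrow> nat) set" where
  "shift_space = {\<omega>. \<forall>k. \<omega> k \<in> {1..8}}"

definition cylinder :: "nat list \<Rightarrow> (nat \<Rightarrow> nat) set" where
  "cylinder w = {\<omega> \<in> shift_space. map \<omega> [0..<length w] = w}"

definition coding :: "(nat \<Rightarrow> nat) \<Rightarrow> real \<times> real" where
  "coding \<omega> = the_elem (\<Inter>n. cell (map \<omega> [0..<n]))"

definition is_symbolic_energy_measure ::
    "real \<Rightarrow> ((real \<times> real \<Rightarrow> real) \<Rightarrow> real) \<Rightarrow> (real \<times> real \<Rightarrow> real) \<Rightarrow> (nat \<Rightarrow> nat) measure \<Rightarrow> bool"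
  where
  "is_symbolic_energy_measure \<rho> \<E> f \<mu> \<longleftrightarrow>
     finite_measure \<mu> \<and> sets \<mu> = sets (restrict_space borel shift_space) \<and>
     (\<forall>n. \<forall>w\<in>words n. measure \<mu> (cylinder w) = \<rho> ^ n * \<E> (f \<circ> word_map w))"

definition energy_measure :: "(nat \<Rightarrow> nat) measure \<Rightarrow> (real \<times> real) measure" where
  "energy_measure \<mu> = distr \<mu> (restrict_space borel carpet) coding"

end

theory Submission
  imports Defs
begin

text \<open>The hypotheses bound the oscillation of a function by its energy on the whole carpet; both
inequalities are carried to small scales by self-similarity. Since
\<^term>\<open>(1 / 3 ^ n) powr walk_dim \<rho>\<close> is \<open>1 / (8 * \<rho>) ^ n\<close>, rescaling the Poincare inequality of the
carpet to a cell of level \<open>n\<close> produces exactly the factor \<open>r powr walk_dim \<rho>\<close> at scale \<open>r = 1 / 3 ^ n\<close>,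
and the energy of \<open>f\<close> on that cell is the energy measure of the cylinder, which lies over a ball of
comparable radius.

A ball of radius \<open>1 / 3 ^ n\<close> meets a bounded number of cells of level \<open>n\<close>, so what remains for the
Poincare inequality is to compare the means of \<open>f\<close> over two touching cells \<open>u\<close> and \<open>v\<close> by the energies
nearby. Their common ancestor may be far larger than the ball, so it is of no use. Instead, the
carpet is folded onto the union of \<open>u\<close> and \<open>v\<close>: two edge-adjacent cells look like the first-level
cells 1 and 2 (or 1 and 8), and reflecting them continues \<open>f\<close> to a function on the whole carpet
whose restriction to each first-level cell is a reflected copy of \<open>f\<close> on \<open>u\<close> or on \<open>v\<close>
(\<open>foldable_horizontal\<close>, \<open>foldable_vertical\<close>). If \<open>f\<close> is continuous, this function has finite energy,
namely \<open>\<rho>\<close> times the sum of the energies of the pieces, and the Poincare inequality of the carpet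
compares the two means (\<open>mean_difference_foldable_continuous\<close>). Density of the continuous functions gives
the estimate for all \<open>f\<close>, and diagonal neighbours are joined through a third cell of their
two-by-two block, which is always present (\<open>grid_pos_corner_filled\<close>).

For the capacity, one clamped continuous function of finite energy that is 1 on the quadrant at the
corner \<open>(-1, -1)\<close> and 0 on the two opposite edges is reflected around a vertex of the grid of level
\<open>N\<close>. This gives a bump of energy at most a constant times \<open>\<rho> ^ N\<close> (\<open>vertex_cutoff\<close>). Boundedly many
bumps cover a ball of radius comparable to \<open>1 / 3 ^ N\<close>; their sum, cut off at 1, is admissible, and
\<open>\<rho> ^ N\<close> is comparable to \<open>m B / r powr walk_dim \<rho>\<close>.

Large radii make it necessary that \<^term>\<open>walk_dim \<rho>\<close> is nonnegative. This follows from the definition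
of \<open>\<rho>\<close>, because the conductances grow at most like \<open>8 ^ n\<close> (\<open>scaling_constant_ge\<close>).\<close>

section \<open>Grid positions of the cells\<close>

definition digit :: "nat \<Rightarrow> int \<times> int" where
  "digit i = [(-1,-1), (0,-1), (1,-1), (1,0), (1,1), (0,1), (-1,1), (-1,0)] ! (i - 1)"

text \<open>The cell of a word \<open>w\<close> of length \<open>n\<close> has its centre at \<open>2 / 3 ^ n\<close> times \<open>grid_pos w\<close>, whose coordinates
have the letters of \<open>w\<close> as balanced ternary digits. Integer positions make adjacency of cells and
the counting of neighbours a matter of integer arithmetic.\<close>

definition grid_pos :: "nat list \<Rightarrow> int \<times> int" where
  "grid_pos w = foldl (\<lambda>(a, b) i. (3 * a + fst (digit i), 3 * b + snd (digit i))) (0, 0) w"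

lemma grid_pos_Nil [simp]: "grid_pos [] = (0, 0)"
  by (simp add: grid_pos_def)

lemma grid_pos_snoc:
  "grid_pos (w @ [i]) =
     (3 * fst (grid_pos w) + fst (digit i), 3 * snd (grid_pos w) + snd (digit i))"
  by (simp add: grid_pos_def case_prod_beta)

lemma letters: "{1..8::nat} = {1, 2, 3, 4, 5, 6, 7, 8}"
  by auto

lemma digit_simps [simp]:
  "digit (Suc 0) = (-1,-1)" "digit 2 = (0,-1)" "digit 3 = (1,-1)" "digit 4 = (1,0)"
  "digit 5 = (1,1)" "digit 6 = (0,1)" "digit 7 = (-1,1)" "digit 8 = (-1,0)"
  by (simp_all add: digit_def)

lemma carpet_pt_digit:
  "i \<in> {1..8} \<Longrightarrow> carpet_pt i = (real_of_int (fst (digit i)), real_of_int (snd (digit i)))"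
  unfolding letters by (elim insertE emptyE) (simp_all add: carpet_pt_def digit_def)

lemma digit_bounds: "i \<in> {1..8} \<Longrightarrow> \<bar>fst (digit i)\<bar> \<le> 1 \<and> \<bar>snd (digit i)\<bar> \<le> 1"
  unfolding letters by (elim insertE emptyE) simp_all

lemma digit_nonzero: "i \<in> {1..8} \<Longrightarrow> digit i \<noteq> (0, 0)"
  unfolding letters by (elim insertE emptyE) simp_all

lemma digit_inj: "inj_on digit {1..8}"
  unfolding letters by (simp add: inj_on_def)

lemma digit_surj:
  assumes "\<bar>a\<bar> \<le> 1" "\<bar>b\<bar> \<le> 1" "(a, b) \<noteq> (0, 0)"
  shows "\<exists>i\<in>{1..8}. digit i = (a, b)"
proof -
  have "a \<in> {-1, 0, 1}" "b \<in> {-1, 0, 1}" using assms by auto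
  then show ?thesis using assms(3) unfolding letters by auto
qed

lemma carpet_map_eq:
  assumes "i \<in> {1..8}"
  shows "carpet_map i x = ((fst x + 2 * of_int (fst (digit i))) / 3,
                           (snd x + 2 * of_int (snd (digit i))) / 3)"
  using carpet_pt_digit[OF assms] by (cases x) (simp add: carpet_map_def field_simps)

lemma words_0 [simp]: "words 0 = {[]}"
  by (auto simp: words_def)

lemma words_snoc: "words (Suc n) = {w @ [i] |w i. w \<in> words n \<and> i \<in> {1..8}}"
proof (intro equalityI subsetI)
  fix w assume w: "w \<in> words (Suc n)"
  then obtain u i where "w = u @ [i]" by (cases w rule: rev_cases) (auto simp: words_def)
  then show "w \<in> {w @ [i] |w i. w \<in> words n \<and> i \<in> {1..8}}" using w by (auto simp: words_def)
qed (auto simp: words_def)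

lemma words_Cons: "words (Suc n) = (\<lambda>(i, w). i # w) ` ({1..8} \<times> words n)"
proof (intro equalityI subsetI)
  fix w assume w: "w \<in> words (Suc n)"
  then obtain u i where "w = i # u" by (cases w) (auto simp: words_def)
  then show "w \<in> (\<lambda>(i, w). i # w) ` ({1..8} \<times> words n)" using w by (auto simp: words_def)
qed (auto simp: words_def)

lemma sum_words_Suc: "(\<Sum>w\<in>words (Suc n). g w) = (\<Sum>i\<in>{1..8}. \<Sum>w\<in>words n. g (i # w))"
  unfolding words_Cons
  by (subst sum.reindex) (auto simp: inj_on_def sum.cartesian_product case_prod_beta)

lemma finite_words [simp]: "finite (words n)"
  by (induction n) (simp_all add: words_Cons)

lemma card_words: "card (words n) = 8 ^ n"
  by (induction n) (simp_all add: words_Cons card_image inj_on_def card_cartesian_product)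

lemma word_map_append: "word_map (u @ v) = word_map u \<circ> word_map v"
  by (induction u) (simp_all add: o_assoc)

lemma word_map_eq:
  assumes "w \<in> words n"
  shows "word_map w x = ((fst x + 2 * of_int (fst (grid_pos w))) / 3 ^ n,
                         (snd x + 2 * of_int (snd (grid_pos w))) / 3 ^ n)"
  using assms
proof (induction n arbitrary: w x)
  case (Suc n)
  then obtain u i where *: "w = u @ [i]" "u \<in> words n" "i \<in> {1..8}"
    by (auto simp: words_snoc)
  show ?case
    unfolding *(1) by (simp add: word_map_append Suc.IH[OF *(2)] carpet_map_eq[OF *(3)]
        grid_pos_snoc field_simps)
qed simp

text \<open>Balanced ternary expansions are unique.\<close>

lemma grid_pos_inj: "inj_on grid_pos (words n)"
proof (induction n)
  case (Suc n)
  show ?case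
  proof (rule inj_onI)
    fix v w assume vw: "v \<in> words (Suc n)" "w \<in> words (Suc n)" "grid_pos v = grid_pos w"
    then obtain v' i w' j where *: "v = v' @ [i]" "v' \<in> words n" "i \<in> {1..8}"
      "w = w' @ [j]" "w' \<in> words n" "j \<in> {1..8}"
      unfolding words_snoc by blast
    have "fst (grid_pos v) = fst (grid_pos w)" "snd (grid_pos v) = snd (grid_pos w)"
      using vw by auto
    then have eq: "3 * fst (grid_pos v') + fst (digit i) = 3 * fst (grid_pos w') + fst (digit j)"
      "3 * snd (grid_pos v') + snd (digit i) = 3 * snd (grid_pos w') + snd (digit j)"
      unfolding *(1,4) grid_pos_snoc by simp_all
    then have "fst (grid_pos v') = fst (grid_pos w')" "snd (grid_pos v') = snd (grid_pos w')"
      using digit_bounds[OF *(3)] digit_bounds[OF *(6)] by linarith+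
    moreover from this have "fst (digit i) = fst (digit j)" "snd (digit i) = snd (digit j)"
      using eq by linarith+
    ultimately have "v' = w'" "i = j"
      using Suc.IH digit_inj * by (auto simp: inj_on_def prod_eq_iff)
    then show "v = w" using * by simp
  qed
qed simp

text \<open>Two diagonal neighbours are always joined by a third cell of the two-by-two block that they
  span, so it suffices to compare edge-adjacent cells. In the induction, the last letter of the new
  cell mixes the digits of the last letters of \<open>u\<close> and \<open>v\<close>. If the mixture is the forbidden digit
  \<open>(0, 0)\<close>, then a vanishing digit excludes a carry in either coordinate, so \<open>u\<close> and \<open>v\<close> have the same
  parent, and the opposite mixture is available.\<close>

lemma grid_pos_corner_filled:
  assumes "u \<in> words n" "v \<in> words n"
    and "\<bar>fst (grid_pos u) - fst (grid_pos v)\<bar> \<le> 1" "\<bar>snd (grid_pos u) - snd (grid_pos v)\<bar> \<le> 1"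
  shows "\<exists>w\<in>words n. grid_pos w = (fst (grid_pos u), snd (grid_pos v)) \<or>
                      grid_pos w = (fst (grid_pos v), snd (grid_pos u))"
  using assms
proof (induction n arbitrary: u v)
  case (Suc n)
  then obtain u' i v' j where *: "u = u' @ [i]" "u' \<in> words n" "i \<in> {1..8}"
      "v = v' @ [j]" "v' \<in> words n" "j \<in> {1..8}"
    unfolding words_snoc by blast
  obtain a b where ab: "digit i = (a, b)" by force
  obtain c d where cd: "digit j = (c, d)" by force
  obtain P Q where PQ: "grid_pos u' = (P, Q)" by force
  obtain R S where RS: "grid_pos v' = (R, S)" by force
  have bd: "\<bar>a\<bar> \<le> 1" "\<bar>b\<bar> \<le> 1" "\<bar>c\<bar> \<le> 1" "\<bar>d\<bar> \<le> 1" "(a, b) \<noteq> (0, 0)" "(c, d) \<noteq> (0, 0)"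
    using digit_bounds[OF *(3)] digit_bounds[OF *(6)] digit_nonzero[OF *(3)] digit_nonzero[OF *(6)]
      ab cd by auto
  have u: "grid_pos u = (3 * P + a, 3 * Q + b)" and v: "grid_pos v = (3 * R + c, 3 * S + d)"
    unfolding *(1,4) grid_pos_snoc ab cd PQ RS by auto
  have near: "\<bar>(3 * P + a) - (3 * R + c)\<bar> \<le> 1" "\<bar>(3 * Q + b) - (3 * S + d)\<bar> \<le> 1"
    using Suc.prems(3,4) unfolding u v by auto
  have carry: "\<bar>X - Y\<bar> \<le> 1" "e = 0 \<or> f = 0 \<Longrightarrow> X = Y"
    if "\<bar>(3 * X + e) - (3 * Y + f)\<bar> \<le> 1" "\<bar>e\<bar> \<le> 1" "\<bar>f\<bar> \<le> 1" for X Y e f :: int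
    using that unfolding abs_le_iff by arith+
  have "\<bar>P - R\<bar> \<le> 1" "\<bar>Q - S\<bar> \<le> 1" using carry near bd by blast+
  then obtain w where w: "w \<in> words n" "grid_pos w = (P, S) \<or> grid_pos w = (R, Q)"
    using Suc.IH[OF *(2,5)] PQ RS by auto
  have mk: "\<exists>w\<in>words (Suc n). grid_pos w = (3 * X + e, 3 * Y + f)"
    if "w \<in> words n" "grid_pos w = (X, Y)" "\<bar>e\<bar> \<le> 1" "\<bar>f\<bar> \<le> 1" "(e, f) \<noteq> (0, 0)" for w X Y e f
  proof -
    from digit_surj[OF that(3-5)] obtain k where "k \<in> {1..8}" "digit k = (e, f)" by blast
    then have "w @ [k] \<in> words (Suc n)" "grid_pos (w @ [k]) = (3 * X + e, 3 * Y + f)"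
      using that by (auto simp: words_snoc grid_pos_snoc)
    then show ?thesis by blast
  qed
  have no_carry1: "a = 0 \<Longrightarrow> P = R" "c = 0 \<Longrightarrow> P = R" using carry(2)[OF near(1)] bd by blast+
  have no_carry2: "b = 0 \<Longrightarrow> Q = S" "d = 0 \<Longrightarrow> Q = S" using carry(2)[OF near(2)] bd by blast+
  from w(2) have "(\<exists>w\<in>words (Suc n). grid_pos w = (3 * P + a, 3 * S + d)) \<or>
                  (\<exists>w\<in>words (Suc n). grid_pos w = (3 * R + c, 3 * Q + b))"
  proof
    assume 1: "grid_pos w = (P, S)"
    show ?thesis
    proof (cases "(a, d) = (0, 0)")
      case False
      then show ?thesis using mk[OF w(1) 1 bd(1,4)] by simp
    next
      case True
      then have "P = R" "Q = S" "(c, b) \<noteq> (0, 0)" using no_carry1 no_carry2 bd by auto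
      then show ?thesis using mk[OF w(1) _ bd(3,2)] 1 by auto
    qed
  next
    assume 1: "grid_pos w = (R, Q)"
    show ?thesis
    proof (cases "(c, b) = (0, 0)")
      case False
      then show ?thesis using mk[OF w(1) 1 bd(3,2)] by simp
    next
      case True
      then have "P = R" "Q = S" "(a, d) \<noteq> (0, 0)" using no_carry1 no_carry2 bd by auto
      then show ?thesis using mk[OF w(1) _ bd(1,4)] 1 by auto
    qed
  qed
  then obtain w where w: "w \<in> words (Suc n)"
      "grid_pos w = (3 * P + a, 3 * S + d) \<or> grid_pos w = (3 * R + c, 3 * Q + b)" by blast
  have "grid_pos w = (fst (grid_pos u), snd (grid_pos v)) \<or>
      grid_pos w = (fst (grid_pos v), snd (grid_pos u))"
    using w(2) unfolding u v fst_conv snd_conv .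
  then show ?case using w(1) by blast
next
  case 0
  then have "u = []" "v = []" by simp_all
  then show ?case by simp
qed

section \<open>Geometry of the carpet and its cells\<close>

text \<open>A point where a coordinate is extremal is the image under some first-level map of a point whose
coordinate is no larger in modulus; this forces the extremal modulus to be at most 1.\<close>

lemma carpet_bounds:
  assumes "x \<in> carpet"
  shows "\<bar>fst x\<bar> \<le> 1" "\<bar>snd x\<bar> \<le> 1"
proof -
  have gen: "\<bar>c x\<bar> \<le> 1"
    if c: "continuous_on carpet c"
      and le: "\<And>i y. i \<in> {1..8} \<Longrightarrow> \<bar>c (carpet_map i y)\<bar> \<le> (\<bar>c y\<bar> + 2) / 3"
    for c :: "real \<times> real \<Rightarrow> real"
  proof -
    have "continuous_on carpet (\<lambda>y. \<bar>c y\<bar>)" using c by (intro continuous_intros)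
    then obtain z where z: "z \<in> carpet" "\<And>y. y \<in> carpet \<Longrightarrow> \<bar>c y\<bar> \<le> \<bar>c z\<bar>"
      using continuous_attains_sup[OF carpet_props(1,2)] by blast
    obtain i y where "i \<in> {1..8}" "y \<in> carpet" "z = carpet_map i y"
      using z(1) carpet_props(3) by blast
    then have "\<bar>c z\<bar> \<le> (\<bar>c z\<bar> + 2) / 3" using le[of i y] z(2)[of y] by force
    then show ?thesis using z(2)[OF assms] by argo
  qed
  have "\<bar>fst (carpet_map i y)\<bar> \<le> (\<bar>fst y\<bar> + 2) / 3 \<and> \<bar>snd (carpet_map i y)\<bar> \<le> (\<bar>snd y\<bar> + 2) / 3"
    if "i \<in> {1..8}" for i y
  proof -
    have "\<bar>real_of_int (fst (digit i))\<bar> \<le> 1" "\<bar>real_of_int (snd (digit i))\<bar> \<le> 1"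
      using digit_bounds[OF that] by linarith+
    then show ?thesis unfolding carpet_map_eq[OF that] fst_conv snd_conv by (intro conjI; simp; linarith)
  qed
  then show "\<bar>fst x\<bar> \<le> 1" "\<bar>snd x\<bar> \<le> 1"
    by (auto intro!: gen continuous_intros)
qed

lemma carpet_closed: "closed carpet"
  using carpet_props(1) compact_imp_closed by blast

lemma carpet_map_in: "i \<in> {1..8} \<Longrightarrow> x \<in> carpet \<Longrightarrow> carpet_map i x \<in> carpet"
  using carpet_props(3) by blast

lemma word_map_in: "w \<in> words n \<Longrightarrow> x \<in> carpet \<Longrightarrow> word_map w x \<in> carpet"
  by (induction n arbitrary: w) (auto simp: words_Cons carpet_map_in)

lemma word_map_continuous: "continuous_on A (word_map w)"
proof (induction w arbitrary: A)
  case (Cons i w)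
  then show ?case
    using continuous_on_compose[OF Cons[of A] carpet_map_continuous] by simp
qed (simp add: id_def)

lemma cell_subset: "w \<in> words n \<Longrightarrow> cell w \<subseteq> carpet"
  by (auto simp: cell_def word_map_in)

lemma cell_compact: "compact (cell w)"
  unfolding cell_def by (intro compact_continuous_image word_map_continuous carpet_props)

lemma cell_Cons: "cell (i # w) = carpet_map i ` cell w"
  by (simp add: cell_def image_comp)

lemma carpet_eq_cells: "carpet = (\<Union>w\<in>words n. cell w)"
proof (induction n)
  case (Suc n)
  have "carpet = (\<Union>i\<in>{1..8}. carpet_map i ` (\<Union>w\<in>words n. cell w))"
    using carpet_props(3) unfolding Suc[symmetric] .
  also have "\<dots> = (\<Union>w\<in>words (Suc n). cell w)"
    unfolding words_Cons UN_simps(10) case_prod_beta cell_Cons image_UN by force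
  finally show ?case .
qed (simp add: cell_def)

lemma cell_of_point:
  assumes "x \<in> carpet" obtains w where "w \<in> words n" "x \<in> cell w"
  using assms carpet_eq_cells[of n] by blast

text \<open>A cell lies in the grid square of side \<open>2 / 3 ^ n\<close> around twice its grid position.\<close>

lemma cell_coords:
  assumes "w \<in> words n" "x \<in> cell w"
  shows "\<bar>3 ^ n * fst x - 2 * of_int (fst (grid_pos w))\<bar> \<le> 1"
    "\<bar>3 ^ n * snd x - 2 * of_int (snd (grid_pos w))\<bar> \<le> 1"
proof -
  obtain y where y: "y \<in> carpet" "x = word_map w y" using assms by (auto simp: cell_def)
  show "\<bar>3 ^ n * fst x - 2 * of_int (fst (grid_pos w))\<bar> \<le> 1"
    "\<bar>3 ^ n * snd x - 2 * of_int (snd (grid_pos w))\<bar> \<le> 1"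
    using carpet_bounds[OF y(1)] unfolding y(2) word_map_eq[OF assms(1)] by simp_all
qed

lemma dist_le_coords:
  fixes x y :: "real \<times> real"
  shows "dist x y \<le> \<bar>fst x - fst y\<bar> + \<bar>snd x - snd y\<bar>"
  unfolding dist_prod_def dist_real_def 
  using sqrt_sum_squares_le_sum_abs[of "fst x - fst y" "snd x - snd y"] by simp

text \<open>Cells touched by a small ball are neighbours in the grid: the centres of two cells at distance at
most \<open>1 / 3 ^ n\<close> differ by at most three half sides in each coordinate, hence, being integer multiples
of two half sides apart, by at most one side.\<close>

lemma cells_near:
  assumes "u \<in> words n" "v \<in> words n" "x \<in> cell u" "y \<in> cell v" "dist x y \<le> 1 / 3 ^ n"
  shows "\<bar>fst (grid_pos u) - fst (grid_pos v)\<bar> \<le> 1 \<and> \<bar>snd (grid_pos u) - snd (grid_pos v)\<bar> \<le> 1"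
proof -
  have near: "\<bar>a - b\<bar> \<le> 1"
    if "\<bar>3 ^ n * c - 2 * of_int a\<bar> \<le> 1" "\<bar>3 ^ n * d - 2 * of_int b\<bar> \<le> 1" "\<bar>c - d\<bar> \<le> dist x y"
    for a b :: int and c d :: real
  proof -
    have "\<bar>3 ^ n * (c - d)\<bar> \<le> 1"
      using order_trans[OF that(3) assms(5)] by (simp add: abs_mult pos_le_divide_eq mult.commute)
    then have "\<bar>3 ^ n * c - 3 ^ n * d\<bar> \<le> 1" by (simp add: right_diff_distrib)
    then have "\<bar>real_of_int a - of_int b\<bar> \<le> 3 / 2" using that by linarith
    then show ?thesis by linarith
  qed
  show ?thesis
    using near[OF cell_coords(1)[OF assms(1,3)] cell_coords(1)[OF assms(2,4)]]
      near[OF cell_coords(2)[OF assms(1,3)] cell_coords(2)[OF assms(2,4)]]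
      dist_fst_le[of x y] dist_snd_le[of x y] by (simp add: dist_real_def)
qed

lemma edge_grid_pos:
  assumes "(u, v) \<in> edges n"
  shows "\<bar>fst (grid_pos u) - fst (grid_pos v)\<bar> \<le> 1 \<and> \<bar>snd (grid_pos u) - snd (grid_pos v)\<bar> \<le> 1"
proof -
  obtain x where x: "x \<in> cell u" "x \<in> cell v" "u \<in> words n" "v \<in> words n"
    using assms by (auto simp: edges_def)
  have "\<bar>real_of_int (fst (grid_pos u)) - of_int (fst (grid_pos v))\<bar> \<le> 1"
    "\<bar>real_of_int (snd (grid_pos u)) - of_int (snd (grid_pos v))\<bar> \<le> 1"
    using cell_coords[OF x(3,1)] cell_coords[OF x(4,2)] by linarith+
  then show ?thesis by linarith
qed

lemma card_neighbours:
  assumes "u \<in> words n"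
  shows "card {v \<in> words n. \<bar>fst (grid_pos u) - fst (grid_pos v)\<bar> \<le> 1 \<and>
                \<bar>snd (grid_pos u) - snd (grid_pos v)\<bar> \<le> 1} \<le> 9" (is "card ?V \<le> 9")
proof -
  let ?B = "{fst (grid_pos u) - 1..fst (grid_pos u) + 1} \<times> {snd (grid_pos u) - 1..snd (grid_pos u) + 1}"
  have "card ?V \<le> card ?B"
  proof (rule card_inj_on_le)
    show "inj_on grid_pos ?V" by (rule inj_on_subset[OF grid_pos_inj]) auto
    show "grid_pos ` ?V \<subseteq> ?B" 
    proof
      fix z assume "z \<in> grid_pos ` ?V"
      then obtain v where "z = grid_pos v" "v \<in> ?V" by blast
      then show "z \<in> ?B" by (simp add: mem_Times_iff abs_le_iff)
    qed
  qed simp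
  then show ?thesis by (simp add: card_cartesian_product)
qed

section \<open>Reflections\<close>

definition reflect :: "real \<Rightarrow> real \<Rightarrow> real \<times> real \<Rightarrow> real \<times> real" where
  "reflect s t = (\<lambda>x. (s * fst x, t * snd x))"

lemma reflect_continuous: "continuous_on A (reflect s t)"
  unfolding reflect_def by (intro continuous_intros)

lemma reflect_symmetry:
  assumes "\<bar>s\<bar> = 1" "\<bar>t\<bar> = 1"
  shows "reflect s t \<in> square_symmetries"
proof -
  have st: "s = 1 \<or> s = -1" "t = 1 \<or> t = -1" using assms by auto
  have 1: "linear (reflect s t)"
    by (intro linearI) (auto simp: reflect_def algebra_simps)
  have sub: "reflect s t ` cbox (-1,-1) (1,1) \<subseteq> cbox (-1,-1) (1,1)"
    using st by (auto simp: reflect_def cbox_Pair_iff)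
  have "reflect s t (reflect s t x) = x" for x
    using st by (cases x) (auto simp: reflect_def)
  then have "x \<in> reflect s t ` cbox (-1,-1) (1,1)" if "x \<in> cbox (-1,-1) (1,1)" for x
    using sub that by (metis image_eqI image_subset_iff)
  then show ?thesis using 1 sub by (auto simp: square_symmetries_def)
qed

text \<open>A reflection permutes the first-level maps up to conjugation, so the reflected carpet solves the
same fixed point equation, whose solution is unique.\<close>

lemma reflect_carpet:
  assumes "\<bar>s\<bar> = 1" "\<bar>t\<bar> = 1"
  shows "reflect s t ` carpet = carpet"
proof -
  have st: "s = 1 \<or> s = -1" "t = 1 \<or> t = -1" using assms by auto
  let ?K = "reflect s t ` carpet"
  have inv: "reflect s t (reflect s t x) = x" for x
    using st by (cases x) (auto simp: reflect_def)
  have conj: "\<exists>j\<in>{1..8}. \<forall>x. reflect s t (carpet_map i x) = carpet_map j (reflect s t x)"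
    if i: "i \<in> {1..8}" for i
  proof -
    obtain a b where ab: "digit i = (a, b)" by force
    obtain s' t' :: int where s't': "s = of_int s'" "t = of_int t'" "\<bar>s'\<bar> = 1" "\<bar>t'\<bar> = 1"
      using st by (metis abs_1 abs_minus_cancel of_int_1 of_int_minus)
    have "\<bar>s' * a\<bar> \<le> 1" "\<bar>t' * b\<bar> \<le> 1" "(s' * a, t' * b) \<noteq> (0, 0)"
      using digit_bounds[OF i] digit_nonzero[OF i] ab s't' by (auto simp: abs_mult)
    then obtain j where j: "j \<in> {1..8}" "digit j = (s' * a, t' * b)" using digit_surj by blast
    have "reflect s t (carpet_map i x) = carpet_map j (reflect s t x)" for x
      using j by (simp add: carpet_map_eq[OF i] carpet_map_eq[OF j(1)] reflect_def ab s't' algebra_simps)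
    then show ?thesis using j(1) by blast
  qed
  have "compact ?K"
    by (rule compact_continuous_image[OF reflect_continuous carpet_props(1)])
  moreover have "?K \<noteq> {}" unfolding image_is_empty by (rule carpet_props(2))
  moreover have "?K = (\<Union>i\<in>{1..8}. carpet_map i ` ?K)"
  proof (rule equalityI; rule subsetI)
    fix y assume "y \<in> ?K"
    then obtain x where x: "x \<in> carpet" "y = reflect s t x" by (rule imageE)
    obtain i z where z: "i \<in> {1..8}" "z \<in> carpet" "x = carpet_map i z"
      using carpet_props(3) x(1) by blast
    obtain j where j: "j \<in> {1..8}"
      "\<And>x. reflect s t (carpet_map i x) = carpet_map j (reflect s t x)"
      using conj[OF z(1)] by blast
    have "y = carpet_map j (reflect s t z)" unfolding x(2) z(3) by (rule j(2))
    then show "y \<in> (\<Union>i\<in>{1..8}. carpet_map i ` ?K)" using j(1) z(2) by blast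
  next
    fix y assume "y \<in> (\<Union>i\<in>{1..8}. carpet_map i ` ?K)"
    then obtain i x where x: "i \<in> {1..8}" "x \<in> carpet" "y = carpet_map i (reflect s t x)"
      by blast
    obtain j where j: "j \<in> {1..8}"
      "\<And>x. reflect s t (carpet_map i x) = carpet_map j (reflect s t x)"
      using conj[OF x(1)] by blast
    have "y = reflect s t (carpet_map j x)"
      using j(2)[of "reflect s t x"] unfolding x(3) inv by (metis inv)
    then show "y \<in> ?K" using carpet_map_in[OF j(1) x(2)] by (rule image_eqI)
  qed
  ultimately show ?thesis
    using the1_equality[OF carpet_ex1, folded carpet_def] by metis
qed

section \<open>Convexity estimates\<close>

lemma abs_add_powr_le:
  fixes a b p :: real
  assumes "0 \<le> p"
  shows "\<bar>a + b\<bar> powr p \<le> 2 powr p * (\<bar>a\<bar> powr p + \<bar>b\<bar> powr p)"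
proof -
  have "\<bar>a + b\<bar> powr p \<le> (2 * max \<bar>a\<bar> \<bar>b\<bar>) powr p"
    using assms by (intro powr_mono2) auto
  also have "\<dots> = 2 powr p * max \<bar>a\<bar> \<bar>b\<bar> powr p"
    by (simp add: powr_mult)
  also have "\<dots> \<le> 2 powr p * (\<bar>a\<bar> powr p + \<bar>b\<bar> powr p)"
    by (intro mult_left_mono) (auto simp: max_def)
  finally show ?thesis .
qed

lemma abs_le_one_plus_powr:
  fixes a p :: real
  assumes "1 \<le> p"
  shows "\<bar>a\<bar> \<le> 1 + \<bar>a\<bar> powr p"
proof (cases "\<bar>a\<bar> \<le> 1")
  case False
  then have "\<bar>a\<bar> powr 1 \<le> \<bar>a\<bar> powr p" using assms by (intro powr_mono) auto
  then show ?thesis using False by auto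
qed (smt (verit) powr_ge_zero)

lemma integrable_powr_add:
  fixes f g :: "'a \<Rightarrow> real"
  assumes [measurable]: "f \<in> borel_measurable M" "g \<in> borel_measurable M"
    and "0 \<le> p" "integrable M (\<lambda>x. \<bar>f x\<bar> powr p)" "integrable M (\<lambda>x. \<bar>g x\<bar> powr p)"
  shows "integrable M (\<lambda>x. \<bar>f x + g x\<bar> powr p)"
proof (rule Bochner_Integration.integrable_bound)
  show "integrable M (\<lambda>x. 2 powr p * (\<bar>f x\<bar> powr p + \<bar>g x\<bar> powr p))"
    using assms(4,5) by (intro integrable_mult_right Bochner_Integration.integrable_add)
  show "AE x in M. norm (\<bar>f x + g x\<bar> powr p) \<le> norm (2 powr p * (\<bar>f x\<bar> powr p + \<bar>g x\<bar> powr p))"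
    using abs_add_powr_le[OF assms(3)] by (intro AE_I2) (auto simp: abs_mult)
qed measurable

lemma (in finite_measure) integrable_of_powr:
  fixes f :: "'a \<Rightarrow> real"
  assumes [measurable]: "f \<in> borel_measurable M" and "1 \<le> p" "integrable M (\<lambda>x. \<bar>f x\<bar> powr p)"
  shows "integrable M f"
proof (rule Bochner_Integration.integrable_bound)
  show "integrable M (\<lambda>x. 1 + \<bar>f x\<bar> powr p)"
    using assms(3) by (intro Bochner_Integration.integrable_add) auto
  show "AE x in M. norm (f x) \<le> norm (1 + \<bar>f x\<bar> powr p)"
    using abs_le_one_plus_powr[OF assms(2)] by (intro AE_I2) (auto simp: add_nonneg_nonneg)
qed measurable

lemma integrable_imp_set_integrable:
  fixes f :: "'a \<Rightarrow> real"
  shows "integrable M f \<Longrightarrow> A \<in> sets M \<Longrightarrow> set_integrable M A f"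
  unfolding set_integrable_def by (rule integrable_mult_indicator)

text \<open>Jensen's inequality on a subset, by integrating Young's inequality
  \<open>\<bar>g\<bar> * s powr (p - 1) \<le> \<bar>g\<bar> powr p / p + (1 - 1/p) * s powr p\<close> with \<open>s\<close> the modulus of the mean.\<close>

lemma (in finite_measure) mean_powr_le:
  fixes g :: "'a \<Rightarrow> real"
  assumes B: "B \<in> sets M" and g: "g \<in> borel_measurable M" and p: "1 < p"
    and gp: "integrable M (\<lambda>x. \<bar>g x\<bar> powr p)"
  shows "\<bar>(LINT x:B|M. g x) / measure M B\<bar> powr p * measure M B \<le> (LINT x:B|M. \<bar>g x\<bar> powr p)"
proof (cases "measure M B = 0")
  case True
  have "0 \<le> (LINT x:B|M. \<bar>g x\<bar> powr p)"
    unfolding set_lebesgue_integral_def by (intro integral_nonneg_AE AE_I2) auto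
  then show ?thesis using True by simp
next
  case False
  define b where "b = measure M B"
  then have b: "b > 0" using False by (simp add: zero_less_measure_iff)
  define s where "s = \<bar>(LINT x:B|M. g x) / b\<bar>"
  have gi: "set_integrable M B g" "set_integrable M B (\<lambda>x. \<bar>g x\<bar>)"
    "set_integrable M B (\<lambda>x. \<bar>g x\<bar> powr p)" "set_integrable M B (\<lambda>x. (1 - 1/p) * s powr p)"
    using integrable_of_powr[OF g less_imp_le[OF p] gp] gp B
    by (auto intro!: integrable_imp_set_integrable)
  have young: "\<bar>g x\<bar> * s powr (p - 1) \<le> \<bar>g x\<bar> powr p / p + (1 - 1/p) * s powr p" for x
  proof -
    define q where "q = p / (p - 1)"
    have q: "q > 1" "1 / p + 1 / q = 1" "(p - 1) * q = p" using p by (auto simp: q_def field_simps)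
    have "\<bar>g x\<bar> * s powr (p - 1) \<le> \<bar>g x\<bar> powr p / p + (s powr (p - 1)) powr q / q"
      using Youngs_inequality[of p q "\<bar>g x\<bar>" "s powr (p - 1)"] p q by simp
    also have "(s powr (p - 1)) powr q / q = (1 - 1/p) * s powr p"
    proof -
      have "1 - 1 / p = 1 / q" using q(2) by linarith
      then show ?thesis using q(3) by (simp add: powr_powr)
    qed
    finally show ?thesis .
  qed
  have "s * b = \<bar>LINT x:B|M. g x\<bar>" using b by (simp add: s_def)
  also have "\<dots> \<le> (LINT x:B|M. \<bar>g x\<bar>)"
    using set_integral_norm_bound[OF gi(1)] by simp
  finally have "(s * b) * s powr (p - 1) \<le> (LINT x:B|M. \<bar>g x\<bar>) * s powr (p - 1)"
    by (rule mult_right_mono) simp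
  also have "\<dots> = (LINT x:B|M. \<bar>g x\<bar> * s powr (p - 1))" by simp
  also have "\<dots> \<le> (LINT x:B|M. \<bar>g x\<bar> powr p / p + (1 - 1/p) * s powr p)"
    by (intro set_integral_mono set_integrable_mult_left set_integral_add(1)
        set_integrable_divide gi young)
  also have "\<dots> = (LINT x:B|M. \<bar>g x\<bar> powr p) / p + (1 - 1/p) * s powr p * b"
    using gi B by (subst set_integral_add(2)) (auto simp: set_integrable_divide b_def set_integral_const)
  finally have "b * (s * s powr (p - 1)) \<le> (LINT x:B|M. \<bar>g x\<bar> powr p) / p + (1 - 1/p) * (s powr p * b)"
    by (simp add: mult_ac)
  moreover have "s * s powr (p - 1) = s powr p"
    using p by (cases "s = 0") (auto simp: s_def powr_diff)
  ultimately have "(s powr p * b) / p \<le> (LINT x:B|M. \<bar>g x\<bar> powr p) / p"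
    by (simp add: algebra_simps)
  then show ?thesis using p by (simp add: s_def b_def divide_le_cancel)
qed

text \<open>Up to a constant, the mean may be replaced by any other number; on a ball this will be the mean over
one of the cells that meet it.\<close>

lemma (in finite_measure) oscillation_le:
  fixes f :: "'a \<Rightarrow> real"
  assumes B: "B \<in> sets M" and f: "f \<in> borel_measurable M" and p: "1 < p"
    and fp: "integrable M (\<lambda>x. \<bar>f x\<bar> powr p)"
  shows "(LINT y:B|M. \<bar>f y - (LINT z:B|M. f z) / measure M B\<bar> powr p)
           \<le> 2 * 2 powr p * (LINT y:B|M. \<bar>f y - c\<bar> powr p)"
proof -
  define b a where "b = measure M B" and "a = (LINT z:B|M. f z) / b"
  have fi: "set_integrable M B f"
    using integrable_of_powr[OF f less_imp_le[OF p] fp] B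
    by (rule integrable_imp_set_integrable)
  have const: "integrable M (\<lambda>x. \<bar>k\<bar> powr p)" for k :: real by simp
  have int: "integrable M (\<lambda>x. \<bar>f x - k\<bar> powr p)" for k
    using integrable_powr_add[OF f _ _ fp, of "\<lambda>_. - k"] p by simp
  have "\<bar>c - a\<bar> powr p * b \<le> (LINT y:B|M. \<bar>f y - c\<bar> powr p)"
  proof (cases "b = 0")
    case True
    have "0 \<le> (LINT y:B|M. \<bar>f y - c\<bar> powr p)"
      unfolding set_lebesgue_integral_def by (intro integral_nonneg_AE AE_I2) auto
    then show ?thesis using True by simp
  next
    case False
    have "(LINT x:B|M. f x - c) = (LINT z:B|M. f z) - c * b"
      using fi B integrable_imp_set_integrable[of M "\<lambda>_. c" B]
      by (subst set_integral_diff(2)) (auto simp: b_def set_integral_const)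
    then have "(LINT x:B|M. f x - c) / b = a - c"
      using False by (simp add: a_def diff_divide_distrib)
    then show ?thesis
      using mean_powr_le[OF B _ p int[of c]] f unfolding b_def[symmetric]
      by (simp add: abs_minus_commute)
  qed
  moreover have "(LINT y:B|M. \<bar>f y - a\<bar> powr p)
      \<le> (LINT y:B|M. 2 powr p * (\<bar>f y - c\<bar> powr p + \<bar>c - a\<bar> powr p))"
  proof (rule set_integral_mono)
    show "set_integrable M B (\<lambda>y. \<bar>f y - a\<bar> powr p)"
      "set_integrable M B (\<lambda>y. 2 powr p * (\<bar>f y - c\<bar> powr p + \<bar>c - a\<bar> powr p))"
      using B int const by (auto intro!: integrable_imp_set_integrable)
    show "\<bar>f y - a\<bar> powr p \<le> 2 powr p * (\<bar>f y - c\<bar> powr p + \<bar>c - a\<bar> powr p)" for y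
      using abs_add_powr_le[of p "f y - c" "c - a"] p by simp
  qed
  moreover have "\<dots> = 2 powr p * ((LINT y:B|M. \<bar>f y - c\<bar> powr p) + \<bar>c - a\<bar> powr p * b)"
  proof -
    have "set_integrable M B (\<lambda>y. \<bar>f y - c\<bar> powr p)" "set_integrable M B (\<lambda>y. \<bar>c - a\<bar> powr p)"
      using B int const by (auto intro!: integrable_imp_set_integrable)
    then show ?thesis
      using B by (simp add: set_integral_add(2) b_def set_integral_const)
  qed
  ultimately have "(LINT y:B|M. \<bar>f y - a\<bar> powr p)
      \<le> 2 powr p * ((LINT y:B|M. \<bar>f y - c\<bar> powr p) + (LINT y:B|M. \<bar>f y - c\<bar> powr p))"
    by (smt (verit) mult_left_mono powr_ge_zero)
  then show ?thesis by (simp add: a_def b_def mult_ac)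
qed

section \<open>Integration over cells\<close>

locale carpet_measure =
  fixes m :: "(real \<times> real) measure"
  assumes carpet_measure: "is_carpet_measure m"
begin

sublocale prob_space m
  using carpet_measure by (simp add: is_carpet_measure_def)

lemma sets_m: "sets m = sets (restrict_space borel carpet)"
  using carpet_measure by (simp add: is_carpet_measure_def)

lemma space_m [simp]: "space m = carpet"
  using sets_eq_imp_space_eq[OF sets_m] by (simp add: space_restrict_space)

lemma borel_carpet_sets: "A \<in> sets borel \<Longrightarrow> A \<subseteq> carpet \<Longrightarrow> A \<in> sets m"
  by (auto simp: sets_m sets_restrict_space)

lemma cell_sets [measurable]: "w \<in> words n \<Longrightarrow> cell w \<in> sets m"
  by (intro borel_carpet_sets cell_subset borel_closed compact_imp_closed cell_compact)

lemma carpet_ball_sets [measurable]: "carpet_ball x r \<in> sets m"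
proof (rule borel_carpet_sets)
  have "carpet_ball x r = carpet \<inter> ball x r" by (auto simp: carpet_ball_def)
  then show "carpet_ball x r \<in> sets borel" using carpet_closed by simp
qed (auto simp: carpet_ball_def)

lemma measurable_self_map:
  assumes "continuous_on carpet h" "h ` carpet \<subseteq> carpet"
  shows "h \<in> measurable m m"
proof -
  have "h \<in> measurable (restrict_space borel carpet) (restrict_space borel carpet)"
    using assms borel_measurable_continuous_on_restrict[of carpet h]
    by (intro measurable_restrict_space2) (auto simp: space_restrict_space)
  then show ?thesis using measurable_cong_sets[OF sets_m sets_m] by blast
qed

lemma word_map_measurable: "w \<in> words n \<Longrightarrow> word_map w \<in> measurable m m"
  by (intro measurable_self_map word_map_continuous) (auto simp: word_map_in)

lemma measure_cell: "w \<in> words n \<Longrightarrow> measure m (cell w) = 1 / 8 ^ n"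
  using carpet_measure by (simp add: is_carpet_measure_def)

lemma measure_words:
  assumes "A \<in> sets m"
  shows "measure m A = (\<Sum>w\<in>words n. measure m {x \<in> carpet. word_map w x \<in> A}) / 8 ^ n"
  using assms
proof (induction n arbitrary: A)
  case 0
  then have "{x \<in> carpet. x \<in> A} = A" using sets.sets_into_space[of A m] by auto
  then show ?case by simp
next
  case (Suc n)
  have *: "measure m {x \<in> carpet. carpet_map i x \<in> A}
      = (\<Sum>w\<in>words n. measure m {x \<in> carpet. word_map (i # w) x \<in> A}) / 8 ^ n" if i: "i \<in> {1..8}" for i
  proof -
    have "[i] \<in> words 1" using i by (auto simp: words_def)
    then have "{x \<in> carpet. carpet_map i x \<in> A} \<in> sets m"
      using measurable_sets[OF word_map_measurable Suc.prems, of "[i]"]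
      by (simp add: vimage_def Int_def conj_commute)
    from Suc.IH[OF this]
    have "measure m {x \<in> carpet. carpet_map i x \<in> A}
      = (\<Sum>w\<in>words n. measure m {x \<in> carpet. word_map w x \<in> {x \<in> carpet. carpet_map i x \<in> A}}) / 8 ^ n" .
    moreover have "{x \<in> carpet. word_map w x \<in> {x \<in> carpet. carpet_map i x \<in> A}}
        = {x \<in> carpet. word_map (i # w) x \<in> A}" if "w \<in> words n" for w
      using word_map_in[OF that] by auto
    ultimately show ?thesis by simp
  qed
  have "measure m A = (\<Sum>i\<in>{1..8}. measure m {x \<in> carpet. carpet_map i x \<in> A}) / 8"
    using carpet_measure Suc.prems by (simp add: is_carpet_measure_def)
  also have "\<dots> = (\<Sum>i\<in>{1..8}. (\<Sum>w\<in>words n. measure m {x \<in> carpet. word_map (i # w) x \<in> A}) / 8 ^ n) / 8"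
    using * by simp
  also have "\<dots> = (\<Sum>w\<in>words (Suc n). measure m {x \<in> carpet. word_map w x \<in> A}) / 8 ^ Suc n"
    unfolding sum_words_Suc by (simp add: sum_divide_distrib mult.commute)
  finally show ?case .
qed

text \<open>The self-similarity formula for \<^term>\<open>cell w\<close> already reaches the value \<open>1 / 8 ^ n\<close> by its
  summand for \<open>w\<close>, so all other summands vanish, for \<^term>\<open>cell w\<close> and for its subsets.\<close>

lemma measure_subset_cell:
  assumes w: "w \<in> words n" and A: "A \<in> sets m" "A \<subseteq> cell w"
  shows "measure m {x \<in> carpet. word_map w x \<in> A} = 8 ^ n * measure m A"
proof -
  define Z where "Z B v = {x \<in> carpet. word_map v x \<in> B}" for B v
  have Z_sets: "Z B v \<in> sets m" if "v \<in> words n" "B \<in> sets m" for B v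
    using measurable_sets[OF word_map_measurable[OF that(1)] that(2)]
    by (simp add: Z_def vimage_def Int_def conj_commute)
  have "Z (cell w) w = carpet" by (auto simp: Z_def cell_def)
  then have one: "measure m (Z (cell w) w) = 1" using prob_space by simp
  have "(\<Sum>v\<in>words n. measure m (Z (cell w) v)) = 1"
    using measure_words[OF cell_sets[OF w], of n] measure_cell[OF w] by (simp add: Z_def)
  then have "(\<Sum>v\<in>words n - {w}. measure m (Z (cell w) v)) = 0"
    using one w by (simp add: sum.remove)
  then have null: "measure m (Z (cell w) v) = 0" if "v \<in> words n - {w}" for v
    using that by (subst (asm) sum_nonneg_eq_0_iff) auto
  have "measure m (Z A v) = 0" if v: "v \<in> words n - {w}" for v
  proof -
    have "measure m (Z A v) \<le> measure m (Z (cell w) v)"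
      using v A(2) by (intro finite_measure_mono Z_sets cell_sets[OF w]) (auto simp: Z_def)
    then show ?thesis using null[OF v] measure_nonneg[of m "Z A v"] by linarith
  qed
  then have "(\<Sum>v\<in>words n. measure m (Z A v)) = measure m (Z A w)"
    using w by (subst sum.remove[of _ w]) auto
  then show ?thesis using measure_words[OF A(1), of n] by (simp add: Z_def)
qed

lemma distr_word_map:
  assumes w: "w \<in> words n"
  shows "distr m m (word_map w) = density m (\<lambda>x. ennreal (8 ^ n * indicator (cell w) x))"
proof (rule measure_eqI)
  fix A assume "A \<in> sets (distr m m (word_map w))"
  then have A: "A \<in> sets m" by simp
  have "emeasure (distr m m (word_map w)) A = measure m (word_map w -` A \<inter> carpet)"
    using A word_map_measurable[OF w] by (simp add: emeasure_distr emeasure_eq_measure)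
  also have "word_map w -` A \<inter> carpet = {x \<in> carpet. word_map w x \<in> A \<inter> cell w}"
    by (auto simp: cell_def)
  also have "measure m \<dots> = 8 ^ n * measure m (A \<inter> cell w)"
    using A w by (intro measure_subset_cell) auto
  also have "ennreal \<dots> = ennreal (8 ^ n) * emeasure m (A \<inter> cell w)"
    by (simp add: emeasure_eq_measure ennreal_mult)
  also have "\<dots> = (\<integral>\<^sup>+x. ennreal (8 ^ n) * indicator (A \<inter> cell w) x \<partial>m)"
    using A w by (subst nn_integral_cmult_indicator) auto
  also have "\<dots> = (\<integral>\<^sup>+x. ennreal (8 ^ n * indicator (cell w) x) * indicator A x \<partial>m)"
    by (intro nn_integral_cong) (auto simp: indicator_def)
  also have "\<dots> = emeasure (density m (\<lambda>x. ennreal (8 ^ n * indicator (cell w) x))) A"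
    using A w by (subst emeasure_density) (auto)
  finally show "emeasure (distr m m (word_map w)) A
      = emeasure (density m (\<lambda>x. ennreal (8 ^ n * indicator (cell w) x))) A" .
qed simp

lemma
  fixes f :: "real \<times> real \<Rightarrow> real"
  assumes w: "w \<in> words n" and f: "f \<in> borel_measurable m"
  shows integral_word_map: "(LINT x|m. f (word_map w x)) = 8 ^ n * (LINT x:cell w|m. f x)"
    and integrable_word_map: "integrable m f \<Longrightarrow> integrable m (\<lambda>x. f (word_map w x))"
proof -
  have meas: "(\<lambda>x. 8 ^ n * indicator (cell w) x :: real) \<in> borel_measurable m"
    using w by auto
  have "(LINT x|m. f (word_map w x)) = (LINT x|distr m m (word_map w). f x)"
    using word_map_measurable[OF w] f by (simp add: integral_distr)
  also have "\<dots> = (LINT x|m. (8 ^ n * indicator (cell w) x) *\<^sub>R f x)"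
    unfolding distr_word_map[OF w] by (intro integral_density f meas) auto
  also have "\<dots> = 8 ^ n * (LINT x:cell w|m. f x)"
    unfolding set_lebesgue_integral_def by (simp add: mult.assoc)
  finally show "(LINT x|m. f (word_map w x)) = 8 ^ n * (LINT x:cell w|m. f x)" .
  assume "integrable m f"
  then have "integrable m (\<lambda>x. (8 ^ n * indicator (cell w) x) *\<^sub>R f x)"
    using integrable_mult_right[OF integrable_mult_indicator[OF cell_sets[OF w], of f], of "8 ^ n :: real"]
    by (simp add: mult.assoc)
  then have "integrable (distr m m (word_map w)) f"
    unfolding distr_word_map[OF w] using meas f by (subst integrable_density) auto
  then show "integrable m (\<lambda>x. f (word_map w x))"
    using word_map_measurable[OF w] integrable_distr by blast
qed

end

section \<open>The Sobolev space and the self-similar energy\<close>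

locale carpet_energy = carpet_measure m
  for m :: "(real \<times> real) measure" +
  fixes p \<rho> :: real and \<E> :: "(real \<times> real \<Rightarrow> real) \<Rightarrow> real"
  assumes p_gt_1: "1 < p"
    and scaling_constant: "is_scaling_constant p \<rho>"
    and regular: "sobolev_regular p \<rho> m"
    and self_similar: "is_self_similar_energy p \<rho> m \<E>"
begin

abbreviation "F \<equiv> sobolev p \<rho> m"
abbreviation "FC \<equiv> sobolev_cont p \<rho> m"

definition energy_norm :: "(real \<times> real \<Rightarrow> real) \<Rightarrow> real" where
  "energy_norm f = \<E> f powr (1 / p)"

lemma rho_pos: "0 < \<rho>"
  using scaling_constant by (simp add: is_scaling_constant_def)

lemma FC_iff: "f \<in> FC \<longleftrightarrow> f \<in> F \<and> continuous_on carpet f"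
  by (auto simp: sobolev_cont_def)

lemma sobolev_measurable: "f \<in> F \<Longrightarrow> f \<in> borel_measurable m"
  by (simp add: sobolev_def)

lemma sobolev_integrable_powr: "f \<in> F \<Longrightarrow> integrable m (\<lambda>x. \<bar>f x\<bar> powr p)"
  by (simp add: sobolev_def)

lemma sobolev_integrable: "f \<in> F \<Longrightarrow> integrable m f"
  using integrable_of_powr[of f p] sobolev_measurable sobolev_integrable_powr p_gt_1 by simp

text \<open>Functions are compared on the carpet only; the pieces glued together below agree with
reflected copies of given functions there but not on the whole plane.\<close>

lemma sobolev_cong:
  assumes "\<And>x. x \<in> carpet \<Longrightarrow> f x = g x"
  shows "f \<in> F \<longleftrightarrow> g \<in> F"
proof -
  have "cell_mean m f u = cell_mean m g u" for u
    unfolding cell_mean_def set_lebesgue_integral_def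
    using assms by (intro arg_cong2[where f="(/)"] refl Bochner_Integration.integral_cong) auto
  then have "cell_mean m f = cell_mean m g" by auto
  moreover have "f \<in> borel_measurable m \<longleftrightarrow> g \<in> borel_measurable m"
    using assms by (intro measurable_cong) auto
  moreover have "integrable m (\<lambda>x. \<bar>f x\<bar> powr p) \<longleftrightarrow> integrable m (\<lambda>x. \<bar>g x\<bar> powr p)"
    using assms by (intro Bochner_Integration.integrable_cong) auto
  ultimately show ?thesis by (simp add: sobolev_def)
qed

lemma FC_cong:
  assumes "\<And>x. x \<in> carpet \<Longrightarrow> f x = g x"
  shows "f \<in> FC \<longleftrightarrow> g \<in> FC"
proof -
  have "f \<in> F \<longleftrightarrow> g \<in> F" by (rule sobolev_cong) (fact assms)
  moreover have "continuous_on carpet f \<longleftrightarrow> continuous_on carpet g"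
    by (rule continuous_on_cong[OF refl]) (fact assms)
  ultimately show ?thesis by (simp add: FC_iff)
qed

lemma sobolev_add:
  assumes f: "f \<in> F" and g: "g \<in> F"
  shows "(\<lambda>x. f x + g x) \<in> F"
proof -
  have mean_add: "cell_mean m (\<lambda>x. f x + g x) u = cell_mean m f u + cell_mean m g u"
    if "u \<in> words n" for u n
  proof -
    have "set_integrable m (cell u) f" "set_integrable m (cell u) g"
      using sobolev_integrable[OF f] sobolev_integrable[OF g] that
      by (auto intro: integrable_imp_set_integrable)
    then show ?thesis by (simp add: cell_mean_def add_divide_distrib)
  qed
  have energy_add: "graph_energy p n (cell_mean m (\<lambda>x. f x + g x))
      \<le> 2 powr p * (graph_energy p n (cell_mean m f) + graph_energy p n (cell_mean m g))" for n
  proof -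
    have "(\<Sum>(u, v)\<in>edges n. \<bar>cell_mean m (\<lambda>x. f x + g x) u - cell_mean m (\<lambda>x. f x + g x) v\<bar> powr p)
        \<le> (\<Sum>(u, v)\<in>edges n. 2 powr p * (\<bar>cell_mean m f u - cell_mean m f v\<bar> powr p
              + \<bar>cell_mean m g u - cell_mean m g v\<bar> powr p))"
    proof (rule sum_mono, clarify)
      fix u v assume "(u, v) \<in> edges n"
      then have "u \<in> words n" "v \<in> words n" by (auto simp: edges_def)
      then have "cell_mean m (\<lambda>x. f x + g x) u - cell_mean m (\<lambda>x. f x + g x) v
          = (cell_mean m f u - cell_mean m f v) + (cell_mean m g u - cell_mean m g v)"
        by (simp add: mean_add)
      then show "\<bar>cell_mean m (\<lambda>x. f x + g x) u - cell_mean m (\<lambda>x. f x + g x) v\<bar> powr p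
          \<le> 2 powr p * (\<bar>cell_mean m f u - cell_mean m f v\<bar> powr p
              + \<bar>cell_mean m g u - cell_mean m g v\<bar> powr p)"
        using abs_add_powr_le[of p "cell_mean m f u - cell_mean m f v"] p_gt_1 by simp
    qed
    also have "\<dots> = 2 powr p * ((\<Sum>(u, v)\<in>edges n. \<bar>cell_mean m f u - cell_mean m f v\<bar> powr p)
              + (\<Sum>(u, v)\<in>edges n. \<bar>cell_mean m g u - cell_mean m g v\<bar> powr p))"
      by (simp add: case_prod_beta sum.distrib flip: sum_distrib_left)
    finally show ?thesis by (simp add: graph_energy_def algebra_simps)
  qed
  obtain a b where ab: "\<And>n. n \<ge> 1 \<Longrightarrow> \<rho> ^ n * graph_energy p n (cell_mean m f) \<le> a"
    "\<And>n. n \<ge> 1 \<Longrightarrow> \<rho> ^ n * graph_energy p n (cell_mean m g) \<le> b"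
    using f g unfolding sobolev_def bdd_above_def by fastforce
  have "bdd_above ((\<lambda>n. \<rho> ^ n * graph_energy p n (cell_mean m (\<lambda>x. f x + g x))) ` {1..})"
  proof (intro bdd_aboveI2[of _ _ "2 powr p * (a + b)"])
    fix n :: nat assume "n \<in> {1..}"
    have "\<rho> ^ n * graph_energy p n (cell_mean m (\<lambda>x. f x + g x))
      \<le> \<rho> ^ n * (2 powr p * (graph_energy p n (cell_mean m f) + graph_energy p n (cell_mean m g)))"
      using rho_pos by (intro mult_left_mono energy_add) auto
    also have "\<dots> = 2 powr p * (\<rho> ^ n * graph_energy p n (cell_mean m f)
        + \<rho> ^ n * graph_energy p n (cell_mean m g))"
      by (simp add: algebra_simps)
    also have "\<dots> \<le> 2 powr p * (a + b)"
      using ab \<open>n \<in> {1..}\<close> by (intro mult_left_mono add_mono) auto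
    finally show "\<rho> ^ n * graph_energy p n (cell_mean m (\<lambda>x. f x + g x)) \<le> 2 powr p * (a + b)" .
  qed
  moreover have "integrable m (\<lambda>x. \<bar>f x + g x\<bar> powr p)"
    using integrable_powr_add[of f m g p] sobolev_measurable[OF f] sobolev_measurable[OF g]
      sobolev_integrable_powr[OF f] sobolev_integrable_powr[OF g] p_gt_1 by simp
  ultimately show ?thesis
    using sobolev_measurable[OF f] sobolev_measurable[OF g] by (simp add: sobolev_def)
qed

lemma energy_nonneg: "f \<in> F \<Longrightarrow> 0 \<le> \<E> f"
  using self_similar unfolding is_self_similar_energy_def Let_def by blast

lemma energy_norm_nonneg [simp]: "0 \<le> energy_norm f"
  by (simp add: energy_norm_def)

lemma energy_eq: "f \<in> F \<Longrightarrow> \<E> f = energy_norm f powr p"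
  using energy_nonneg[of f] p_gt_1 by (simp add: energy_norm_def powr_powr)

lemma energy_norm_triangle:
  "f \<in> F \<Longrightarrow> g \<in> F \<Longrightarrow> energy_norm (\<lambda>x. f x + g x) \<le> energy_norm f + energy_norm g"
  using self_similar
  unfolding is_self_similar_energy_def Let_def uniformly_convex_seminorm_on_def energy_norm_def
  by blast

lemma lipschitz_energy:
  "1-lipschitz_on UNIV \<phi> \<Longrightarrow> f \<in> F \<Longrightarrow> \<phi> \<circ> f \<in> F \<and> \<E> (\<phi> \<circ> f) \<le> \<E> f"
  using self_similar unfolding is_self_similar_energy_def Let_def by blast

lemma energy_zero_iff: "f \<in> F \<Longrightarrow> \<E> f = 0 \<longleftrightarrow> (\<exists>c. AE x in m. f x = c)"
  using self_similar unfolding is_self_similar_energy_def Let_def by blast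

lemma uniform_approximation:
  assumes "continuous_on carpet h" "0 < \<epsilon>"
  shows "\<exists>g\<in>FC. \<forall>x\<in>carpet. \<bar>h x - g x\<bar> < \<epsilon>"
proof -
  have "\<forall>h. continuous_on carpet h \<longrightarrow> (\<forall>\<epsilon>>0. \<exists>g\<in>FC. \<forall>x\<in>carpet. \<bar>h x - g x\<bar> < \<epsilon>)"
    using regular unfolding sobolev_regular_def by (rule conjunct2)
  then show ?thesis using assms by blast
qed

text \<open>Constants are images of any Sobolev function under a constant, hence 1-Lipschitz, map.\<close>

lemma sobolev_const: "(\<lambda>_. c) \<in> F"
proof -
  obtain g where "g \<in> F"
    using uniform_approximation[of "\<lambda>_. 0" 1] by (auto simp: FC_iff)
  moreover have "1-lipschitz_on UNIV (\<lambda>_::real. c)" by (rule lipschitz_onI) auto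
  ultimately have "(\<lambda>_. c) \<circ> g \<in> F" using lipschitz_energy by blast
  then show ?thesis by (simp add: o_def)
qed

lemma energy_const: "\<E> (\<lambda>_. c) = 0"
  using energy_zero_iff[OF sobolev_const] by auto

lemma sobolev_uminus: "f \<in> F \<Longrightarrow> (\<lambda>x. - f x) \<in> F \<and> energy_norm (\<lambda>x. - f x) \<le> energy_norm f"
proof -
  assume f: "f \<in> F"
  have "1-lipschitz_on UNIV (uminus :: real \<Rightarrow> real)"
    by (rule lipschitz_onI) (auto simp: dist_real_def)
  then have *: "uminus \<circ> f \<in> F" "\<E> (uminus \<circ> f) \<le> \<E> f" using lipschitz_energy f by blast+
  have "energy_norm (uminus \<circ> f) \<le> energy_norm f"
    unfolding energy_norm_def using * energy_nonneg[OF *(1)] p_gt_1 by (intro powr_mono2) auto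
  then show ?thesis using *(1) by (simp add: o_def)
qed

lemma sobolev_diff:
  assumes f: "f \<in> F" and g: "g \<in> F"
  shows "(\<lambda>x. f x - g x) \<in> F"
proof -
  have "(\<lambda>x. - g x) \<in> F" using sobolev_uminus[OF g] by (rule conjunct1)
  from sobolev_add[OF f this] show ?thesis by simp
qed

lemma energy_norm_le_diff:
  assumes "f \<in> F" "g \<in> F"
  shows "energy_norm f \<le> energy_norm (\<lambda>x. f x - g x) + energy_norm g"
  using energy_norm_triangle[OF sobolev_diff[OF assms] assms(2)] by simp

text \<open>The difference of the two functions vanishes almost everywhere, so its energy is zero, and the
triangle inequality applies.\<close>

lemma energy_cong:
  assumes eq: "\<And>x. x \<in> carpet \<Longrightarrow> f x = g x" and f: "f \<in> F"
  shows "\<E> f = \<E> g"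
proof -
  have "f \<in> F \<longleftrightarrow> g \<in> F" by (rule sobolev_cong) (fact eq)
  then have g: "g \<in> F" using f by simp
  have zero: "energy_norm (\<lambda>x. h x - k x) = 0"
    if "h \<in> F" "k \<in> F" "\<And>x. x \<in> carpet \<Longrightarrow> h x = k x" for h k
  proof -
    have "AE x in m. h x - k x = 0" using that(3) by (intro AE_I2) simp
    then have "\<E> (\<lambda>x. h x - k x) = 0"
      using energy_zero_iff[OF sobolev_diff[OF that(1,2)]] by blast
    then show ?thesis by (simp add: energy_norm_def)
  qed
  have "energy_norm f = energy_norm g"
    using energy_norm_le_diff[OF f g] energy_norm_le_diff[OF g f] zero[OF f g eq]
      zero[OF g f eq[symmetric]] by linarith
  then show ?thesis using energy_eq f g by simp
qed

lemma comp_word_map_Cons: "f \<circ> word_map (i # w) = f \<circ> carpet_map i \<circ> word_map w"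
  by (simp add: comp_assoc)

lemma sobolev_word_map: "f \<in> F \<Longrightarrow> w \<in> words n \<Longrightarrow> f \<circ> word_map w \<in> F"
proof (induction n arbitrary: f w)
  case (Suc n)
  then obtain i u where w: "w = i # u" "i \<in> {1..8}" "u \<in> words n" by (auto simp: words_Cons)
  have "f \<circ> carpet_map i \<in> F"
    using self_similar Suc.prems(1) w(2) unfolding is_self_similar_energy_def Let_def by blast
  from Suc.IH[OF this w(3)] show ?case unfolding w(1) comp_word_map_Cons .
qed simp

lemma energy_words: "f \<in> F \<Longrightarrow> \<E> f = \<rho> ^ n * (\<Sum>w\<in>words n. \<E> (f \<circ> word_map w))"
proof (induction n arbitrary: f)
  case (Suc n)
  have 1: "f \<circ> carpet_map i \<in> F" if "i \<in> {1..8}" for i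
    using self_similar Suc.prems that unfolding is_self_similar_energy_def Let_def by blast
  have "\<E> f = \<rho> * (\<Sum>i\<in>{1..8}. \<E> (f \<circ> carpet_map i))"
    using self_similar Suc.prems unfolding is_self_similar_energy_def Let_def by blast
  also have "\<dots> = \<rho> * (\<Sum>i\<in>{1..8}. \<rho> ^ n * (\<Sum>w\<in>words n. \<E> (f \<circ> word_map (i # w))))"
    unfolding comp_word_map_Cons
    by (intro arg_cong2[where f="(*)"] sum.cong refl Suc.IH 1)
  also have "\<dots> = \<rho> ^ Suc n * (\<Sum>w\<in>words (Suc n). \<E> (f \<circ> word_map w))"
    unfolding sum_words_Suc by (simp add: mult.assoc flip: sum_distrib_left)
  finally show ?case .
qed simp

lemma energy_word_map_le:
  assumes "f \<in> F" "w \<in> words n"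
  shows "\<E> (f \<circ> word_map w) \<le> \<E> f / \<rho> ^ n"
proof -
  have "\<E> (f \<circ> word_map w) \<le> (\<Sum>w\<in>words n. \<E> (f \<circ> word_map w))"
    using assms by (intro member_le_sum energy_nonneg sobolev_word_map) auto
  then show ?thesis
    using energy_words[OF assms(1), of n] rho_pos by (simp add: field_simps)
qed

lemma FC_reflect:
  assumes "f \<in> FC" "\<bar>s\<bar> = 1" "\<bar>t\<bar> = 1"
  shows "f \<circ> reflect s t \<in> FC" "\<E> (f \<circ> reflect s t) = \<E> f"
proof -
  have f: "f \<in> F" "continuous_on carpet f" using assms(1) by (auto simp: FC_iff)
  have "f \<circ> reflect s t \<in> F \<and> \<E> (f \<circ> reflect s t) = \<E> f"
    using self_similar f(1) reflect_symmetry[OF assms(2,3)]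
    unfolding is_self_similar_energy_def Let_def by blast
  moreover have "continuous_on carpet (f \<circ> reflect s t)"
    using f(2) by (intro continuous_on_compose reflect_continuous) (simp add: reflect_carpet[OF assms(2,3)])
  ultimately show "f \<circ> reflect s t \<in> FC" "\<E> (f \<circ> reflect s t) = \<E> f" by (auto simp: FC_iff)
qed

lemma FC_word_map:
  assumes "f \<in> FC" "w \<in> words n"
  shows "f \<circ> word_map w \<in> FC"
proof -
  have "continuous_on (word_map w ` carpet) f"
    using assms word_map_in by (auto simp: FC_iff elim!: continuous_on_subset)
  then have "continuous_on carpet (f \<circ> word_map w)"
    by (intro continuous_on_compose word_map_continuous)
  then show ?thesis using assms sobolev_word_map by (auto simp: FC_iff simp del: o_apply)
qed

text \<open>The carpet is a finite closed cover by its cells, so continuity may be checked cell by cell; for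
continuous functions finiteness of the energy may be checked cell by cell as well. This is how
functions are built by prescribing them on cells.\<close>

lemma FC_glue_letters:
  assumes "\<And>i. i \<in> {1..8} \<Longrightarrow> f \<circ> carpet_map i \<in> FC"
  shows "f \<in> FC"
proof -
  have "continuous_on (carpet_map i ` carpet) f" if i: "i \<in> {1..8}" for i
  proof -
    define g where "g x = 3 *\<^sub>R (x - carpet_pt i) + carpet_pt i" for x
    have g: "g (carpet_map i x) = x" for x by (simp add: g_def carpet_map_def)
    then have "f y = (f \<circ> carpet_map i) (g y)" if "y \<in> carpet_map i ` carpet" for y
      using that by auto
    moreover have "continuous_on (carpet_map i ` carpet) (\<lambda>y. (f \<circ> carpet_map i) (g y))"
    proof (rule continuous_on_compose2[of carpet "f \<circ> carpet_map i"])
      show "continuous_on carpet (f \<circ> carpet_map i)" using assms[OF i] by (simp add: FC_iff)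
      show "continuous_on (carpet_map i ` carpet) g" unfolding g_def by (intro continuous_intros)
    qed (auto simp: g)
    ultimately show ?thesis by (simp cong: continuous_on_cong)
  qed
  moreover have "closed (carpet_map i ` carpet)" for i
    by (intro compact_imp_closed compact_continuous_image carpet_map_continuous carpet_props)
  ultimately have "continuous_on (\<Union>i\<in>{1..8}. carpet_map i ` carpet) f"
    by (intro continuous_on_closed_Union) auto
  then have "continuous_on carpet f" using carpet_props(3) by simp
  moreover have "\<forall>i\<in>{1..8}. f \<circ> carpet_map i \<in> F" using assms by (simp add: FC_iff)
  ultimately show ?thesis
    using self_similar unfolding is_self_similar_energy_def Let_def by blast
qed

lemma FC_glue:
  assumes "\<And>w. w \<in> words n \<Longrightarrow> f \<circ> word_map w \<in> FC"
  shows "f \<in> FC"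
  using assms
proof (induction n arbitrary: f)
  case (Suc n)
  show ?case
  proof (rule FC_glue_letters)
    fix i :: nat assume i: "i \<in> {1..8}"
    show "f \<circ> carpet_map i \<in> FC"
    proof (rule Suc.IH)
      fix w assume "w \<in> words n"
      then have "i # w \<in> words (Suc n)" using i by (auto simp: words_def)
      from Suc.prems[OF this] show "f \<circ> carpet_map i \<circ> word_map w \<in> FC"
        unfolding comp_word_map_Cons .
    qed
  qed
qed simp

lemma energy_constants:
  "\<exists>C\<ge>1. \<forall>f\<in>F. energy_norm f \<le> C * sobolev_seminorm p \<rho> m f \<and>
     (LINT x|m. \<bar>f x - (LINT y|m. f y)\<bar> powr p) \<le> C * \<E> f"
proof -
  obtain C where "C \<ge> 1" "\<forall>f\<in>F.
        sobolev_seminorm p \<rho> m f / C \<le> \<E> f powr (1 / p) \<and>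
        \<E> f powr (1 / p) \<le> C * sobolev_seminorm p \<rho> m f \<and>
        (LINT x|m. \<bar>f x - (LINT y|m. f y)\<bar> powr p) \<le> C * \<E> f"
    using self_similar unfolding is_self_similar_energy_def Let_def by blast
  then show ?thesis unfolding energy_norm_def by blast
qed

lemma dense_continuous:
  assumes f: "f \<in> F" and "\<epsilon> > 0"
  shows "\<exists>g\<in>FC. energy_norm (\<lambda>x. f x - g x) \<le> \<epsilon> \<and> lp_norm p m (\<lambda>x. f x - g x) \<le> \<epsilon>"
proof -
  obtain C where C: "C \<ge> 1" "\<And>f. f \<in> F \<Longrightarrow> energy_norm f \<le> C * sobolev_seminorm p \<rho> m f"
    using energy_constants by blast
  have "\<epsilon> / C > 0" using C assms by simp
  moreover have "\<forall>f\<in>F. \<forall>\<epsilon>>0. \<exists>g\<in>FC. sobolev_norm p \<rho> m (\<lambda>x. f x - g x) < \<epsilon>"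
    using regular unfolding sobolev_regular_def by (rule conjunct1)
  ultimately obtain g where g: "g \<in> FC" "sobolev_norm p \<rho> m (\<lambda>x. f x - g x) < \<epsilon> / C"
    using f by blast
  have nonneg: "0 \<le> sobolev_seminorm p \<rho> m h" "0 \<le> lp_norm p m h" for h
    by (simp_all add: sobolev_seminorm_def lp_norm_def)
  have "sobolev_seminorm p \<rho> m (\<lambda>x. f x - g x) \<le> \<epsilon> / C" "lp_norm p m (\<lambda>x. f x - g x) \<le> \<epsilon> / C"
    using g(2) nonneg[of "\<lambda>x. f x - g x"] unfolding sobolev_norm_def by linarith+
  moreover have "(\<lambda>x. f x - g x) \<in> F" using f g by (intro sobolev_diff) (auto simp: FC_iff)
  ultimately have "energy_norm (\<lambda>x. f x - g x) \<le> \<epsilon>" "lp_norm p m (\<lambda>x. f x - g x) \<le> \<epsilon> / C"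
    using C(1) order_trans[OF C(2), of "\<lambda>x. f x - g x" \<epsilon>] by (auto simp: field_simps)
  moreover have "\<epsilon> / C \<le> \<epsilon>" using C(1) assms by (simp add: field_simps)
  ultimately show ?thesis using g(1) by force
qed

lemma mean_powr_le_prob:
  assumes "g \<in> borel_measurable m" "integrable m (\<lambda>x. \<bar>g x\<bar> powr p)"
  shows "\<bar>LINT x|m. g x\<bar> powr p \<le> (LINT x|m. \<bar>g x\<bar> powr p)"
proof -
  have "(LINT x:carpet|m. h x) = (LINT x|m. h x)" for h :: "real \<times> real \<Rightarrow> real"
    unfolding set_lebesgue_integral_def by (intro Bochner_Integration.integral_cong) auto
  then show ?thesis
    using mean_powr_le[OF sets.top assms(1) p_gt_1 assms(2)] prob_space by simp
qed

lemma integral_powr_word_map_le: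
  assumes w: "w \<in> words n" and g: "g \<in> F"
  shows "(LINT x|m. \<bar>g (word_map w x)\<bar> powr p) \<le> 8 ^ n * (LINT x|m. \<bar>g x\<bar> powr p)"
proof -
  have "(LINT x|m. \<bar>g (word_map w x)\<bar> powr p) = 8 ^ n * (LINT x:cell w|m. \<bar>g x\<bar> powr p)"
    using sobolev_measurable[OF g] by (intro integral_word_map[OF w, of "\<lambda>x. \<bar>g x\<bar> powr p"]) auto
  also have "(LINT x:cell w|m. \<bar>g x\<bar> powr p) \<le> (LINT x|m. \<bar>g x\<bar> powr p)"
    unfolding set_lebesgue_integral_def
    using integrable_mult_indicator[OF cell_sets[OF w] sobolev_integrable_powr[OF g]]
      sobolev_integrable_powr[OF g]
    by (intro integral_mono) (auto simp: indicator_def)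
  finally show ?thesis by simp
qed

lemma mean_word_map_le:
  assumes w: "w \<in> words n" and g: "g \<in> F"
  shows "\<bar>LINT x|m. g (word_map w x)\<bar> powr p \<le> 8 ^ n * (LINT x|m. \<bar>g x\<bar> powr p)"
proof -
  have "g \<circ> word_map w \<in> F" by (rule sobolev_word_map[OF g w])
  then have "\<bar>LINT x|m. (g \<circ> word_map w) x\<bar> powr p \<le> (LINT x|m. \<bar>(g \<circ> word_map w) x\<bar> powr p)"
    by (intro mean_powr_le_prob sobolev_measurable sobolev_integrable_powr)
  then show ?thesis using integral_powr_word_map_le[OF w g] by simp
qed

end

section \<open>The walk dimension is nonnegative\<close>

lemma powr_walk_dim:
  assumes "0 < \<rho>"
  shows "(1 / 3 ^ n) powr walk_dim \<rho> = 1 / (8 * \<rho>) ^ n"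
proof -
  have "(3::real) powr walk_dim \<rho> = 8 * \<rho>"
    using assms by (simp add: walk_dim_def powr_def)
  then have "(3 powr walk_dim \<rho>) ^ n = (8 * \<rho>) ^ n" by simp
  then have "(3 ^ n :: real) powr walk_dim \<rho> = (8 * \<rho>) ^ n"
    by (simp add: powr_power mult.commute powr_powr flip: powr_realpow[of 3])
  then show ?thesis by (simp add: powr_divide)
qed

lemma extensions_eq:
  assumes "w \<in> words k"
  shows "extensions n w = (\<lambda>v. w @ v) ` words n"
proof (intro equalityI subsetI)
  fix u assume u: "u \<in> extensions n w"
  then have "u = w @ drop (length w) u" "drop (length w) u \<in> words n"
    by (auto simp: extensions_def words_def dest: in_set_dropD) (metis append_take_drop_id)
  then show "u \<in> (\<lambda>v. w @ v) ` words n" by blast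
next
  fix u assume "u \<in> (\<lambda>v. w @ v) ` words n"
  then show "u \<in> extensions n w"
    using assms unfolding extensions_def words_def by clarsimp
qed

lemma graph_energy_nonneg: "0 \<le> graph_energy p n g"
  by (auto simp: graph_energy_def intro!: sum_nonneg)

text \<open>The indicator of the complement of the subcells of \<^term>\<open>w\<close> jumps only along edges that
  leave one of these \<open>8 ^ n\<close> subcells, and a cell has a bounded number of neighbours.\<close>

lemma word_conductance_bounds:
  assumes w: "w \<in> words k"
  shows "0 \<le> word_conductance p n w" "word_conductance p n w \<le> 9 * 8 ^ n"
proof -
  define X where "X = extensions n w"
  define g where "g u = (if u \<in> X then 0 else 1 :: real)" for u
  define A where "A = {g :: nat list \<Rightarrow> real. (\<forall>u\<in>extensions n w. g u = 0) \<and>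
                (\<forall>u \<in> words (length w + n) -
                   (\<Union>v\<in>{v \<in> words (length w). graph_dist (length w) v w \<le> 1}. extensions n v).
                   g u = 1)}"
  have len: "length w = k" using w by (simp add: words_def)
  have "graph_dist k w w \<le> enat 0"
    unfolding graph_dist_def by (rule INF_lower) simp
  then have "graph_dist k w w \<le> 1" by (simp add: zero_enat_def[symmetric])
  then have "g \<in> A" using w by (auto simp: A_def g_def X_def len)
  have wc: "word_conductance p n w = (INF g\<in>A. graph_energy p (length w + n) g)"
    by (simp add: word_conductance_def A_def)
  show "0 \<le> word_conductance p n w"
    unfolding wc using \<open>g \<in> A\<close> by (intro cINF_greatest) (auto simp: graph_energy_nonneg)
  have X: "finite X" "card X \<le> 8 ^ n"
    using card_image_le[OF finite_words, of "\<lambda>v. w @ v" n]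
    unfolding X_def extensions_eq[OF w] card_words by simp_all
  have X3: "X \<subseteq> words (k + n)" by (auto simp: X_def extensions_def len)
  let ?N = "\<lambda>u. {v \<in> words (k + n). \<bar>fst (grid_pos u) - fst (grid_pos v)\<bar> \<le> 1 \<and>
                \<bar>snd (grid_pos u) - snd (grid_pos v)\<bar> \<le> 1}"
  have count: "(\<Sum>u\<in>X. \<Sum>v\<in>?N u. 1::real) \<le> 9 * 8 ^ n"
  proof -
    have "(\<Sum>u\<in>X. \<Sum>v\<in>?N u. 1::real) \<le> (\<Sum>u\<in>X. 9)"
      using card_neighbours X3 by (intro sum_mono) (force simp: subset_iff)
    also have "\<dots> \<le> 9 * 8 ^ n" using X(2) by simp
    finally show ?thesis .
  qed
  have E: "(\<Sum>e\<in>edges (k + n). of_bool (fst e \<in> X) :: real) \<le> 9 * 8 ^ n"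
    "(\<Sum>e\<in>edges (k + n). of_bool (snd e \<in> X) :: real) \<le> 9 * 8 ^ n"
  proof -
    have fin: "finite (edges (k + n))"
      by (rule finite_subset[of _ "words (k + n) \<times> words (k + n)"]) (auto simp: edges_def)
    have sub: "card Y \<le> card (Sigma X ?N)" if "Y \<subseteq> Sigma X ?N" for Y
      using that X(1) by (intro card_mono) auto
    have cS: "real (card (Sigma X ?N)) = (\<Sum>u\<in>X. \<Sum>v\<in>?N u. 1::real)"
      using X(1) by (simp add: card_SigmaI)
    have "{e \<in> edges (k + n). fst e \<in> X} \<subseteq> Sigma X ?N"
      using edge_grid_pos by (fastforce simp: edges_def)
    then have 1: "real (card {e \<in> edges (k + n). fst e \<in> X}) \<le> 9 * 8 ^ n"
      using sub count cS by (metis (no_types, lifting) of_nat_le_iff order_trans)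
    have "prod.swap ` {e \<in> edges (k + n). snd e \<in> X} \<subseteq> Sigma X ?N"
    proof clarsimp
      fix u v assume "(u, v) \<in> edges (k + n)" "v \<in> X"
      then show "u \<in> words (k + n) \<and> \<bar>fst (grid_pos v) - fst (grid_pos u)\<bar> \<le> 1
          \<and> \<bar>snd (grid_pos v) - snd (grid_pos u)\<bar> \<le> 1"
        using edge_grid_pos[of u v "k + n"] by (auto simp: edges_def abs_minus_commute)
    qed
    from sub[OF this] have "card {e \<in> edges (k + n). snd e \<in> X} \<le> card (Sigma X ?N)"
      by (simp add: card_image)
    then have 2: "real (card {e \<in> edges (k + n). snd e \<in> X}) \<le> 9 * 8 ^ n"
      using count cS by (metis (no_types, lifting) of_nat_le_iff order_trans)
    show "(\<Sum>e\<in>edges (k + n). of_bool (fst e \<in> X) :: real) \<le> 9 * 8 ^ n"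
      "(\<Sum>e\<in>edges (k + n). of_bool (snd e \<in> X) :: real) \<le> 9 * 8 ^ n"
      using 1 2 fin by (simp_all add: sum_of_bool_eq Int_def)
  qed
  have "graph_energy p (k + n) g \<le> (\<Sum>e\<in>edges (k + n). of_bool (fst e \<in> X) + of_bool (snd e \<in> X)) / 2"
    unfolding graph_energy_def by (intro divide_right_mono sum_mono) (auto simp: g_def)
  also have "\<dots> \<le> 9 * 8 ^ n" using E by (simp add: sum.distrib)
  finally have "graph_energy p (length w + n) g \<le> 9 * 8 ^ n" by (simp add: len)
  moreover have "word_conductance p n w \<le> graph_energy p (length w + n) g"
    unfolding wc by (rule cINF_lower[OF _ \<open>g \<in> A\<close>]) (auto intro: bdd_belowI2 graph_energy_nonneg)
  ultimately show "word_conductance p n w \<le> 9 * 8 ^ n" by linarith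
qed

lemma conductance_bounds: "0 \<le> conductance p n" "conductance p n \<le> 9 * 8 ^ n"
proof -
  let ?W = "\<Union>k\<in>{1..}. words k"
  have W: "[1] \<in> ?W" by (auto simp: words_def intro!: exI[of _ 1])
  show "conductance p n \<le> 9 * 8 ^ n"
    unfolding conductance_def using W word_conductance_bounds(2)
    by (intro cSUP_least) blast+
  have "bdd_above (word_conductance p n ` ?W)"
    using word_conductance_bounds(2) by (intro bdd_aboveI2) blast
  then have "word_conductance p n [1] \<le> conductance p n"
    unfolding conductance_def using W by (intro cSUP_upper) auto
  moreover have "0 \<le> word_conductance p n [1]"
    by (rule word_conductance_bounds(1)[of _ 1]) (auto simp: words_def)
  ultimately show "0 \<le> conductance p n" by linarith
qed

text \<open>The bound \<open>9 * 8 ^ n\<close> on the conductances gives at least \<open>1 / 8\<close> in the limit. Positivity of \<open>\<rho>\<close> is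
what makes the conductances eventually nonzero; this matters because \<open>0 powr a\<close> is 0 even for
negative \<open>a\<close>.\<close>

lemma scaling_constant_ge:
  assumes "is_scaling_constant p \<rho>"
  shows "1 / 8 \<le> \<rho>"
proof -
  have lim: "(\<lambda>n. conductance p n powr (- 1 / real n)) \<longlonglongrightarrow> \<rho>" and pos: "0 < \<rho>"
    using assms by (auto simp: is_scaling_constant_def)
  have "(\<lambda>n. (9 * 8 ^ n) powr (- 1 / real n)) \<longlonglongrightarrow> (1 / 8 :: real)"
  proof -
    have "(\<lambda>n. 9 powr (- 1 / real n) * (1 / 8)) \<longlonglongrightarrow> 9 powr 0 * (1 / 8 :: real)"
      by (intro tendsto_intros lim_const_over_n) simp
    moreover have "\<forall>\<^sub>F n in sequentially.
        9 powr (- 1 / real n) * (1 / 8) = (9 * 8 ^ n) powr (- 1 / real n)"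
      using eventually_gt_at_top[of 0]
    proof eventually_elim
      case (elim n)
      have "(8 ^ n :: real) powr (- 1 / real n) = 8 powr (real n * (- 1 / real n))"
        by (simp add: powr_powr flip: powr_realpow)
      also have "\<dots> = 1 / 8" using elim by (simp add: powr_minus_divide)
      finally show ?case by (simp add: powr_mult)
    qed
    ultimately show ?thesis by (auto dest: Lim_transform_eventually)
  qed
  moreover have "\<forall>\<^sub>F n in sequentially. (9 * 8 ^ n) powr (- 1 / real n) \<le> conductance p n powr (- 1 / real n)"
    using order_tendstoD(1)[OF lim pos]
  proof eventually_elim
    case (elim n)
    then have "conductance p n \<noteq> 0" by auto
    then have "0 < conductance p n" using conductance_bounds(1)[of p n] by simp
    then show ?case using conductance_bounds(2)[of p n] by (intro powr_mono2') auto
  qed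
  ultimately show ?thesis
    using lim by (intro tendsto_le[OF _ lim]) auto
qed

lemma walk_dim_nonneg: "is_scaling_constant p \<rho> \<Longrightarrow> 0 \<le> walk_dim \<rho>"
  using scaling_constant_ge[of p \<rho>] by (simp add: walk_dim_def)

section \<open>Energy measures\<close>

lemma cell_dist:
  assumes "u \<in> words n" "v \<in> words n" "x \<in> cell u" "y \<in> cell v"
    and "\<bar>fst (grid_pos u) - fst (grid_pos v)\<bar> \<le> k" "\<bar>snd (grid_pos u) - snd (grid_pos v)\<bar> \<le> k"
  shows "dist x y \<le> (4 + 4 * k) / 3 ^ n"
proof -
  have near: "\<bar>c - d\<bar> \<le> (2 + 2 * k) / 3 ^ n"
    if "\<bar>3 ^ n * c - 2 * of_int a\<bar> \<le> 1" "\<bar>3 ^ n * d - 2 * of_int b\<bar> \<le> 1" "\<bar>a - b\<bar> \<le> k"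
    for a b :: int and c d :: real
  proof -
    have "\<bar>real_of_int a - of_int b\<bar> \<le> k" using that(3) by linarith
    then have "\<bar>3 ^ n * c - 3 ^ n * d\<bar> \<le> 2 + 2 * k" using that(1,2) by linarith
    then have "\<bar>3 ^ n * (c - d)\<bar> \<le> 2 + 2 * k" by (simp add: right_diff_distrib)
    then show ?thesis by (simp add: abs_mult pos_le_divide_eq mult.commute)
  qed
  have "\<bar>fst x - fst y\<bar> \<le> (2 + 2 * k) / 3 ^ n" "\<bar>snd x - snd y\<bar> \<le> (2 + 2 * k) / 3 ^ n"
    using near[OF cell_coords(1)[OF assms(1,3)] cell_coords(1)[OF assms(2,4)] assms(5)]
      near[OF cell_coords(2)[OF assms(1,3)] cell_coords(2)[OF assms(2,4)] assms(6)] by simp_all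
  then have "dist x y \<le> (2 + 2 * k) / 3 ^ n + (2 + 2 * k) / 3 ^ n"
    using dist_le_coords[of x y] by linarith
  then show ?thesis by (simp flip: add_divide_distrib)
qed

lemma exists_small_power:
  assumes "0 < (e::real)" shows "\<exists>n. K / 3 ^ n < e"
proof -
  obtain n where n: "\<bar>K\<bar> / e < 3 ^ n" using real_arch_pow[of 3 "\<bar>K\<bar> / e"] by auto
  then have "\<bar>K\<bar> / 3 ^ n < e" using assms by (simp add: field_simps)
  moreover have "K / 3 ^ n \<le> \<bar>K\<bar> / 3 ^ n" by (intro divide_right_mono) auto
  ultimately show ?thesis by (intro exI[of _ n]) linarith
qed

lemma prefix_word: "\<omega> \<in> shift_space \<Longrightarrow> map \<omega> [0..<n] \<in> words n"
  by (auto simp: shift_space_def words_def)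

text \<open>The nested cells along a sequence are compact and shrink to a single point, which is the value of
the coding map.\<close>

lemma coding_in_cell:
  assumes \<omega>: "\<omega> \<in> shift_space"
  shows "coding \<omega> \<in> cell (map \<omega> [0..<n])"
proof -
  define C where "C n = cell (map \<omega> [0..<n])" for n
  have "C (Suc n) \<subseteq> C n" for n
  proof -
    have "\<omega> n \<in> {1..8}" using \<omega> by (simp add: shift_space_def)
    then show ?thesis by (auto simp: C_def cell_def word_map_append carpet_map_in)
  qed
  then have dec: "C n \<subseteq> C m" if "m \<le> n" for m n
    using lift_Suc_antimono_le[of C, OF _ that] by blast
  have "C n \<noteq> {}" "compact (C n)" for n
    using carpet_props(2) cell_compact by (auto simp: C_def cell_def)
  then have "\<Inter> (range C) \<noteq> {}" using compact_nest[of C] dec by blast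
  then obtain z where z: "\<And>n. z \<in> C n" by blast
  have "y = z" if "\<And>n. y \<in> C n" for y
  proof (rule ccontr)
    assume "y \<noteq> z"
    then obtain n where "4 / 3 ^ n < dist y z" using exists_small_power[of "dist y z"] by auto
    then show False
      using cell_dist[OF prefix_word[OF \<omega>] prefix_word[OF \<omega>], of y n z 0] that[of n] z[of n]
      by (simp add: C_def)
  qed
  then have "(\<Inter>n. C n) = {z}" using z by blast
  then have "coding \<omega> = z" by (simp add: coding_def C_def)
  then show ?thesis using z by (simp add: C_def)
qed

lemma coding_continuous: "continuous_on shift_space coding"
  unfolding continuous_on_topological
proof (intro ballI allI impI)
  fix \<omega> B assume \<omega>: "\<omega> \<in> shift_space" and B: "open B" "coding \<omega> \<in> B"
  obtain e where e: "e > 0" "ball (coding \<omega>) e \<subseteq> B" using B by (meson open_contains_ball)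
  obtain n where n: "4 / 3 ^ n < e" using exists_small_power[OF e(1)] by blast
  define A where "A = Pi\<^sub>E UNIV (\<lambda>k. if k < n then {\<omega> k} else UNIV)"
  have "open A" unfolding A_def
    by (rule open_PiE, rule Topological_Spaces.open_discrete)
       (auto intro: finite_subset[of _ "{..<n}"])
  moreover have "coding \<eta> \<in> B" if \<eta>: "\<eta> \<in> shift_space" "\<eta> \<in> A" for \<eta>
  proof -
    have "\<eta> k = \<omega> k" if "k < n" for k
    proof -
      have "\<eta> k \<in> (if k < n then {\<omega> k} else UNIV)" using \<eta>(2) unfolding A_def by (rule PiE_mem) simp
      then show ?thesis using that by simp
    qed
    then have "map \<eta> [0..<n] = map \<omega> [0..<n]" by simp
    then have "coding \<eta> \<in> cell (map \<omega> [0..<n])" using coding_in_cell[OF \<eta>(1), of n] by metis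
    then have "dist (coding \<omega>) (coding \<eta>) \<le> 4 / 3 ^ n"
      using cell_dist[OF prefix_word[OF \<omega>] prefix_word[OF \<omega>] coding_in_cell[OF \<omega>], of "coding \<eta>" n 0]
      by simp
    then show ?thesis using n e(2) by auto
  qed
  ultimately show "\<exists>A. open A \<and> \<omega> \<in> A \<and> (\<forall>y\<in>shift_space. y \<in> A \<longrightarrow> coding y \<in> B)"
    by (intro exI[of _ A]) (auto simp: A_def)
qed

text \<open>A cell contains the image of its cylinder under the coding map, so the energy carried by the
cylinder is seen by every ball that contains the cell.\<close>

lemma energy_measure_ge:
  assumes \<mu>: "is_symbolic_energy_measure \<rho> \<E> f \<mu>" and w: "w \<in> words n"
    and sub: "cell w \<subseteq> carpet_ball x R"
  shows "\<rho> ^ n * \<E> (f \<circ> word_map w) \<le> measure (energy_measure \<mu>) (carpet_ball x R)"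
proof -
  have fin: "finite_measure \<mu>" and sets: "sets \<mu> = sets (restrict_space borel shift_space)"
    and cyl: "measure \<mu> (cylinder w) = \<rho> ^ n * \<E> (f \<circ> word_map w)"
    using \<mu> w by (auto simp: is_symbolic_energy_measure_def)
  have sp: "space \<mu> = shift_space"
    using sets_eq_imp_space_eq[OF sets] by (simp add: space_restrict_space)
  have "coding \<in> measurable (restrict_space borel shift_space) borel"
    by (rule borel_measurable_continuous_on_restrict[OF coding_continuous])
  moreover have "coding \<omega> \<in> carpet" if "\<omega> \<in> shift_space" for \<omega>
    using coding_in_cell[OF that, of 0] by (simp add: cell_def)
  ultimately have "coding \<in> measurable (restrict_space borel shift_space) (restrict_space borel carpet)"
    by (intro measurable_restrict_space2) (auto simp: space_restrict_space)
  then have meas: "coding \<in> measurable \<mu> (restrict_space borel carpet)"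
    using measurable_cong_sets[OF sets refl] by blast
  have "carpet_ball x R = carpet \<inter> ball x R" by (auto simp: carpet_ball_def)
  then have B: "carpet_ball x R \<in> sets (restrict_space borel carpet)"
    by (auto simp: sets_restrict_space)
  have "measure (energy_measure \<mu>) (carpet_ball x R) = measure \<mu> (coding -` carpet_ball x R \<inter> space \<mu>)"
    unfolding energy_measure_def by (rule measure_distr[OF meas B])
  moreover have "cylinder w \<subseteq> coding -` carpet_ball x R \<inter> space \<mu>"
  proof
    fix \<omega> assume "\<omega> \<in> cylinder w"
    then have "\<omega> \<in> shift_space" "map \<omega> [0..<length w] = w" by (auto simp: cylinder_def)
    then show "\<omega> \<in> coding -` carpet_ball x R \<inter> space \<mu>"
      using coding_in_cell[of \<omega> "length w"] sub sp by auto
  qed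
  then have "measure \<mu> (cylinder w) \<le> measure \<mu> (coding -` carpet_ball x R \<inter> space \<mu>)"
    by (intro finite_measure.finite_measure_mono fin measurable_sets[OF meas B])
  ultimately show ?thesis using cyl by simp
qed

section \<open>Comparing means over neighbouring cells\<close>

text \<open>The map \<open>\<iota>\<close> folds the carpet onto the union of the cells \<open>u\<close> and \<open>v\<close>: it carries each first-level cell
onto one of them by a reflection and a scaling, without reflection for the two cells \<open>i\<close> and \<open>j\<close>
that represent \<open>u\<close> and \<open>v\<close>. Composing with \<open>\<iota>\<close> continues a function from the two cells to the whole
carpet.\<close>

definition foldable :: "nat list \<Rightarrow> nat list \<Rightarrow> bool" where
  "foldable u v \<longleftrightarrow> (\<exists>\<iota> i j. i \<in> {1..8} \<and> j \<in> {1..8} \<and>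
     (\<forall>x\<in>carpet. \<iota> (carpet_map i x) = word_map u x) \<and>
     (\<forall>x\<in>carpet. \<iota> (carpet_map j x) = word_map v x) \<and>
     (\<forall>k\<in>{1..8}. \<exists>w\<in>{u, v}. \<exists>s t. \<bar>s\<bar> = 1 \<and> \<bar>t\<bar> = 1 \<and>
        (\<forall>x\<in>carpet. \<iota> (carpet_map k x) = word_map w (reflect s t x))))"

text \<open>The coordinate maps of the foldings, written in \<open>t = 3 * x\<close>: \<open>3 - \<bar>t - 1\<bar>\<close> runs through two
adjacent intervals \<open>[-1, 1]\<close> and \<open>[1, 3]\<close> and turns back, while \<open>1 - \<bar>2 - \<bar>t - 1\<bar>\<bar>\<close> zigzags three times
through \<open>[-1, 1]\<close>.\<close>

lemma walk_eq:
  fixes x :: real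
  assumes "\<bar>x\<bar> \<le> 1" "\<bar>d\<bar> \<le> (1::int)"
  shows "3 - \<bar>x + 2 * of_int d - 1\<bar> = (if d = 1 then -1 else 1) * x + (if d = -1 then 0 else 2)"
proof -
  have "d = -1 \<or> d = 0 \<or> d = 1" using assms(2) by auto
  then show ?thesis using assms(1) by auto
qed

lemma zigzag_eq:
  fixes x :: real
  assumes "\<bar>x\<bar> \<le> 1" "\<bar>d\<bar> \<le> (1::int)"
  shows "1 - \<bar>2 - \<bar>x + 2 * of_int d - 1\<bar>\<bar> = (if d = 0 then -1 else 1) * x"
proof -
  have "d = -1 \<or> d = 0 \<or> d = 1" using assms(2) by auto
  then show ?thesis using assms(1) by auto
qed

lemma foldable_horizontal:
  assumes u: "u \<in> words n" and v: "v \<in> words n"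
    and pos: "grid_pos v = (fst (grid_pos u) + 1, snd (grid_pos u))"
  shows "foldable u v"
proof -
  obtain a b where ab: "grid_pos u = (a, b)" by force
  define \<iota> where "\<iota> x = ((3 - \<bar>3 * fst x - 1\<bar> + 2 * of_int a) / 3 ^ n,
      (1 - \<bar>2 - \<bar>3 * snd x - 1\<bar>\<bar> + 2 * of_int b) / 3 ^ n)" for x :: "real \<times> real"
  have main: "\<iota> (carpet_map k x) = word_map (if fst (digit k) = -1 then u else v)
      (reflect (if fst (digit k) = 1 then -1 else 1) (if snd (digit k) = 0 then -1 else 1) x)"
    if k: "k \<in> {1..8}" and x: "x \<in> carpet" for k x
  proof -
    have "3 * fst (carpet_map k x) = fst x + 2 * of_int (fst (digit k))"
      "3 * snd (carpet_map k x) = snd x + 2 * of_int (snd (digit k))"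
      by (simp_all add: carpet_map_eq[OF k])
    then show ?thesis
      using digit_bounds[OF k] carpet_bounds[OF x]
      by (simp add: \<iota>_def walk_eq zigzag_eq word_map_eq[OF u] word_map_eq[OF v] pos ab reflect_def)
  qed
  have id: "reflect 1 1 x = x" for x by (simp add: reflect_def)
  show ?thesis
    unfolding foldable_def
  proof (rule exI[of _ \<iota>], rule exI[of _ 1], rule exI[of _ 2], intro conjI ballI)
    fix x assume x: "x \<in> carpet"
    show "\<iota> (carpet_map 1 x) = word_map u x" "\<iota> (carpet_map 2 x) = word_map v x"
      using main[of 1, OF _ x] main[of 2, OF _ x] by (simp_all add: id)
  next
    fix k :: nat assume k: "k \<in> {1..8}"
    show "\<exists>w\<in>{u, v}. \<exists>s t. \<bar>s\<bar> = 1 \<and> \<bar>t\<bar> = 1 \<and>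
        (\<forall>x\<in>carpet. \<iota> (carpet_map k x) = word_map w (reflect s t x))"
      using main[OF k]
      by (intro bexI[of _ "if fst (digit k) = -1 then u else v"]
          exI[of _ "if fst (digit k) = 1 then -1 else 1"]
          exI[of _ "if snd (digit k) = 0 then -1 else 1"]) auto
  qed auto
qed

lemma foldable_vertical:
  assumes u: "u \<in> words n" and v: "v \<in> words n"
    and pos: "grid_pos v = (fst (grid_pos u), snd (grid_pos u) + 1)"
  shows "foldable u v"
proof -
  obtain a b where ab: "grid_pos u = (a, b)" by force
  define \<iota> where "\<iota> x = ((1 - \<bar>2 - \<bar>3 * fst x - 1\<bar>\<bar> + 2 * of_int a) / 3 ^ n,
      (3 - \<bar>3 * snd x - 1\<bar> + 2 * of_int b) / 3 ^ n)" for x :: "real \<times> real"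
  have main: "\<iota> (carpet_map k x) = word_map (if snd (digit k) = -1 then u else v)
      (reflect (if fst (digit k) = 0 then -1 else 1) (if snd (digit k) = 1 then -1 else 1) x)"
    if k: "k \<in> {1..8}" and x: "x \<in> carpet" for k x
  proof -
    have "3 * fst (carpet_map k x) = fst x + 2 * of_int (fst (digit k))"
      "3 * snd (carpet_map k x) = snd x + 2 * of_int (snd (digit k))"
      by (simp_all add: carpet_map_eq[OF k])
    then show ?thesis
      using digit_bounds[OF k] carpet_bounds[OF x]
      by (simp add: \<iota>_def walk_eq zigzag_eq word_map_eq[OF u] word_map_eq[OF v] pos ab reflect_def)
  qed
  have id: "reflect 1 1 x = x" for x by (simp add: reflect_def)
  show ?thesis
    unfolding foldable_def
  proof (rule exI[of _ \<iota>], rule exI[of _ 1], rule exI[of _ 8], intro conjI ballI)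
    fix x assume x: "x \<in> carpet"
    show "\<iota> (carpet_map 1 x) = word_map u x"
      using main[of 1, OF _ x] by (simp add: id)
    have "\<iota> (carpet_map 8 x) = word_map v (reflect 1 1 x)"
      using main[of 8, OF _ x] by simp
    then show "\<iota> (carpet_map 8 x) = word_map v x" by (simp add: id)
  next
    fix k :: nat assume k: "k \<in> {1..8}"
    show "\<exists>w\<in>{u, v}. \<exists>s t. \<bar>s\<bar> = 1 \<and> \<bar>t\<bar> = 1 \<and>
        (\<forall>x\<in>carpet. \<iota> (carpet_map k x) = word_map w (reflect s t x))"
      using main[OF k]
      by (intro bexI[of _ "if snd (digit k) = -1 then u else v"]
          exI[of _ "if fst (digit k) = 0 then -1 else 1"]
          exI[of _ "if snd (digit k) = 1 then -1 else 1"]) auto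
  qed auto
qed

context carpet_energy
begin

lemma le_powr_inverse:
  assumes "0 \<le> a" "0 \<le> b" "0 \<le> c" "a powr p \<le> c * b powr p"
  shows "a \<le> c powr (1 / p) * b"
proof -
  have "(a powr p) powr (1 / p) \<le> (c * b powr p) powr (1 / p)"
    using assms p_gt_1 by (intro powr_mono2) auto
  then show ?thesis using assms p_gt_1 by (simp add: powr_powr powr_mult)
qed

text \<open>The function \<open>h = f \<circ> \<iota>\<close> transports the problem to the whole carpet: the two means become means of
\<open>h\<close> over first-level cells, both close to the mean of \<open>h\<close> over the carpet by the Poincare inequality
there, while self-similarity computes the energy of \<open>h\<close> from the energies of \<open>f\<close> on \<open>u\<close> and \<open>v\<close>.
The constant \<open>64 * C1 * \<rho>\<close> collects the Poincare constant, the factor \<open>\<rho>\<close>, the eight pieces and the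
mass \<open>1 / 8\<close> of a first-level cell.\<close>

lemma mean_difference_foldable_continuous:
  "\<exists>C\<ge>0. \<forall>n. \<forall>u\<in>words n. \<forall>v\<in>words n. foldable u v \<longrightarrow> (\<forall>f\<in>FC.
     \<bar>(LINT x|m. f (word_map u x)) - (LINT x|m. f (word_map v x))\<bar>
       \<le> C * (energy_norm (f \<circ> word_map u) + energy_norm (f \<circ> word_map v)))"
proof -
  obtain C1 where C1: "C1 \<ge> 1"
    "\<And>f. f \<in> F \<Longrightarrow> (LINT x|m. \<bar>f x - (LINT y|m. f y)\<bar> powr p) \<le> C1 * \<E> f"
    using energy_constants by blast
  define K where "K = (64 * C1 * \<rho>) powr (1 / p)"
  have "\<bar>(LINT x|m. f (word_map u x)) - (LINT x|m. f (word_map v x))\<bar>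
       \<le> 2 * K * (energy_norm (f \<circ> word_map u) + energy_norm (f \<circ> word_map v))"
    if uv: "u \<in> words n" "v \<in> words n" "foldable u v" and f: "f \<in> FC" for n u v f
  proof -
    define X where "X = max (energy_norm (f \<circ> word_map u)) (energy_norm (f \<circ> word_map v))"
    obtain \<iota> i j where \<iota>: "i \<in> {1..8}" "j \<in> {1..8}"
      "\<And>x. x \<in> carpet \<Longrightarrow> \<iota> (carpet_map i x) = word_map u x"
      "\<And>x. x \<in> carpet \<Longrightarrow> \<iota> (carpet_map j x) = word_map v x"
      "\<And>k. k \<in> {1..8} \<Longrightarrow> \<exists>w\<in>{u, v}. \<exists>s t. \<bar>s\<bar> = 1 \<and> \<bar>t\<bar> = 1 \<and>
        (\<forall>x\<in>carpet. \<iota> (carpet_map k x) = word_map w (reflect s t x))"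
      using uv(3) unfolding foldable_def by blast
    define h where "h = f \<circ> \<iota>"
    have piece: "h \<circ> carpet_map k \<in> FC \<and> \<E> (h \<circ> carpet_map k) \<le> X powr p"
      if k: "k \<in> {1..8}" for k
    proof -
      obtain w s t where w: "w \<in> {u, v}" "\<bar>s\<bar> = 1" "\<bar>t\<bar> = 1"
        "\<And>x. x \<in> carpet \<Longrightarrow> \<iota> (carpet_map k x) = word_map w (reflect s t x)"
        using \<iota>(5)[OF k] by blast
      have fw: "f \<circ> word_map w \<in> FC" using FC_word_map[OF f] uv w(1) by blast
      have fr: "f \<circ> word_map w \<circ> reflect s t \<in> FC"
        "\<E> (f \<circ> word_map w \<circ> reflect s t) = \<E> (f \<circ> word_map w)"
        using FC_reflect[OF fw w(2,3)] by blast+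
      have eq: "(h \<circ> carpet_map k) x = (f \<circ> word_map w \<circ> reflect s t) x" if "x \<in> carpet" for x
        using w(4)[OF that] by (simp add: h_def)
      have hk: "h \<circ> carpet_map k \<in> FC"
        using FC_cong[of "h \<circ> carpet_map k", OF eq] fr(1) by blast
      then have "h \<circ> carpet_map k \<in> F" unfolding FC_iff by blast
      then have "\<E> (h \<circ> carpet_map k) = \<E> (f \<circ> word_map w)"
        using energy_cong[of "h \<circ> carpet_map k", OF eq] unfolding fr(2) by blast
      also have "\<dots> = energy_norm (f \<circ> word_map w) powr p"
        using fw by (intro energy_eq) (simp add: FC_iff)
      also have "\<dots> \<le> X powr p"
        using w(1) p_gt_1 by (intro powr_mono2) (auto simp: X_def)
      finally show ?thesis using hk by blast
    qed
    have h: "h \<in> FC" by (rule FC_glue_letters) (use piece in blast)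
    then have hF: "h \<in> F" by (simp add: FC_iff)
    have "\<E> h = \<rho> * (\<Sum>w\<in>words 1. \<E> (h \<circ> word_map w))"
      using energy_words[OF hF, of 1] by simp
    also have "(\<Sum>w\<in>words 1. \<E> (h \<circ> word_map w)) \<le> real (card (words 1)) * X powr p"
    proof (rule sum_bounded_above)
      fix w assume "w \<in> words 1"
      then obtain k where "w = [k]" "k \<in> {1..8}" by (auto simp: words_def length_Suc_conv)
      then show "\<E> (h \<circ> word_map w) \<le> X powr p" using piece by simp
    qed
    finally have Eh: "\<E> h \<le> \<rho> * (8 * X powr p)" using rho_pos by (simp add: card_words)
    define c where "c = (LINT y|m. h y)"
    have mean: "\<bar>(LINT x|m. h (carpet_map l x)) - c\<bar> \<le> K * X" if l: "l \<in> {1..8}" for l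
    proof -
      have l': "[l] \<in> words 1" using l by (auto simp: words_def)
      have hc: "(\<lambda>x. h x - c) \<in> F" by (intro sobolev_diff hF sobolev_const)
      have "integrable m (\<lambda>x. h (carpet_map l x))"
        using sobolev_integrable[OF sobolev_word_map[OF hF l']] by (simp add: o_def)
      then have "(LINT x|m. h (carpet_map l x) - c) = (LINT x|m. h (carpet_map l x)) - c"
        using prob_space by simp
      then have "\<bar>(LINT x|m. h (carpet_map l x)) - c\<bar> powr p \<le> 8 * (LINT x|m. \<bar>h x - c\<bar> powr p)"
        using mean_word_map_le[OF l' hc] by simp
      also have "\<dots> \<le> 8 * (C1 * \<E> h)" using C1(2)[OF hF] by (simp add: c_def)
      also have "\<dots> \<le> 8 * (C1 * (\<rho> * (8 * X powr p)))"
        using Eh C1(1) by (intro mult_left_mono) auto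
      finally have "\<bar>(LINT x|m. h (carpet_map l x)) - c\<bar> powr p \<le> (64 * C1 * \<rho>) * X powr p"
        by (simp add: mult_ac)
      then show ?thesis
        unfolding K_def using C1(1) rho_pos by (intro le_powr_inverse) (auto simp: X_def le_max_iff_disj)
    qed
    have "(LINT x|m. h (carpet_map i x)) = (LINT x|m. f (word_map u x))"
      "(LINT x|m. h (carpet_map j x)) = (LINT x|m. f (word_map v x))"
      using \<iota>(3,4) by (auto simp: h_def intro!: Bochner_Integration.integral_cong)
    then have "\<bar>(LINT x|m. f (word_map u x)) - (LINT x|m. f (word_map v x))\<bar> \<le> 2 * K * X"
      using mean[OF \<iota>(1)] mean[OF \<iota>(2)] by linarith
    also have "\<dots> \<le> 2 * K * (energy_norm (f \<circ> word_map u) + energy_norm (f \<circ> word_map v))"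
      by (intro mult_left_mono) (auto simp: K_def X_def)
    finally show ?thesis .
  qed
  then show ?thesis by (intro exI[of _ "2 * K"]) (auto simp: K_def)
qed

lemma energy_norm_word_map_le:
  assumes f: "f \<in> F" and w: "w \<in> words n"
  shows "energy_norm (f \<circ> word_map w) \<le> (1 / \<rho> ^ n) powr (1 / p) * energy_norm f"
proof (rule le_powr_inverse)
  show "energy_norm (f \<circ> word_map w) powr p \<le> 1 / \<rho> ^ n * energy_norm f powr p"
    using energy_word_map_le[OF f w] energy_eq[OF f] energy_eq[OF sobolev_word_map[OF f w]] by simp
qed (use rho_pos in auto)

text \<open>For fixed \<open>u\<close> and \<open>v\<close> both sides are continuous in \<open>f\<close> for the Sobolev norm, with a modulus of
continuity that may depend on the level; the constant \<open>C\<close> of the continuous case is kept.\<close>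

lemma mean_difference_foldable:
  "\<exists>C\<ge>0. \<forall>n. \<forall>u\<in>words n. \<forall>v\<in>words n. foldable u v \<longrightarrow> (\<forall>f\<in>F.
     \<bar>(LINT x|m. f (word_map u x)) - (LINT x|m. f (word_map v x))\<bar>
       \<le> C * (energy_norm (f \<circ> word_map u) + energy_norm (f \<circ> word_map v)))"
proof -
  obtain C where C: "C \<ge> 0" "\<And>n u v f. u \<in> words n \<Longrightarrow> v \<in> words n \<Longrightarrow> foldable u v \<Longrightarrow> f \<in> FC \<Longrightarrow>
     \<bar>(LINT x|m. f (word_map u x)) - (LINT x|m. f (word_map v x))\<bar>
       \<le> C * (energy_norm (f \<circ> word_map u) + energy_norm (f \<circ> word_map v))"
    using mean_difference_foldable_continuous by blast
  have "\<bar>(LINT x|m. f (word_map u x)) - (LINT x|m. f (word_map v x))\<bar>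
       \<le> C * (energy_norm (f \<circ> word_map u) + energy_norm (f \<circ> word_map v))"
    if uv: "u \<in> words n" "v \<in> words n" "foldable u v" and f: "f \<in> F" for n u v f
  proof -
    define A where "A = (8 ^ n) powr (1 / p)"
    define B where "B = (1 / \<rho> ^ n) powr (1 / p)"
    have AB: "A \<ge> 0" "B \<ge> 0" by (simp_all add: A_def B_def)
    define R where "R = C * (energy_norm (f \<circ> word_map u) + energy_norm (f \<circ> word_map v))"
    have approx: "\<bar>(LINT x|m. f (word_map u x)) - (LINT x|m. f (word_map v x))\<bar>
        \<le> R + (2 * A + 2 * C * B) * \<epsilon>" if \<epsilon>: "\<epsilon> > 0" for \<epsilon>
    proof -
      obtain g where g: "g \<in> FC" "energy_norm (\<lambda>x. f x - g x) \<le> \<epsilon>" "lp_norm p m (\<lambda>x. f x - g x) \<le> \<epsilon>"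
        using dense_continuous[OF f \<epsilon>] by blast
      have gF: "g \<in> F" using g(1) by (simp add: FC_iff)
      define d where "d = (\<lambda>x. f x - g x)"
      have d: "d \<in> F" unfolding d_def by (intro sobolev_diff f gF)
      have md: "\<bar>(LINT x|m. f (word_map w x)) - (LINT x|m. g (word_map w x))\<bar> \<le> A * \<epsilon>"
        if w: "w \<in> words n" for w
      proof -
        have "(LINT x|m. d (word_map w x)) = (LINT x|m. f (word_map w x)) - (LINT x|m. g (word_map w x))"
          using sobolev_integrable[OF sobolev_word_map[OF f w]] sobolev_integrable[OF sobolev_word_map[OF gF w]]
          by (simp add: d_def o_def)
        moreover have "\<bar>LINT x|m. d (word_map w x)\<bar> \<le> A * lp_norm p m d"
          unfolding A_def
        proof (rule le_powr_inverse)
          have "0 \<le> (LINT x|m. \<bar>d x\<bar> powr p)" by (intro integral_nonneg_AE AE_I2) auto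
          then have "lp_norm p m d powr p = (LINT x|m. \<bar>d x\<bar> powr p)"
            using p_gt_1 by (simp add: lp_norm_def powr_powr)
          then show "\<bar>LINT x|m. d (word_map w x)\<bar> powr p \<le> 8 ^ n * lp_norm p m d powr p"
            using mean_word_map_le[OF w d] by simp
        qed (auto simp: lp_norm_def)
        moreover have "A * lp_norm p m d \<le> A * \<epsilon>"
          using g(3) AB by (intro mult_left_mono) (auto simp: d_def)
        ultimately show ?thesis by linarith
      qed
      have nd: "energy_norm (g \<circ> word_map w) \<le> energy_norm (f \<circ> word_map w) + B * \<epsilon>"
        if w: "w \<in> words n" for w
      proof -
        have "energy_norm (\<lambda>x. (g \<circ> word_map w) x - (f \<circ> word_map w) x) \<le> energy_norm (d \<circ> word_map w)"
          using conjunct2[OF sobolev_uminus[OF sobolev_word_map[OF d w]]] by (simp add: d_def o_def)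
        also have "\<dots> \<le> B * energy_norm d"
          unfolding B_def by (rule energy_norm_word_map_le[OF d w])
        also have "\<dots> \<le> B * \<epsilon>" using g(2) AB by (intro mult_left_mono) (auto simp: d_def)
        finally show ?thesis
          using energy_norm_le_diff[OF sobolev_word_map[OF gF w] sobolev_word_map[OF f w]] by linarith
      qed
      have "C * (energy_norm (g \<circ> word_map u) + energy_norm (g \<circ> word_map v))
          \<le> C * ((energy_norm (f \<circ> word_map u) + B * \<epsilon>) + (energy_norm (f \<circ> word_map v) + B * \<epsilon>))"
        by (intro mult_left_mono add_mono nd uv C)
      also have "\<dots> = R + 2 * C * B * \<epsilon>" by (simp add: R_def algebra_simps)
      finally have "\<bar>(LINT x|m. g (word_map u x)) - (LINT x|m. g (word_map v x))\<bar> \<le> R + 2 * C * B * \<epsilon>"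
        using C(2)[OF uv g(1)] by linarith
      then have "\<bar>(LINT x|m. f (word_map u x)) - (LINT x|m. f (word_map v x))\<bar>
          \<le> R + 2 * C * B * \<epsilon> + 2 * (A * \<epsilon>)"
        using md[OF uv(1)] md[OF uv(2)] by linarith
      then show ?thesis by (simp add: algebra_simps)
    qed
    have "\<bar>(LINT x|m. f (word_map u x)) - (LINT x|m. f (word_map v x))\<bar> \<le> R"
    proof (rule field_le_epsilon)
      fix e :: real assume e: "0 < e"
      let ?K = "2 * A + 2 * C * B"
      have K: "?K \<ge> 0" using AB C(1) by simp
      then have "?K * (e / (?K + 1)) \<le> e" using e by (simp add: field_simps)
      then show "\<bar>(LINT x|m. f (word_map u x)) - (LINT x|m. f (word_map v x))\<bar> \<le> R + e"
        using approx[of "e / (?K + 1)"] e K by fastforce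
    qed
    then show ?thesis by (simp add: R_def)
  qed
  then show ?thesis using C(1) by blast
qed

text \<open>The path from \<open>u\<close> to \<open>v\<close> runs through the third cell of their two-by-two block; edge-adjacent and
equal cells are covered too, with a step of the path that does not move.\<close>

lemma mean_difference_neighbour:
  "\<exists>C\<ge>0. \<forall>n. \<forall>u\<in>words n. \<forall>v\<in>words n.
     \<bar>fst (grid_pos u) - fst (grid_pos v)\<bar> \<le> 1 \<and> \<bar>snd (grid_pos u) - snd (grid_pos v)\<bar> \<le> 1 \<longrightarrow>
     (\<exists>w\<in>words n. \<bar>fst (grid_pos u) - fst (grid_pos w)\<bar> \<le> 1 \<and> \<bar>snd (grid_pos u) - snd (grid_pos w)\<bar> \<le> 1 \<and>
       (\<forall>f\<in>F. \<bar>(LINT x|m. f (word_map u x)) - (LINT x|m. f (word_map v x))\<bar>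
       \<le> C * (energy_norm (f \<circ> word_map u) + 2 * energy_norm (f \<circ> word_map w) + energy_norm (f \<circ> word_map v))))"
proof -
  obtain C where C: "C \<ge> 0" "\<And>n u v f. u \<in> words n \<Longrightarrow> v \<in> words n \<Longrightarrow> foldable u v \<Longrightarrow> f \<in> F \<Longrightarrow>
     \<bar>(LINT x|m. f (word_map u x)) - (LINT x|m. f (word_map v x))\<bar>
       \<le> C * (energy_norm (f \<circ> word_map u) + energy_norm (f \<circ> word_map v))"
    using mean_difference_foldable by blast
  have edge: "\<bar>(LINT x|m. f (word_map u x)) - (LINT x|m. f (word_map v x))\<bar>
       \<le> C * (energy_norm (f \<circ> word_map u) + energy_norm (f \<circ> word_map v))"
    if uv: "u \<in> words n" "v \<in> words n" and f: "f \<in> F"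
      and near: "\<bar>fst (grid_pos u) - fst (grid_pos v)\<bar> \<le> 1" "\<bar>snd (grid_pos u) - snd (grid_pos v)\<bar> \<le> 1"
      and axis: "fst (grid_pos u) = fst (grid_pos v) \<or> snd (grid_pos u) = snd (grid_pos v)" for n u v f
  proof -
    obtain a b where a: "grid_pos u = (a, b)" by force
    obtain c d where c: "grid_pos v = (c, d)" by force
    from near axis have "(a, b) = (c, d) \<or> (c, d) = (a + 1, b) \<or> (a, b) = (c + 1, d) \<or>
        (c, d) = (a, b + 1) \<or> (a, b) = (c, d + 1)"
      unfolding a c by auto
    then consider "grid_pos u = grid_pos v" | "foldable u v" | "foldable v u"
      using foldable_horizontal[OF uv] foldable_horizontal[OF uv(2,1)]
        foldable_vertical[OF uv] foldable_vertical[OF uv(2,1)] unfolding a c fst_conv snd_conv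
      by blast
    then show ?thesis
    proof cases
      case 1
      then have "u = v" using grid_pos_inj uv by (auto dest: inj_onD)
      then show ?thesis using C(1) by simp
    next
      case 2
      then show ?thesis using C(2)[OF uv 2 f] by simp
    next
      case 3
      then show ?thesis using C(2)[OF uv(2,1) 3 f] by (simp add: abs_minus_commute add.commute)
    qed
  qed
  show ?thesis
  proof (intro exI[of _ C] conjI C(1) allI ballI impI; elim conjE)
    fix n u v assume uv: "u \<in> words n" "v \<in> words n"
      and near: "\<bar>fst (grid_pos u) - fst (grid_pos v)\<bar> \<le> 1" "\<bar>snd (grid_pos u) - snd (grid_pos v)\<bar> \<le> 1"
    obtain w where w: "w \<in> words n" "grid_pos w = (fst (grid_pos u), snd (grid_pos v)) \<or>
        grid_pos w = (fst (grid_pos v), snd (grid_pos u))"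
      using grid_pos_corner_filled[OF uv near] by blast
    have uw: "\<bar>fst (grid_pos u) - fst (grid_pos w)\<bar> \<le> 1" "\<bar>snd (grid_pos u) - snd (grid_pos w)\<bar> \<le> 1"
      "fst (grid_pos u) = fst (grid_pos w) \<or> snd (grid_pos u) = snd (grid_pos w)"
      and wv: "\<bar>fst (grid_pos w) - fst (grid_pos v)\<bar> \<le> 1" "\<bar>snd (grid_pos w) - snd (grid_pos v)\<bar> \<le> 1"
      "fst (grid_pos w) = fst (grid_pos v) \<or> snd (grid_pos w) = snd (grid_pos v)"
      using w(2) near by auto
    have "\<bar>(LINT x|m. f (word_map u x)) - (LINT x|m. f (word_map v x))\<bar>
       \<le> C * (energy_norm (f \<circ> word_map u) + 2 * energy_norm (f \<circ> word_map w) + energy_norm (f \<circ> word_map v))"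
      if f: "f \<in> F" for f
    proof -
      have "C * (energy_norm (f \<circ> word_map u) + 2 * energy_norm (f \<circ> word_map w) + energy_norm (f \<circ> word_map v))
         = C * (energy_norm (f \<circ> word_map u) + energy_norm (f \<circ> word_map w))
         + C * (energy_norm (f \<circ> word_map w) + energy_norm (f \<circ> word_map v))"
        by (simp add: algebra_simps)
      then show ?thesis using edge[OF uv(1) w(1) f uw] edge[OF w(1) uv(2) f wv] by linarith
    qed
    then show "\<exists>w\<in>words n. \<bar>fst (grid_pos u) - fst (grid_pos w)\<bar> \<le> 1 \<and> \<bar>snd (grid_pos u) - snd (grid_pos w)\<bar> \<le> 1 \<and>
       (\<forall>f\<in>F. \<bar>(LINT x|m. f (word_map u x)) - (LINT x|m. f (word_map v x))\<bar>
       \<le> C * (energy_norm (f \<circ> word_map u) + 2 * energy_norm (f \<circ> word_map w) + energy_norm (f \<circ> word_map v)))"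
      using w(1) uw(1,2) by blast
  qed
qed

section \<open>The Poincare inequality on balls\<close>

lemma integral_cell_powr_le:
  assumes C: "\<And>f. f \<in> F \<Longrightarrow> (LINT x|m. \<bar>f x - (LINT y|m. f y)\<bar> powr p) \<le> C * \<E> f"
    and f: "f \<in> F" and w: "w \<in> words n"
  shows "(LINT y:cell w|m. \<bar>f y - c\<bar> powr p)
     \<le> 2 powr p / 8 ^ n * (C * \<E> (f \<circ> word_map w) + \<bar>(LINT y|m. f (word_map w y)) - c\<bar> powr p)"
proof -
  define a where "a = (LINT y|m. f (word_map w y))"
  have fw: "f \<circ> word_map w \<in> F" by (rule sobolev_word_map[OF f w])
  have int: "integrable m (\<lambda>y. \<bar>f (word_map w y) - k\<bar> powr p)" for k
    using sobolev_integrable_powr[OF sobolev_diff[OF fw sobolev_const]] by simp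
  have "8 ^ n * (LINT y:cell w|m. \<bar>f y - c\<bar> powr p) = (LINT y|m. \<bar>f (word_map w y) - c\<bar> powr p)"
    using sobolev_measurable[OF f] by (intro integral_word_map[OF w, symmetric]) auto
  also have "\<dots> \<le> (LINT y|m. 2 powr p * (\<bar>f (word_map w y) - a\<bar> powr p + \<bar>a - c\<bar> powr p))"
  proof (rule integral_mono)
    show "\<bar>f (word_map w y) - c\<bar> powr p \<le> 2 powr p * (\<bar>f (word_map w y) - a\<bar> powr p + \<bar>a - c\<bar> powr p)" for y
      using abs_add_powr_le[of p "f (word_map w y) - a" "a - c"] p_gt_1 by simp
  qed (use int in auto)
  also have "\<dots> = 2 powr p * ((LINT y|m. \<bar>f (word_map w y) - a\<bar> powr p) + \<bar>a - c\<bar> powr p)"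
    using int prob_space by simp
  also have "\<dots> \<le> 2 powr p * (C * \<E> (f \<circ> word_map w) + \<bar>a - c\<bar> powr p)"
    using C[OF fw] by (intro mult_left_mono add_right_mono) (auto simp: a_def)
  finally show ?thesis by (simp add: a_def field_simps)
qed

text \<open>The level \<open>n\<close> is chosen so that \<open>1 / 3 ^ n\<close> is comparable to the radius, and \<open>n = 0\<close> for large
radii. All cells that meet the ball are neighbours of a cell \<open>u\<close> containing its centre, so \<open>f\<close> may
be compared on each of them with its mean over \<open>u\<close>. The neighbours of \<open>u\<close> lie within distance
\<open>8 / 3 ^ n\<close>, less than \<open>24 * r\<close>, of the centre; this is where the enlargement factor comes from.\<close>

lemma poincare_ball:
  "\<exists>C\<ge>0. \<forall>x\<in>carpet. \<forall>r>0. \<forall>f\<in>F. \<forall>\<mu>. is_symbolic_energy_measure \<rho> \<E> f \<mu> \<longrightarrow>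
     (LINT y:carpet_ball x r|m.
        \<bar>f y - (LINT z:carpet_ball x r|m. f z) / measure m (carpet_ball x r)\<bar> powr p)
     \<le> C * r powr walk_dim \<rho> * measure (energy_measure \<mu>) (carpet_ball x (24 * r))"
proof -
  obtain C1 where C1: "C1 \<ge> 1"
    "\<And>f. f \<in> F \<Longrightarrow> (LINT x|m. \<bar>f x - (LINT y|m. f y)\<bar> powr p) \<le> C1 * \<E> f"
    using energy_constants by blast
  obtain C2 where C2: "C2 \<ge> 0" "\<And>n u v. u \<in> words n \<Longrightarrow> v \<in> words n \<Longrightarrow>
     \<bar>fst (grid_pos u) - fst (grid_pos v)\<bar> \<le> 1 \<and> \<bar>snd (grid_pos u) - snd (grid_pos v)\<bar> \<le> 1 \<Longrightarrow>
     (\<exists>w\<in>words n. \<bar>fst (grid_pos u) - fst (grid_pos w)\<bar> \<le> 1 \<and> \<bar>snd (grid_pos u) - snd (grid_pos w)\<bar> \<le> 1 \<and>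
       (\<forall>f\<in>F. \<bar>(LINT x|m. f (word_map u x)) - (LINT x|m. f (word_map v x))\<bar>
       \<le> C2 * (energy_norm (f \<circ> word_map u) + 2 * energy_norm (f \<circ> word_map w) + energy_norm (f \<circ> word_map v))))"
    using mean_difference_neighbour by blast
  define D where "D = 2 * 2 powr p * (9 * (2 powr p * (C1 + (4 * C2) powr p)))"
  have D: "D \<ge> 0" using C1(1) by (simp add: D_def)
  have wd: "0 \<le> walk_dim \<rho>" by (rule walk_dim_nonneg[OF scaling_constant])
  have "(LINT y:carpet_ball x r|m.
        \<bar>f y - (LINT z:carpet_ball x r|m. f z) / measure m (carpet_ball x r)\<bar> powr p)
     \<le> D * 3 powr walk_dim \<rho> * r powr walk_dim \<rho> * measure (energy_measure \<mu>) (carpet_ball x (24 * r))"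
    if x: "x \<in> carpet" and r: "r > 0" and f: "f \<in> F" and \<mu>: "is_symbolic_energy_measure \<rho> \<E> f \<mu>"
    for x r f \<mu>
  proof -
    obtain n where n: "1 / 3 ^ n < 3 * r" "r \<le> 1 / 3 ^ n \<or> n = 0"
    proof -
      define n where "n = (LEAST n. 1 / 3 ^ n < 3 * r)"
      have "\<exists>n. 1 / 3 ^ n < 3 * r" using exists_small_power[of "3 * r" 1] r by simp
      then have 1: "1 / 3 ^ n < 3 * r" unfolding n_def by (rule LeastI_ex)
      have "r \<le> 1 / 3 ^ n \<or> n = 0"
      proof (cases n)
        case (Suc k)
        then have "k < (LEAST n. 1 / 3 ^ n < 3 * r)" unfolding n_def by simp
        from not_less_Least[OF this] show ?thesis by (simp add: Suc field_simps)
      qed simp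
      with 1 show ?thesis by (rule that)
    qed
    obtain u where u: "u \<in> words n" "x \<in> cell u" using cell_of_point[OF x] .
    define W where "W = {v \<in> words n. \<bar>fst (grid_pos u) - fst (grid_pos v)\<bar> \<le> 1 \<and>
                \<bar>snd (grid_pos u) - snd (grid_pos v)\<bar> \<le> 1}"
    have W: "finite W" "card W \<le> 9" "\<And>w. w \<in> W \<Longrightarrow> w \<in> words n"
      using card_neighbours[OF u(1)] by (auto simp: W_def)
    have uW: "u \<in> W" using u by (simp add: W_def)
    have cover: "carpet_ball x r \<subseteq> (\<Union>w\<in>W. cell w)"
    proof
      fix y assume y: "y \<in> carpet_ball x r"
      then obtain v where v: "v \<in> words n" "y \<in> cell v"
        using cell_of_point[of y n] by (auto simp: carpet_ball_def)
      have "v \<in> W"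
        using n(2)
      proof
        assume "r \<le> 1 / 3 ^ n"
        then have "dist x y \<le> 1 / 3 ^ n" using y by (simp add: carpet_ball_def)
        then show ?thesis using cells_near[OF u(1) v(1) u(2) v(2)] v by (simp add: W_def)
      next
        assume "n = 0"
        then show ?thesis using u v uW by simp
      qed
      then show "y \<in> (\<Union>w\<in>W. cell w)" using v by blast
    qed
    define X where "X = measure (energy_measure \<mu>) (carpet_ball x (24 * r))"
    have near: "\<E> (f \<circ> word_map w) \<le> X / \<rho> ^ n" if w: "w \<in> W" for w
    proof -
      have "cell w \<subseteq> carpet_ball x (24 * r)"
      proof
        fix y assume y: "y \<in> cell w"
        have "dist x y \<le> (4 + 4 * of_int 1) / 3 ^ n"
          using w by (intro cell_dist[OF u(1) _ u(2) y]) (auto simp: W_def)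
        then have "dist x y \<le> 8 * (1 / 3 ^ n)" by simp
        then have "dist x y < 24 * r" using n(1) by linarith
        then show "y \<in> carpet_ball x (24 * r)"
          using y cell_subset[OF W(3)[OF w]] by (auto simp: carpet_ball_def)
      qed
      then have "\<rho> ^ n * \<E> (f \<circ> word_map w) \<le> X"
        unfolding X_def by (rule energy_measure_ge[OF \<mu> W(3)[OF w]])
      then show ?thesis using rho_pos by (simp add: field_simps)
    qed
    have X: "X \<ge> 0" by (simp add: X_def)
    define Y where "Y = (X / \<rho> ^ n) powr (1 / p)"
    have Yp: "Y powr p = X / \<rho> ^ n" using X rho_pos p_gt_1 by (simp add: Y_def powr_powr)
    have nY: "energy_norm (f \<circ> word_map w) \<le> Y" if "w \<in> W" for w
      unfolding energy_norm_def Y_def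
      using near[OF that] p_gt_1 energy_nonneg[OF sobolev_word_map[OF f W(3)[OF that]]]
      by (intro powr_mono2) auto
    define c where "c = (LINT y|m. f (word_map u y))"
    have cell: "(LINT y:cell w|m. \<bar>f y - c\<bar> powr p)
        \<le> 2 powr p * (C1 + (4 * C2) powr p) * X / (8 * \<rho>) ^ n" if w: "w \<in> W" for w
    proof -
      obtain w' where w': "w' \<in> W" "\<bar>c - (LINT x|m. f (word_map w x))\<bar>
         \<le> C2 * (energy_norm (f \<circ> word_map u) + 2 * energy_norm (f \<circ> word_map w') + energy_norm (f \<circ> word_map w))"
        using C2(2)[OF u(1) W(3)[OF w]] w f unfolding W_def c_def by blast
      \<comment> \<open>The cells \<open>u\<close>, \<open>w'\<close> and \<open>w\<close> all lie in the large ball, so \<open>Y\<close> bounds each of the four terms.\<close>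
      have "\<dots> \<le> C2 * (Y + 2 * Y + Y)"
        using nY[OF uW] nY[OF w'(1)] nY[OF w] C2(1) by (intro mult_left_mono) auto
      with w'(2) have "\<bar>(LINT x|m. f (word_map w x)) - c\<bar> \<le> 4 * C2 * Y" by (simp add: abs_minus_commute)
      then have "\<bar>(LINT x|m. f (word_map w x)) - c\<bar> powr p \<le> (4 * C2 * Y) powr p"
        using p_gt_1 by (intro powr_mono2) auto
      also have "\<dots> = (4 * C2) powr p * (X / \<rho> ^ n)" by (simp add: powr_mult Yp)
      finally have "C1 * \<E> (f \<circ> word_map w) + \<bar>(LINT x|m. f (word_map w x)) - c\<bar> powr p
          \<le> C1 * (X / \<rho> ^ n) + (4 * C2) powr p * (X / \<rho> ^ n)"
        using near[OF w] C1(1) by (intro add_mono mult_left_mono) auto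
      then have "2 powr p / 8 ^ n * (C1 * \<E> (f \<circ> word_map w) + \<bar>(LINT x|m. f (word_map w x)) - c\<bar> powr p)
          \<le> 2 powr p / 8 ^ n * (C1 * (X / \<rho> ^ n) + (4 * C2) powr p * (X / \<rho> ^ n))"
        by (intro mult_left_mono) auto
      also have "\<dots> = 2 powr p * (C1 + (4 * C2) powr p) * X / (8 * \<rho>) ^ n"
        using rho_pos by (simp add: power_mult_distrib field_simps)
      finally show ?thesis
        using integral_cell_powr_le[OF C1(2) f W(3)[OF w], of c] by linarith
    qed
    have int: "integrable m (\<lambda>y. \<bar>f y - c\<bar> powr p)"
      by (rule sobolev_integrable_powr[OF sobolev_diff[OF f sobolev_const]])
    have "(LINT y:carpet_ball x r|m. \<bar>f y - c\<bar> powr p) \<le> (\<Sum>w\<in>W. LINT y:cell w|m. \<bar>f y - c\<bar> powr p)"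
    proof -
      have 1: "integrable m (\<lambda>y. indicator (cell w) y *\<^sub>R \<bar>f y - c\<bar> powr p)" if "w \<in> W" for w
        using W(3)[OF that] int by (intro integrable_mult_indicator) auto
      have "(LINT y|m. indicator (carpet_ball x r) y *\<^sub>R \<bar>f y - c\<bar> powr p)
          \<le> (LINT y|m. (\<Sum>w\<in>W. indicator (cell w) y *\<^sub>R \<bar>f y - c\<bar> powr p))"
      proof (rule integral_mono)
        show "integrable m (\<lambda>y. indicator (carpet_ball x r) y *\<^sub>R \<bar>f y - c\<bar> powr p)"
          using int by (intro integrable_mult_indicator) auto
        show "integrable m (\<lambda>y. \<Sum>w\<in>W. indicator (cell w) y *\<^sub>R \<bar>f y - c\<bar> powr p)"
          using 1 by (intro Bochner_Integration.integrable_sum)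
        fix y assume "y \<in> space m"
        show "indicator (carpet_ball x r) y *\<^sub>R \<bar>f y - c\<bar> powr p
            \<le> (\<Sum>w\<in>W. indicator (cell w) y *\<^sub>R \<bar>f y - c\<bar> powr p)"
        proof (cases "y \<in> carpet_ball x r")
          case True
          then obtain w where w: "w \<in> W" "y \<in> cell w" using cover by blast
          have "indicator (cell w) y *\<^sub>R \<bar>f y - c\<bar> powr p
             \<le> (\<Sum>w\<in>W. indicator (cell w) y *\<^sub>R \<bar>f y - c\<bar> powr p)"
            using w W(1) by (intro member_le_sum) auto
          then show ?thesis using True w by simp
        qed (auto intro!: sum_nonneg)
      qed
      also have "\<dots> = (\<Sum>w\<in>W. LINT y|m. indicator (cell w) y *\<^sub>R \<bar>f y - c\<bar> powr p)"
        using 1 by (intro Bochner_Integration.integral_sum)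
      finally show ?thesis by (simp add: set_lebesgue_integral_def)
    qed
    also have "\<dots> \<le> real (card W) * (2 powr p * (C1 + (4 * C2) powr p) * X / (8 * \<rho>) ^ n)"
      using cell by (rule sum_bounded_above)
    also have "\<dots> \<le> 9 * (2 powr p * (C1 + (4 * C2) powr p) * X / (8 * \<rho>) ^ n)"
      using W(2) X C1(1) rho_pos by (intro mult_right_mono) auto
    finally have "2 * 2 powr p * (LINT y:carpet_ball x r|m. \<bar>f y - c\<bar> powr p)
        \<le> 2 * 2 powr p * (9 * (2 powr p * (C1 + (4 * C2) powr p) * X / (8 * \<rho>) ^ n))"
      by (intro mult_left_mono) auto
    also have "\<dots> = D * (1 / 3 ^ n) powr walk_dim \<rho> * X"
      unfolding powr_walk_dim[OF rho_pos] by (simp add: D_def)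
    also have "\<dots> \<le> D * (3 * r) powr walk_dim \<rho> * X"
      using n(1) X D wd by (intro mult_right_mono mult_left_mono powr_mono2) auto
    also have "\<dots> = D * 3 powr walk_dim \<rho> * r powr walk_dim \<rho> * X"
      using r by (simp add: powr_mult mult.assoc)
    finally show ?thesis
      using oscillation_le[OF carpet_ball_sets[of x r] sobolev_measurable[OF f] p_gt_1
          sobolev_integrable_powr[OF f], of c]
      by (simp add: X_def)
  qed
  then show ?thesis using D by (intro exI[of _ "D * 3 powr walk_dim \<rho>"]) auto
qed

section \<open>Cutoff functions\<close>

text \<open>Scaling the model function to run from 0 to 2 leaves room for a uniform error below \<open>1 / 2\<close>, which
the 1-Lipschitz clamp \<open>\<phi>\<close> then removes, so that the values 0 and 1 are taken exactly.\<close>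

lemma corner_cutoff:
  "\<exists>c\<in>FC. (\<forall>x\<in>carpet. 0 \<le> c x) \<and> (\<forall>x\<in>carpet. fst x \<le> 0 \<and> snd x \<le> 0 \<longrightarrow> c x = 1) \<and>
     (\<forall>x\<in>carpet. fst x = 1 \<or> snd x = 1 \<longrightarrow> c x = 0)"
proof -
  define h :: "real \<times> real \<Rightarrow> real" where "h x = 2 * (1 - max 0 (max (fst x) (snd x)))" for x
  have "continuous_on carpet h" unfolding h_def by (intro continuous_intros)
  then obtain g where g: "g \<in> FC" "\<And>x. x \<in> carpet \<Longrightarrow> \<bar>h x - g x\<bar> < 1 / 2"
    using uniform_approximation[of h "1 / 2"] by auto
  define \<phi> :: "real \<Rightarrow> real" where "\<phi> t = max 0 (min 1 (t - 1 / 2))" for t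
  have "1-lipschitz_on UNIV \<phi>"
    by (rule lipschitz_onI) (auto simp: dist_real_def \<phi>_def max_def min_def)
  moreover have "continuous_on carpet (\<lambda>x. \<phi> (g x))"
    using g(1) unfolding \<phi>_def by (intro continuous_intros) (simp add: FC_iff)
  ultimately have c: "\<phi> \<circ> g \<in> FC"
    using lipschitz_energy[of \<phi> g] g(1) by (simp add: FC_iff o_def)
  have "\<phi> (g x) = 1" if "x \<in> carpet" "fst x \<le> 0" "snd x \<le> 0" for x
  proof -
    have "h x = 2" using that by (simp add: h_def)
    then have "g x > 3 / 2" using g(2)[OF that(1)] by linarith
    then show ?thesis by (simp add: \<phi>_def)
  qed
  moreover have "\<phi> (g x) = 0" if "x \<in> carpet" "fst x = 1 \<or> snd x = 1" for x
  proof -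
    have "h x = 0" using that carpet_bounds[OF that(1)] by (auto simp: h_def max_def)
    then have "g x < 1 / 2" using g(2)[OF that(1)] by linarith
    then show ?thesis by (simp add: \<phi>_def)
  qed
  ultimately show ?thesis using c by (intro bexI[OF _ c]) (auto simp: \<phi>_def)
qed

text \<open>The bump around the grid vertex \<open>(2 * a + 1, 2 * b + 1) / 3 ^ N\<close> depends only on the rescaled
distances to it in the two coordinates. On each of the at most four cells at the vertex it is a
reflected copy of the corner cutoff, and on all other cells it vanishes; the vanishing of the corner
cutoff on the far edges makes these pieces fit together.\<close>

lemma vertex_cutoff:
  "\<exists>C\<ge>0. \<forall>N a b. \<exists>T\<in>FC. \<E> T \<le> C * \<rho> ^ N \<and> (\<forall>y\<in>carpet. 0 \<le> T y) \<and>
     (\<forall>y\<in>carpet. \<bar>3 ^ N * fst y - (2 * of_int a + 1)\<bar> \<le> 1 \<and> \<bar>3 ^ N * snd y - (2 * of_int b + 1)\<bar> \<le> 1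
        \<longrightarrow> T y = 1) \<and>
     (\<forall>y\<in>carpet. T y \<noteq> 0 \<longrightarrow>
        \<bar>3 ^ N * fst y - (2 * of_int a + 1)\<bar> \<le> 2 \<and> \<bar>3 ^ N * snd y - (2 * of_int b + 1)\<bar> \<le> 2)"
proof -
  obtain c where c: "c \<in> FC" "\<And>x. x \<in> carpet \<Longrightarrow> 0 \<le> c x"
    "\<And>x. x \<in> carpet \<Longrightarrow> fst x \<le> 0 \<Longrightarrow> snd x \<le> 0 \<Longrightarrow> c x = 1"
    "\<And>x. x \<in> carpet \<Longrightarrow> fst x = 1 \<or> snd x = 1 \<Longrightarrow> c x = 0"
    using corner_cutoff by blast
  have Ec: "\<E> c \<ge> 0" using c(1) by (simp add: energy_nonneg FC_iff)
  have "\<exists>T\<in>FC. \<E> T \<le> 4 * \<E> c * \<rho> ^ N \<and> (\<forall>y\<in>carpet. 0 \<le> T y) \<and>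
     (\<forall>y\<in>carpet. \<bar>3 ^ N * fst y - (2 * of_int a + 1)\<bar> \<le> 1 \<and> \<bar>3 ^ N * snd y - (2 * of_int b + 1)\<bar> \<le> 1
        \<longrightarrow> T y = 1) \<and>
     (\<forall>y\<in>carpet. T y \<noteq> 0 \<longrightarrow>
        \<bar>3 ^ N * fst y - (2 * of_int a + 1)\<bar> \<le> 2 \<and> \<bar>3 ^ N * snd y - (2 * of_int b + 1)\<bar> \<le> 2)"
    for N a b
  proof -
    define s where "s y = \<bar>3 ^ N * fst y - (2 * of_int a + 1)\<bar> - 1" for y :: "real \<times> real"
    define t where "t y = \<bar>3 ^ N * snd y - (2 * of_int b + 1)\<bar> - 1" for y :: "real \<times> real"
    \<comment> \<open>On a cell at the vertex, \<open>s\<close> and \<open>t\<close> are the coordinates of the reflected rescaled point, with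
      the vertex at \<open>(-1, -1)\<close>; on any other cell, one of them is at least 1.\<close>
    define T where "T y = (if s y \<ge> 1 \<or> t y \<ge> 1 then 0 else c (s y, t y))" for y
    define V where "V = {v \<in> words N. fst (grid_pos v) \<in> {a, a + 1} \<and> snd (grid_pos v) \<in> {b, b + 1}}"
    have far: "\<bar>q + 2 * of_int P - (2 * of_int k + 1)\<bar> - 1 \<ge> 1"
      if "\<bar>q\<bar> \<le> 1" "P \<notin> {k, k + 1}" for q :: real and P k :: int
    proof -
      have "P \<le> k - 1 \<or> P \<ge> k + 2" using that(2) by auto
      then have "real_of_int P \<le> of_int k - 1 \<or> real_of_int P \<ge> of_int k + 2" by linarith
      then have "q + 2 * of_int P - (2 * of_int k + 1) \<le> - 2 \<or>
          q + 2 * of_int P - (2 * of_int k + 1) \<ge> 2"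
        using that(1) by (auto simp: abs_le_iff)
      then show ?thesis by auto
    qed
    have inside: "\<exists>\<sigma> \<tau>. \<bar>\<sigma>\<bar> = 1 \<and> \<bar>\<tau>\<bar> = 1 \<and> (\<forall>x\<in>carpet. reflect \<sigma> \<tau> x \<in> carpet \<and>
        reflect \<sigma> \<tau> x = (s (word_map v x), t (word_map v x)) \<and> T (word_map v x) = c (reflect \<sigma> \<tau> x))"
      if v: "v \<in> V" for v
    proof -
      have vw: "v \<in> words N" using v by (simp add: V_def)
      define \<sigma> where "\<sigma> = (if fst (grid_pos v) = a then -1 else 1 :: real)"
      define \<tau> where "\<tau> = (if snd (grid_pos v) = b then -1 else 1 :: real)"
      have st: "\<bar>\<sigma>\<bar> = 1" "\<bar>\<tau>\<bar> = 1" by (simp_all add: \<sigma>_def \<tau>_def)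
      have "reflect \<sigma> \<tau> x \<in> carpet \<and>
        reflect \<sigma> \<tau> x = (s (word_map v x), t (word_map v x)) \<and> T (word_map v x) = c (reflect \<sigma> \<tau> x)"
        if x: "x \<in> carpet" for x
      proof -
        have 1: "reflect \<sigma> \<tau> x \<in> carpet" using reflect_carpet[OF st] x by blast
        have pos: "fst (grid_pos v) \<in> {a, a + 1}" "snd (grid_pos v) \<in> {b, b + 1}"
          using v unfolding V_def by blast+
        have signed: "\<bar>q + 2 * of_int P - (2 * of_int k + 1)\<bar> - 1 = (if P = k then -1 else 1) * q"
          if "\<bar>q\<bar> \<le> 1" "P \<in> {k, k + 1}" for q :: real and P k :: int
        proof (cases "P = k")
          case True
          then show ?thesis using that(1) by auto
        next
          case False
          then have "P = k + 1" using that(2) by blast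
          then show ?thesis using that(1) by auto
        qed
        have 2: "reflect \<sigma> \<tau> x = (s (word_map v x), t (word_map v x))"
          using signed[OF carpet_bounds(1)[OF x] pos(1)] signed[OF carpet_bounds(2)[OF x] pos(2)]
          by (simp add: reflect_def s_def t_def word_map_eq[OF vw] \<sigma>_def \<tau>_def)
        have "T (word_map v x) = c (reflect \<sigma> \<tau> x)"
        proof (cases "s (word_map v x) \<ge> 1 \<or> t (word_map v x) \<ge> 1")
          case True
          have "s (word_map v x) \<le> 1" "t (word_map v x) \<le> 1"
            using carpet_bounds[OF 1] unfolding 2 by auto
          with True have "c (reflect \<sigma> \<tau> x) = 0"
            using c(4)[OF 1] unfolding 2 by auto
          then show ?thesis using True by (simp add: T_def)
        qed (auto simp: T_def 2)
        with 1 2 show ?thesis by blast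
      qed
      with st show ?thesis by blast
    qed
    have outside: "T (word_map v x) = 0 \<and> (s (word_map v x) \<ge> 1 \<or> t (word_map v x) \<ge> 1)"
      if v: "v \<in> words N" "v \<notin> V" and x: "x \<in> carpet" for v x
    proof -
      have "fst (grid_pos v) \<notin> {a, a + 1} \<or> snd (grid_pos v) \<notin> {b, b + 1}"
        using v unfolding V_def by blast
      then have "s (word_map v x) \<ge> 1 \<or> t (word_map v x) \<ge> 1"
      proof
        assume "fst (grid_pos v) \<notin> {a, a + 1}"
        from far[OF carpet_bounds(1)[OF x] this] show ?thesis
          by (simp add: s_def word_map_eq[OF v(1)])
      next
        assume "snd (grid_pos v) \<notin> {b, b + 1}"
        from far[OF carpet_bounds(2)[OF x] this] show ?thesis
          by (simp add: t_def word_map_eq[OF v(1)])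
      qed
      then show ?thesis by (auto simp: T_def)
    qed
    have in_piece: "T \<circ> word_map v \<in> FC \<and> \<E> (T \<circ> word_map v) = \<E> c" if v: "v \<in> V" for v
    proof -
      obtain \<sigma> \<tau> where st: "\<bar>\<sigma>\<bar> = 1" "\<bar>\<tau>\<bar> = 1"
        "\<And>x. x \<in> carpet \<Longrightarrow> T (word_map v x) = c (reflect \<sigma> \<tau> x)"
        using inside[OF v] by blast
      have eq: "(T \<circ> word_map v) x = (c \<circ> reflect \<sigma> \<tau>) x" if "x \<in> carpet" for x
        using st(3)[OF that] by simp
      have "T \<circ> word_map v \<in> FC"
        using FC_cong[of "T \<circ> word_map v", OF eq] FC_reflect(1)[OF c(1) st(1,2)] by blast
      then show ?thesis
        using energy_cong[of "T \<circ> word_map v", OF eq] FC_iff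
        unfolding FC_reflect(2)[OF c(1) st(1,2)] by blast
    qed
    have out_piece: "T \<circ> word_map v \<in> FC \<and> \<E> (T \<circ> word_map v) = 0"
      if v: "v \<in> words N" "v \<notin> V" for v
    proof -
      have eq: "(T \<circ> word_map v) x = (\<lambda>_. 0) x" if "x \<in> carpet" for x
        using outside[OF v that] by simp
      have "T \<circ> word_map v \<in> FC"
        using FC_cong[of "T \<circ> word_map v", OF eq] sobolev_const[of 0] by (simp add: FC_iff)
      then show ?thesis
        using energy_cong[of "T \<circ> word_map v", OF eq] FC_iff unfolding energy_const by blast
    qed
    have T: "T \<in> FC"
    proof (rule FC_glue[of N])
      fix v assume v: "v \<in> words N"
      show "T \<circ> word_map v \<in> FC"
      proof (cases "v \<in> V")
        case True
        from in_piece[OF this] show ?thesis by (rule conjunct1)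
      next
        case False
        from out_piece[OF v this] show ?thesis by (rule conjunct1)
      qed
    qed
    have V: "V \<subseteq> words N" "card V \<le> 4"
    proof -
      have "card V \<le> card ({a, a + 1} \<times> {b, b + 1})"
      proof (rule card_inj_on_le)
        show "inj_on grid_pos V" by (rule inj_on_subset[OF grid_pos_inj]) (auto simp: V_def)
        show "grid_pos ` V \<subseteq> {a, a + 1} \<times> {b, b + 1}" 
        proof (rule image_subsetI)
          fix v assume "v \<in> V"
          then show "grid_pos v \<in> {a, a + 1} \<times> {b, b + 1}"
            unfolding V_def mem_Times_iff by blast
        qed
      qed simp
      then show "card V \<le> 4" by (simp add: card_cartesian_product)
    qed (auto simp: V_def)
    have "\<E> T = \<rho> ^ N * (\<Sum>v\<in>words N. \<E> (T \<circ> word_map v))"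
      using T by (intro energy_words) (simp add: FC_iff)
    also have "(\<Sum>v\<in>words N. \<E> (T \<circ> word_map v)) = (\<Sum>v\<in>V. \<E> (T \<circ> word_map v))"
      using V out_piece by (intro sum.mono_neutral_right) auto
    also have "\<dots> = real (card V) * \<E> c" using in_piece by simp
    also have "\<rho> ^ N * \<dots> \<le> \<rho> ^ N * (4 * \<E> c)"
      using V(2) Ec rho_pos by (intro mult_left_mono mult_right_mono) auto
    finally have E: "\<E> T \<le> 4 * \<E> c * \<rho> ^ N" by (simp add: mult_ac)
    have "0 \<le> T y \<and> (s y \<le> 0 \<and> t y \<le> 0 \<longrightarrow> T y = 1)" if y: "y \<in> carpet" for y
    proof -
      obtain v where "v \<in> words N" "y \<in> cell v" using cell_of_point[OF y] .
      then obtain x where v: "v \<in> words N" "x \<in> carpet" "y = word_map v x"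
        unfolding cell_def by blast
      show ?thesis
      proof (cases "v \<in> V")
        case True
        obtain \<sigma> \<tau> where st: "reflect \<sigma> \<tau> x \<in> carpet" "reflect \<sigma> \<tau> x = (s y, t y)" "T y = c (reflect \<sigma> \<tau> x)"
          using inside[OF True] v(2,3) by blast
        show ?thesis using c(2)[OF st(1)] c(3)[OF st(1)] unfolding st(3) unfolding st(2) by simp
      next
        case False
        then show ?thesis using outside[OF v(1) False v(2)] v(3) by auto
      qed
    qed
    then show ?thesis
      using E by (intro bexI[OF _ T]) (auto simp: s_def t_def T_def split: if_splits)
  qed
  then show ?thesis using Ec by (intro exI[of _ "4 * \<E> c"]) auto
qed

lemma energy_norm_sum:
  assumes "finite Z" "\<And>z. z \<in> Z \<Longrightarrow> T z \<in> FC"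
  shows "(\<lambda>x. \<Sum>z\<in>Z. T z x) \<in> FC \<and> energy_norm (\<lambda>x. \<Sum>z\<in>Z. T z x) \<le> (\<Sum>z\<in>Z. energy_norm (T z))"
  using assms
proof (induction Z rule: finite_induct)
  case empty
  then show ?case using sobolev_const[of 0] energy_const[of 0] by (simp add: FC_iff energy_norm_def)
next
  case (insert z Z)
  have z: "T z \<in> F" "continuous_on carpet (T z)" using insert.prems by (auto simp: FC_iff)
  have S: "(\<lambda>x. \<Sum>z\<in>Z. T z x) \<in> F" "continuous_on carpet (\<lambda>x. \<Sum>z\<in>Z. T z x)"
    "energy_norm (\<lambda>x. \<Sum>z\<in>Z. T z x) \<le> (\<Sum>z\<in>Z. energy_norm (T z))"
    using insert by (auto simp: FC_iff)
  show ?case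
    using sobolev_add[OF z(1) S(1)] energy_norm_triangle[OF z(1) S(1)] S(2,3) z(2) insert.hyps
    by (auto simp: FC_iff intro: continuous_on_add)
qed

text \<open>The level is chosen with \<open>7 \<le> 3 ^ N * r < 21\<close>. The lower bound is needed because a bump whose inner
square meets the ball reaches at most \<open>6 / 3 ^ N\<close> beyond it, in the sum of the two coordinates, and
\<open>r + 6 / 7 * r\<close> is still below \<open>2 * r\<close>; the upper bound limits the number of such bumps to \<open>24\<close> times
\<open>24\<close>. For \<open>r > 7\<close> the ball is the whole carpet, and the constant 1 is admissible.\<close>

lemma capacity_ball:
  "\<exists>C\<ge>0. \<forall>x\<in>carpet. \<forall>r>0. \<exists>g\<in>FC. (\<forall>y\<in>carpet_ball x r. g y = 1) \<and>
     cont_support g \<subseteq> carpet_ball x (2 * r) \<and>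
     \<E> g \<le> C * (measure m (carpet_ball x r) / r powr walk_dim \<rho>)"
proof -
  obtain C where C: "C \<ge> 0" "\<And>N a b. \<exists>T\<in>FC. \<E> T \<le> C * \<rho> ^ N \<and> (\<forall>y\<in>carpet. 0 \<le> T y) \<and>
     (\<forall>y\<in>carpet. \<bar>3 ^ N * fst y - (2 * of_int a + 1)\<bar> \<le> 1 \<and> \<bar>3 ^ N * snd y - (2 * of_int b + 1)\<bar> \<le> 1
        \<longrightarrow> T y = 1) \<and>
     (\<forall>y\<in>carpet. T y \<noteq> 0 \<longrightarrow>
        \<bar>3 ^ N * fst y - (2 * of_int a + 1)\<bar> \<le> 2 \<and> \<bar>3 ^ N * snd y - (2 * of_int b + 1)\<bar> \<le> 2)"
    using vertex_cutoff by blast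
  have wd: "0 \<le> walk_dim \<rho>" by (rule walk_dim_nonneg[OF scaling_constant])
  define D where "D = 576 powr p * C * 21 powr walk_dim \<rho>"
  have D: "D \<ge> 0" using C(1) by (simp add: D_def)
  have "\<exists>g\<in>FC. (\<forall>y\<in>carpet_ball x r. g y = 1) \<and> cont_support g \<subseteq> carpet_ball x (2 * r) \<and>
     \<E> g \<le> D * (measure m (carpet_ball x r) / r powr walk_dim \<rho>)"
    if x: "x \<in> carpet" and r: "r > 0" for x r
  proof (cases "r > 7")
    case True
    have "closure {y \<in> carpet. (1::real) \<noteq> 0} = carpet" using carpet_closed by simp
    moreover have "dist x y < 2 * r" if "y \<in> carpet" for y
      using carpet_bounds[OF x] carpet_bounds[OF that] dist_le_coords[of x y] True by linarith
    ultimately have "cont_support (\<lambda>_. 1) \<subseteq> carpet_ball x (2 * r)"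
      by (auto simp: cont_support_def carpet_ball_def)
    moreover have "(\<lambda>_. 1) \<in> FC" using sobolev_const by (simp add: FC_iff)
    moreover have "\<E> (\<lambda>_. 1) \<le> D * (measure m (carpet_ball x r) / r powr walk_dim \<rho>)"
      using D energy_const by simp
    ultimately show ?thesis by (intro bexI[of _ "\<lambda>_. 1"]) auto
  next
    case False
    obtain N where N: "7 / 3 ^ N \<le> r" "r < 21 / 3 ^ N"
    proof -
      define N where "N = (LEAST n. 7 / 3 ^ n \<le> r)"
      have "\<exists>n. 7 / 3 ^ n \<le> r" using exists_small_power[OF r, of 7] less_imp_le by blast
      then have 1: "7 / 3 ^ N \<le> r" unfolding N_def by (rule LeastI_ex)
      have "r < 21 / 3 ^ N"
      proof (cases N)
        case (Suc k)
        then have "k < (LEAST n. 7 / 3 ^ n \<le> r)" unfolding N_def by simp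
        from not_less_Least[OF this] show ?thesis by (simp add: Suc field_simps)
      qed (use False in simp)
      with 1 show ?thesis by (rule that)
    qed
    define Q :: "real" where "Q = 3 ^ N"
    have Q: "Q > 0" "7 \<le> Q * r" "Q * r < 21" using N by (auto simp: Q_def field_simps)
    define P where "P z T \<longleftrightarrow> T \<in> FC \<and> \<E> T \<le> C * \<rho> ^ N \<and> (\<forall>y\<in>carpet. 0 \<le> T y) \<and>
     (\<forall>y\<in>carpet. \<bar>Q * fst y - (2 * of_int (fst z) + 1)\<bar> \<le> 1 \<and> \<bar>Q * snd y - (2 * of_int (snd z) + 1)\<bar> \<le> 1
        \<longrightarrow> T y = 1) \<and>
     (\<forall>y\<in>carpet. T y \<noteq> 0 \<longrightarrow>
        \<bar>Q * fst y - (2 * of_int (fst z) + 1)\<bar> \<le> 2 \<and> \<bar>Q * snd y - (2 * of_int (snd z) + 1)\<bar> \<le> 2)"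
      for z :: "int \<times> int" and T
    have "\<exists>T. P z T" for z
      unfolding Q_def P_def using C(2)[of N "fst z" "snd z"] by blast
    then obtain T0 where "\<And>z. P z (T0 z)" by metis
    then obtain T where T: "\<And>z. T z \<in> FC" "\<And>z. \<E> (T z) \<le> C * \<rho> ^ N" "\<And>z y. y \<in> carpet \<Longrightarrow> 0 \<le> T z y"
      "\<And>z y. y \<in> carpet \<Longrightarrow> \<bar>Q * fst y - (2 * of_int (fst z) + 1)\<bar> \<le> 1 \<Longrightarrow>
         \<bar>Q * snd y - (2 * of_int (snd z) + 1)\<bar> \<le> 1 \<Longrightarrow> T z y = 1"
      "\<And>z y. y \<in> carpet \<Longrightarrow> T z y \<noteq> 0 \<Longrightarrow>
        \<bar>Q * fst y - (2 * of_int (fst z) + 1)\<bar> \<le> 2 \<and> \<bar>Q * snd y - (2 * of_int (snd z) + 1)\<bar> \<le> 2"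
      unfolding P_def by blast
    have scaled: "\<bar>Q * fst y - Q * fst y'\<bar> \<le> Q * dist y y'" "\<bar>Q * snd y - Q * snd y'\<bar> \<le> Q * dist y y'"
      for y y' :: "real \<times> real"
      using Q(1) dist_fst_le[of y y'] dist_snd_le[of y y']
      by (auto simp: dist_real_def abs_mult simp flip: right_diff_distrib)
    define Z where "Z = {z :: int \<times> int. \<exists>y\<in>carpet_ball x r.
        \<bar>Q * fst y - (2 * of_int (fst z) + 1)\<bar> \<le> 1 \<and> \<bar>Q * snd y - (2 * of_int (snd z) + 1)\<bar> \<le> 1}"
    have Z: "finite Z" "card Z \<le> 576"
    proof -
      define A where "A = \<lfloor>(Q * fst x - 1) / 2\<rfloor>"
      define B where "B = \<lfloor>(Q * snd x - 1) / 2\<rfloor>"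
      have range: "k \<in> {\<lfloor>(q - 1) / 2\<rfloor> - 11..\<lfloor>(q - 1) / 2\<rfloor> + 12}"
        if "\<bar>q' - (2 * of_int k + 1)\<bar> \<le> 1" "\<bar>q - q'\<bar> < 21" for q q' :: real and k :: int
      proof -
        define j where "j = \<lfloor>(q - 1) / 2\<rfloor>"
        have "real_of_int j \<le> (q - 1) / 2" "(q - 1) / 2 < real_of_int j + 1"
          unfolding j_def by linarith+
        then have "real_of_int j - 12 < of_int k" "real_of_int k < of_int j + 12"
          using that by (simp_all add: abs_less_iff abs_le_iff)
        then have "k \<in> {j - 11..j + 12}" by auto
        then show ?thesis unfolding j_def .
      qed
      have sub: "Z \<subseteq> {A - 11..A + 12} \<times> {B - 11..B + 12}"
      proof
        fix z assume "z \<in> Z"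
        then obtain y where y: "dist x y < r" "\<bar>Q * fst y - (2 * of_int (fst z) + 1)\<bar> \<le> 1"
          "\<bar>Q * snd y - (2 * of_int (snd z) + 1)\<bar> \<le> 1" by (auto simp: Z_def carpet_ball_def)
        have "Q * dist x y < 21" using y(1) Q by (smt (verit) mult_strict_left_mono)
        then have "\<bar>Q * fst x - Q * fst y\<bar> < 21" "\<bar>Q * snd x - Q * snd y\<bar> < 21"
          using scaled[of x y] by linarith+
        then show "z \<in> {A - 11..A + 12} \<times> {B - 11..B + 12}"
          using range[OF y(2)] range[OF y(3)] unfolding A_def B_def mem_Times_iff by blast
      qed
      then show "finite Z" by (rule finite_subset) simp
      have "card Z \<le> card ({A - 11..A + 12} \<times> {B - 11..B + 12})"
        using sub by (intro card_mono) auto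
      then show "card Z \<le> 576" by (simp add: card_cartesian_product)
    qed
    define g0 where "g0 = (\<lambda>y. \<Sum>z\<in>Z. T z y)"
    have g0: "g0 \<in> FC" "energy_norm g0 \<le> (\<Sum>z\<in>Z. energy_norm (T z))"
      using energy_norm_sum[OF Z(1), of T] T(1) by (auto simp: g0_def)
    define g where "g = (\<lambda>t. min 1 t) \<circ> g0"
    have lip: "1-lipschitz_on UNIV (\<lambda>t::real. min 1 t)"
      by (rule lipschitz_onI) (auto simp: dist_real_def min_def)
    have gF: "g \<in> F" "\<E> g \<le> \<E> g0"
      using lipschitz_energy[OF lip, of g0] g0(1) by (auto simp: g_def FC_iff)
    have "continuous_on carpet (\<lambda>y. min 1 (g0 y))"
      using g0(1) by (intro continuous_intros) (simp add: FC_iff)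
    then have g: "g \<in> FC" using gF by (simp add: FC_iff g_def o_def)
    have one: "g y = 1" if y: "y \<in> carpet_ball x r" for y
    proof -
      have yc: "y \<in> carpet" using y by (simp add: carpet_ball_def)
      \<comment> \<open>The vertex nearest to \<open>y\<close>: the odd integer nearest to a real number \<open>q\<close> is \<open>2 * \<lfloor>q / 2\<rfloor> + 1\<close>.\<close>
      define z where "z = (\<lfloor>Q * fst y / 2\<rfloor>, \<lfloor>Q * snd y / 2\<rfloor>)"
      have z: "\<bar>Q * fst y - (2 * of_int (fst z) + 1)\<bar> \<le> 1" "\<bar>Q * snd y - (2 * of_int (snd z) + 1)\<bar> \<le> 1"
        unfolding z_def fst_conv snd_conv by linarith+
      then have "z \<in> Z" using y by (auto simp: Z_def)
      then have "T z y \<le> g0 y"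
        unfolding g0_def using Z(1) T(3)[OF yc] by (intro member_le_sum) auto
      then show ?thesis using T(4)[OF yc z] by (simp add: g_def)
    qed
    have supp: "cont_support g \<subseteq> carpet_ball x (2 * r)"
    proof -
      have "y \<in> carpet \<inter> cball x (13 / 7 * r)" if y: "y \<in> carpet" "g y \<noteq> 0" for y
      proof -
        have "\<exists>z\<in>Z. T z y \<noteq> 0"
        proof (rule ccontr)
          assume "\<not> ?thesis"
          then have "g y = 0" by (simp add: g_def g0_def)
          then show False using y(2) by simp
        qed
        then obtain z where z: "z \<in> Z" "T z y \<noteq> 0" by blast
        obtain y' where y': "dist x y' < r" "\<bar>Q * fst y' - (2 * of_int (fst z) + 1)\<bar> \<le> 1"
          "\<bar>Q * snd y' - (2 * of_int (snd z) + 1)\<bar> \<le> 1"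
          using z(1) by (auto simp: Z_def carpet_ball_def)
        have "\<bar>Q * fst y' - Q * fst y\<bar> \<le> 3" "\<bar>Q * snd y' - Q * snd y\<bar> \<le> 3"
          using T(5)[OF y(1) z(2)] y'(2,3) by linarith+
        then have "Q * \<bar>fst y' - fst y\<bar> \<le> 3" "Q * \<bar>snd y' - snd y\<bar> \<le> 3"
          using Q(1) by (auto simp: abs_mult simp flip: right_diff_distrib)
        then have "Q * dist y' y \<le> 6"
          using mult_left_mono[OF dist_le_coords[of y' y], of Q] Q(1) by (simp add: distrib_left)
        then have "Q * dist y' y \<le> Q * (6 / 7 * r)" using Q(2) by simp
        then have "dist y' y \<le> 6 / 7 * r" using Q(1) by simp
        then have "dist x y \<le> 13 / 7 * r" using y'(1) dist_triangle[of x y y'] by linarith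
        then show ?thesis using y(1) by simp
      qed
      then have "closure {y \<in> carpet. g y \<noteq> 0} \<subseteq> carpet \<inter> cball x (13 / 7 * r)"
        by (intro closure_minimal closed_Int carpet_closed closed_cball) blast
      also have "\<dots> \<subseteq> carpet_ball x (2 * r)" using r by (auto simp: carpet_ball_def)
      finally show ?thesis by (simp add: cont_support_def)
    qed
    have meas: "1 / 8 ^ N \<le> measure m (carpet_ball x r)"
    proof -
      obtain w where w: "w \<in> words N" "x \<in> cell w" using cell_of_point[OF x] .
      have "cell w \<subseteq> carpet_ball x r"
      proof
        fix y assume y: "y \<in> cell w"
        have "dist x y \<le> (4 + 4 * of_int 0) / 3 ^ N" by (rule cell_dist[OF w(1) w(1) w(2) y]) auto
        moreover have "4 / 3 ^ N < (7 / 3 ^ N :: real)" by (intro divide_strict_right_mono) auto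
        ultimately have "dist x y < r" using N(1) by simp
        then show "y \<in> carpet_ball x r" using y cell_subset[OF w(1)] by (auto simp: carpet_ball_def)
      qed
      then have "measure m (cell w) \<le> measure m (carpet_ball x r)"
        by (intro finite_measure_mono carpet_ball_sets)
      then show ?thesis by (simp add: measure_cell[OF w(1)])
    qed
    define M where "M = (C * \<rho> ^ N) powr (1 / p)"
    have Mp: "M powr p = C * \<rho> ^ N" using C(1) rho_pos p_gt_1 by (simp add: M_def powr_powr)
    have "energy_norm (T z) \<le> M" for z
      unfolding energy_norm_def M_def
      using T(1,2)[of z] p_gt_1 energy_nonneg[of "T z"] by (intro powr_mono2) (auto simp: FC_iff)
    then have "(\<Sum>z\<in>Z. energy_norm (T z)) \<le> real (card Z) * M" by (intro sum_bounded_above)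
    also have "\<dots> \<le> 576 * M" using Z(2) by (intro mult_right_mono) (auto simp: M_def)
    finally have "energy_norm g0 \<le> 576 * M" using g0(2) by linarith
    then have "energy_norm g0 powr p \<le> (576 * M) powr p"
      using p_gt_1 by (intro powr_mono2) auto
    then have "\<E> g \<le> 576 powr p * C * \<rho> ^ N"
      using gF(2) energy_eq[of g0] g0(1) by (simp add: FC_iff powr_mult Mp mult.assoc)
    also have "\<dots> = D * ((1 / 8 ^ N) / (21 / 3 ^ N) powr walk_dim \<rho>)"
    proof -
      have "(21 / 3 ^ N) powr walk_dim \<rho> = 21 powr walk_dim \<rho> * (1 / 3 ^ N) powr walk_dim \<rho>"
        by (simp flip: powr_mult)
      also have "\<dots> = 21 powr walk_dim \<rho> / (8 ^ N * \<rho> ^ N)"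
        unfolding powr_walk_dim[OF rho_pos] by (simp add: power_mult_distrib)
      finally show ?thesis using rho_pos by (simp add: D_def)
    qed
    also have "\<dots> \<le> D * (measure m (carpet_ball x r) / r powr walk_dim \<rho>)"
      using D meas wd N(2) r by (intro mult_left_mono frac_le powr_mono2) auto
    finally show ?thesis using g one supp by blast
  qed
  then show ?thesis using D by blast
qed

end

theorem theorem1p5:
  fixes p \<rho> :: real
    and m :: "(real \<times> real) measure"
    and \<E> :: "(real \<times> real \<Rightarrow> real) \<Rightarrow> real"
    and \<mm> :: "(real \<times> real \<Rightarrow> real) \<Rightarrow> (nat \<Rightarrow> nat) measure"
  assumes "1 < p"
    and "is_carpet_measure m"
    and "is_scaling_constant p \<rho>"
    and "sobolev_regular p \<rho> m"
    and "is_self_similar_energy p \<rho> m \<E>"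
    and "\<forall>f\<in>sobolev p \<rho> m. is_symbolic_energy_measure \<rho> \<E> f (\<mm> f)"
  shows "\<exists>C\<ge>1. \<exists>A\<ge>1. \<forall>x\<in>carpet. \<forall>r>0.
    (\<forall>f\<in>sobolev p \<rho> m.
       (LINT y:carpet_ball x r|m.
          \<bar>f y - (LINT z:carpet_ball x r|m. f z) / measure m (carpet_ball x r)\<bar> powr p)
       \<le> C * r powr walk_dim \<rho> * measure (energy_measure (\<mm> f)) (carpet_ball x (A * r))) \<and>
    (INF g\<in>{g \<in> sobolev_cont p \<rho> m. (\<forall>y\<in>carpet_ball x r. g y = 1) \<and>
               cont_support g \<subseteq> carpet_ball x (2 * r)}. ereal (\<E> g))
       \<le> ereal (C * (measure m (carpet_ball x r) / r powr walk_dim \<rho>))"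
proof -
  interpret carpet_energy m p \<rho> \<E>
    using assms(1-5) by unfold_locales
  obtain C1 where C1: "C1 \<ge> 0" "\<And>x r f \<mu>. x \<in> carpet \<Longrightarrow> r > 0 \<Longrightarrow> f \<in> F \<Longrightarrow>
     is_symbolic_energy_measure \<rho> \<E> f \<mu> \<Longrightarrow>
     (LINT y:carpet_ball x r|m.
        \<bar>f y - (LINT z:carpet_ball x r|m. f z) / measure m (carpet_ball x r)\<bar> powr p)
     \<le> C1 * r powr walk_dim \<rho> * measure (energy_measure \<mu>) (carpet_ball x (24 * r))"
    using poincare_ball by blast
  obtain C2 where C2: "C2 \<ge> 0" "\<And>x r. x \<in> carpet \<Longrightarrow> r > 0 \<Longrightarrow> \<exists>g\<in>FC. (\<forall>y\<in>carpet_ball x r. g y = 1) \<and>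
     cont_support g \<subseteq> carpet_ball x (2 * r) \<and>
     \<E> g \<le> C2 * (measure m (carpet_ball x r) / r powr walk_dim \<rho>)"
    using capacity_ball by blast
  define C where "C = max 1 (max C1 C2)"
  have C: "C \<ge> 1" "C1 \<le> C" "C2 \<le> C" by (auto simp: C_def)
  show ?thesis
  proof (rule exI[of _ C], rule conjI[OF C(1)], rule exI[of _ 24], intro conjI ballI allI impI)
    fix x and r :: real and f assume xr: "x \<in> carpet" "0 < r" and f: "f \<in> F"
    note C1(2)[OF xr f bspec[OF assms(6) f]]
    also have "C1 * r powr walk_dim \<rho> * measure (energy_measure (\<mm> f)) (carpet_ball x (24 * r))
        \<le> C * r powr walk_dim \<rho> * measure (energy_measure (\<mm> f)) (carpet_ball x (24 * r))"
      using C by (intro mult_right_mono) auto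
    finally show "(LINT y:carpet_ball x r|m.
        \<bar>f y - (LINT z:carpet_ball x r|m. f z) / measure m (carpet_ball x r)\<bar> powr p)
     \<le> C * r powr walk_dim \<rho> * measure (energy_measure (\<mm> f)) (carpet_ball x (24 * r))" .
  next
    fix x and r :: real assume xr: "x \<in> carpet" "0 < r"
    obtain g where g: "g \<in> FC" "\<forall>y\<in>carpet_ball x r. g y = 1" "cont_support g \<subseteq> carpet_ball x (2 * r)"
      "\<E> g \<le> C2 * (measure m (carpet_ball x r) / r powr walk_dim \<rho>)"
      using C2(2)[OF xr] by blast
    have "(INF g\<in>{g \<in> FC. (\<forall>y\<in>carpet_ball x r. g y = 1) \<and>
               cont_support g \<subseteq> carpet_ball x (2 * r)}. ereal (\<E> g)) \<le> ereal (\<E> g)"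
      using g by (intro INF_lower) auto
    also have "\<E> g \<le> C * (measure m (carpet_ball x r) / r powr walk_dim \<rho>)"
      using g(4) mult_right_mono[OF C(3), of "measure m (carpet_ball x r) / r powr walk_dim \<rho>"]
      by simp
    finally show "(INF g\<in>{g \<in> FC. (\<forall>y\<in>carpet_ball x r. g y = 1) \<and>
               cont_support g \<subseteq> carpet_ball x (2 * r)}. ereal (\<E> g))
        \<le> ereal (C * (measure m (carpet_ball x r) / r powr walk_dim \<rho>))" by simp
  qed simp
qed

end
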